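(* Every smooth cubic surface $S\subset\mathbb{P}^3_{\mathbb{Q}}$ defined over $\mathbb{Q}$ contains exactly $n$ lines defined over $\mathbb{Q}$ for some $n\in\{0,1,2,3,5,7,9,15,27\}$. Moreover, for each $n\in\{0,1,2,3,5,7,9,15,27\}$ there exists a smooth cubic surface over $\mathbb{Q}$ containing exactly $n$ lines defined over $\mathbb{Q}$.
   Context: A line on a smooth cubic surface $S$ over a field $k$ is "defined over $k$" (a $k$-rational line) if it is a line $L\subset\mathbb{P}^3_k$ (i.e. cut out by linear forms with coefficients in $k$) with $L\subseteq S$ as schemes; equivalently, one of the 27 lines of $S_{\overline{k}}$ whose defining ideal is generated by polynomials with coefficients in $k$. *)

theory Defs
  imports Complex_Main "HOL-Analysis.Finite_Cartesian_Product"
begin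

text \<open>Homogeneous coordinates x0..x3 of P^3 are the components of a vector of type 'a^4.
  A cubic form over Q is given by its 20 rational coefficients, indexed by exponent
  vectors (i,j,k,l) with i+j+k+l = 3.\<close>

type_synonym cubic_coeffs = "nat \<times> nat \<times> nat \<times> nat \<Rightarrow> rat"

definition mons3 :: "(nat \<times> nat \<times> nat \<times> nat) set" where
  "mons3 = {(i,j,k,l). i + j + k + l = 3}"

definition cubic_eval :: "cubic_coeffs \<Rightarrow> 'a::field_char_0 ^ 4 \<Rightarrow> 'a" where
  "cubic_eval c x = (\<Sum>(i,j,k,l)\<in>mons3.
      of_rat (c (i,j,k,l)) * x$0 ^ i * x$1 ^ j * x$2 ^ k * x$3 ^ l)"

definition cubic_d0 :: "cubic_coeffs \<Rightarrow> 'a::field_char_0 ^ 4 \<Rightarrow> 'a" where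
  "cubic_d0 c x = (\<Sum>(i,j,k,l)\<in>mons3.
      of_rat (c (i,j,k,l)) * of_nat i * x$0 ^ (i - 1) * x$1 ^ j * x$2 ^ k * x$3 ^ l)"
definition cubic_d1 :: "cubic_coeffs \<Rightarrow> 'a::field_char_0 ^ 4 \<Rightarrow> 'a" where
  "cubic_d1 c x = (\<Sum>(i,j,k,l)\<in>mons3.
      of_rat (c (i,j,k,l)) * of_nat j * x$0 ^ i * x$1 ^ (j - 1) * x$2 ^ k * x$3 ^ l)"
definition cubic_d2 :: "cubic_coeffs \<Rightarrow> 'a::field_char_0 ^ 4 \<Rightarrow> 'a" where
  "cubic_d2 c x = (\<Sum>(i,j,k,l)\<in>mons3.
      of_rat (c (i,j,k,l)) * of_nat k * x$0 ^ i * x$1 ^ j * x$2 ^ (k - 1) * x$3 ^ l)"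
definition cubic_d3 :: "cubic_coeffs \<Rightarrow> 'a::field_char_0 ^ 4 \<Rightarrow> 'a" where
  "cubic_d3 c x = (\<Sum>(i,j,k,l)\<in>mons3.
      of_rat (c (i,j,k,l)) * of_nat l * x$0 ^ i * x$1 ^ j * x$2 ^ k * x$3 ^ (l - 1))"

text \<open>Smoothness of the cubic surface F = 0: the partial derivatives have no common
  nontrivial zero over an algebraically closed field (we use the complex numbers,
  which contain an algebraic closure of Q).  This also forces F \<noteq> 0.\<close>
definition smooth_cubic :: "cubic_coeffs \<Rightarrow> bool" where
  "smooth_cubic c \<longleftrightarrow>
     (\<forall>z :: complex ^ 4. cubic_d0 c z = 0 \<and> cubic_d1 c z = 0 \<and> cubic_d2 c z = 0
        \<and> cubic_d3 c z = 0 \<longrightarrow> z = 0)"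

text \<open>A Q-rational line of P^3, identified with the 2-dimensional subspace of Q^4
  spanned by two linearly independent vectors.\<close>
definition rat_line :: "(rat ^ 4) set \<Rightarrow> bool" where
  "rat_line L \<longleftrightarrow> (\<exists>u v :: rat ^ 4.
      (\<forall>a b. (\<forall>i. a * u$i + b * v$i = 0) \<longrightarrow> a = 0 \<and> b = 0) \<and>
      L = {(\<chi> i. a * u$i + b * v$i) | a b. True})"

text \<open>The set of Q-rational lines contained in the surface c: the cubic form vanishes
  on the whole subspace (equivalently, since Q is infinite, it lies in the ideal of L).\<close>
definition rat_lines_on :: "cubic_coeffs \<Rightarrow> (rat ^ 4) set set" where
  "rat_lines_on c = {L. rat_line L \<and> (\<forall>x\<in>L. cubic_eval c x = 0)}"

end

(*
Call two lines of the surface adjacent if they meet. Two meeting lines span a plane, whose section is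
a triangle of three distinct rational lines, and every other line meets exactly one side of it. Given
four pairwise skew rational lines, the first three have three transversals on the surface; the fourth
meets at most two of them, and the remaining one is rational. These incidence properties determine the
count: for two skew lines x, y with f common neighbours one finds f = 0, 1, 2, 3 or 5, and the number of
lines is 2 or 3 for f = 0, 5 or 7 for f = 1 and 6f - 3 for f >= 2; if no two lines are skew it is 0, 1 or 3.

For the converse, diagonal surfaces give 0, 1 and 3 lines. For the surfaces
x0^2 x3 - x1^2 x2 + x0 q(x2,x3) + x1 r(x2,x3) = 0, the common neighbours of the skew lines x2 = x3 = 0
and x0 = x1 = 0 correspond to the rational roots of a binary quintic, which can be prescribed.
*)
theory Submission
  imports Defs "HOL-Analysis.Analysis"
begin

section \<open>Incidence of lines\<close>

text \<open>All counting takes place among rational lines; the 27 geometric lines never appear. For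
  skew \<open>x\<close>, \<open>y\<close> each triangle through \<open>x\<close> contains exactly
  one neighbour of \<open>y\<close>, so \<open>x\<close> and \<open>y\<close> both have 2f
  neighbours. When f >= 2, chains of skew pairs carry this degree to every side of one triangle, and
  sorting the other lines by the side they meet gives 3 + 3(2f - 2) = 6f - 3. The obstacle is f <=
  1. Plane sections alone give no bound there: arbitrarily many isolated lines, or arbitrarily many
  triangles sharing one line, satisfy all axioms but \<open>transversal\<close>. That axiom is used
  only in these two cases. Complex points enter only through nonsingularity. A plane tangent along a
  rational line forces a singular point over a root of a rational binary quadratic, and such a root
  may be irrational.\<close>

text \<open>The triangles are the plane sections consisting of three lines; \<open>transversal\<close> is the rational
  residue of the intersection of the surface with the quadric through three skew lines.\<close>

locale line_configuration =
  fixes P :: "'a set" and adj :: "'a \<Rightarrow> 'a \<Rightarrow> bool"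
  assumes adj_in: "adj x y \<Longrightarrow> x \<in> P"
    and adj_sym: "adj x y \<Longrightarrow> adj y x"
    and adj_irrefl: "\<not> adj x x"
    and third_ex: "adj x y \<Longrightarrow> \<exists>z. adj x z \<and> adj y z"
    and third_unique: "adj x y \<Longrightarrow> adj x z \<Longrightarrow> adj y z \<Longrightarrow> adj x w \<Longrightarrow> adj y w \<Longrightarrow> z = w"
    and triangle: "adj x y \<Longrightarrow> adj x z \<Longrightarrow> adj y z \<Longrightarrow> w \<in> P \<Longrightarrow>
      w = x \<or> w = y \<or> w = z \<or> adj w x \<or> adj w y \<or> adj w z"
    and transversal: "distinct [a, b, c, d] \<Longrightarrow> {a, b, c, d} \<subseteq> P \<Longrightarrow>
      \<not> adj a b \<Longrightarrow> \<not> adj a c \<Longrightarrow> \<not> adj a d \<Longrightarrow> \<not> adj b c \<Longrightarrow> \<not> adj b d \<Longrightarrow> \<not> adj c d \<Longrightarrow>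
      \<exists>y. adj y a \<and> adj y b \<and> adj y c \<and> \<not> adj y d"
begin

definition third :: "'a \<Rightarrow> 'a \<Rightarrow> 'a" where
  "third x y = (THE z. adj x z \<and> adj y z)"

definition common :: "'a \<Rightarrow> 'a \<Rightarrow> 'a set" where
  "common x y = {z. adj x z \<and> adj y z}"

lemma third_adj:
  assumes "adj x y" shows "adj x (third x y)" "adj y (third x y)"
proof -
  have "\<exists>!z. adj x z \<and> adj y z"
    using third_ex[OF assms] third_unique[OF assms] by blast
  from theI'[OF this] show "adj x (third x y)" "adj y (third x y)"
    unfolding third_def by auto
qed

lemma third_eq: "adj x y \<Longrightarrow> adj x z \<Longrightarrow> adj y z \<Longrightarrow> third x y = z"
  using third_adj third_unique by blast

lemma third_third: "adj x y \<Longrightarrow> third x (third x y) = y"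
  using third_adj third_eq adj_sym by blast

text \<open>A line meeting two sides of a triangle equals the third side by uniqueness, so "at least
  one" in \<open>triangle\<close> becomes "exactly one".\<close>

lemma triangle_cases:
  assumes "adj x y" "w \<in> P" "w \<noteq> x" "w \<noteq> y" "w \<noteq> third x y"
  shows "adj w x \<and> \<not> adj w y \<and> \<not> adj w (third x y) \<or>
    \<not> adj w x \<and> adj w y \<and> \<not> adj w (third x y) \<or>
    \<not> adj w x \<and> \<not> adj w y \<and> adj w (third x y)"
proof -
  let ?z = "third x y"
  have t: "adj x ?z" "adj y ?z" using third_adj[OF assms(1)] by auto
  have "\<not> (adj w x \<and> adj w y)"
    using third_eq[OF assms(1)] assms(5) adj_sym by blast
  moreover have "\<not> (adj w x \<and> adj w ?z)"
    using third_eq[OF t(1)] third_eq[OF t(1) assms(1)] assms(4) adj_sym[OF t(2)] adj_sym by metis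
  moreover have "\<not> (adj w y \<and> adj w ?z)"
    using third_eq[OF t(2)] third_eq[OF t(2) adj_sym[OF assms(1)]] assms(3) adj_sym[OF t(1)] adj_sym by metis
  ultimately show ?thesis
    using triangle[OF assms(1) t assms(2)] assms(3-5) by blast
qed

lemma common_sym: "common x y = common y x"
  unfolding common_def by auto

text \<open>In the triangle formed by \<open>x\<close>, \<open>z\<close> and
  \<open>third x z\<close> the line \<open>y\<close> already meets \<open>z\<close>, hence misses
  the other two sides.\<close>

lemma third_common:
  assumes "x \<in> P" "y \<in> P" "x \<noteq> y" "\<not> adj x y" "z \<in> common x y"
  shows "adj x (third x z)" "\<not> adj (third x z) y" "third x z \<noteq> y" "third x z \<noteq> z" "third x z \<in> P"
proof -
  have z: "adj x z" "adj y z" using assms(5) unfolding common_def by auto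
  show x: "adj x (third x z)" using third_adj[OF z(1)] by auto
  show "third x z \<noteq> y" using x assms(4) by auto
  then have "\<not> adj y (third x z)" 
    using triangle_cases[OF z(1) assms(2)] assms(3) z(2) assms(4) adj_sym adj_irrefl by metis
  then show "\<not> adj (third x z) y" using adj_sym by blast
  show "third x z \<noteq> z" "third x z \<in> P"
    using third_adj[OF z(1)] adj_irrefl adj_in adj_sym by metis+
qed

text \<open>Every triangle through \<open>x\<close> contains exactly one neighbour of \<open>y\<close>.\<close>

lemma neighbours_nonadjacent:
  assumes "x \<in> P" "y \<in> P" "x \<noteq> y" "\<not> adj x y"
  shows "{z. adj x z} = common x y \<union> third x ` common x y"
    and "common x y \<inter> third x ` common x y = {}"
    and "inj_on (third x) (common x y)"
proof -
  show "{z. adj x z} = common x y \<union> third x ` common x y" (is "?A = ?B")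
  proof
    show "?B \<subseteq> ?A" using third_common[OF assms] unfolding common_def by auto
    show "?A \<subseteq> ?B"
    proof
      fix z assume "z \<in> ?A"
      then have z: "adj x z" by simp
      show "z \<in> ?B"
      proof (cases "adj y z")
        case True then show ?thesis using z unfolding common_def by auto
      next
        case False
        have "y \<noteq> z" "y \<noteq> third x z" using z third_adj(1)[OF z] assms(4) by auto
        then have "adj y (third x z)"
          using triangle_cases[OF z assms(2)] assms(3,4) False adj_sym by metis
        then have "third x z \<in> common x y" using third_adj[OF z] unfolding common_def by auto
        then show ?thesis using third_third[OF z] by (metis UnI2 imageI)
      qed
    qed
  qed
  show "common x y \<inter> third x ` common x y = {}"
    using third_common(2)[OF assms] adj_sym unfolding common_def by blast
  show "inj_on (third x) (common x y)"
    by (rule inj_on_inverseI[where g = "third x"]) (auto simp: common_def third_third)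
qed

lemma degree_nonadjacent:
  assumes "x \<in> P" "y \<in> P" "x \<noteq> y" "\<not> adj x y"
  shows "card {z. adj x z} = 2 * card (common x y)"
    and "finite {z. adj x z} \<longleftrightarrow> finite (common x y)"
proof -
  note n = neighbours_nonadjacent[OF assms]
  show "finite {z. adj x z} \<longleftrightarrow> finite (common x y)" using n(1) by auto
  show "card {z. adj x z} = 2 * card (common x y)"
  proof (cases "finite (common x y)")
    case True
    then show ?thesis using n(1) card_Un_disjoint[OF True _ n(2)] card_image[OF n(3)] by simp
  next
    case False
    then show ?thesis using n(1) by simp
  qed
qed

section \<open>Two skew lines and their common neighbours\<close>

context
  fixes x y
  assumes xP: "x \<in> P" and yP: "y \<in> P" and xy: "x \<noteq> y" and nadj: "\<not> adj x y"
begin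

lemma nadj': "\<not> adj y x" using nadj adj_sym by blast

lemmas third_x = third_common[OF xP yP xy nadj]
lemmas third_y = third_common[OF yP xP xy[symmetric] nadj', unfolded common_sym[of y]]

text \<open>Otherwise \<open>x\<close> and \<open>y\<close> would both complete \<open>i\<close>,
  \<open>j\<close> to a triangle and would coincide.\<close>

lemma common_nonadjacent:
  assumes "i \<in> common x y" "j \<in> common x y"
  shows "\<not> adj i j"
  using assms third_unique[of i j x y] xy adj_sym unfolding common_def by blast

lemma third_x_common:
  assumes i: "i \<in> common x y" and j: "j \<in> common x y" and ij: "i \<noteq> j"
  shows "\<not> adj (third x i) j" "third x i \<noteq> j"
proof -
  have a: "adj x i" "adj x j" using i j unfolding common_def by auto
  show n: "third x i \<noteq> j" using third_x(2)[OF i] j adj_sym unfolding common_def by blast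
  have "j \<in> P" "j \<noteq> x" using a adj_in adj_sym adj_irrefl by blast+
  then show "\<not> adj (third x i) j"
    using triangle_cases[OF a(1), of j] n ij a adj_sym by metis
qed

lemma third_y_common:
  assumes i: "i \<in> common x y" and j: "j \<in> common x y" and ij: "i \<noteq> j"
  shows "\<not> adj (third y i) j" "third y i \<noteq> j"
proof -
  have a: "adj y i" "adj y j" using i j unfolding common_def by auto
  show n: "third y i \<noteq> j" using third_y(2)[OF i] j adj_sym unfolding common_def by blast
  have "j \<in> P" "j \<noteq> y" using a adj_in adj_sym adj_irrefl by blast+
  then show "\<not> adj (third y i) j"
    using triangle_cases[OF a(1), of j] n ij a adj_sym by metis
qed

text \<open>\<open>third x i\<close> misses \<open>y\<close> and meets \<open>j\<close> exactly when
  \<open>i = j\<close>; the triangle of \<open>y\<close>, \<open>j\<close>, \<open>third y j\<close>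
  leaves the last side for the case \<open>i \<noteq> j\<close>.\<close>

lemma third_x_third_y:
  assumes i: "i \<in> common x y" and j: "j \<in> common x y"
  shows "adj (third x i) (third y j) \<longleftrightarrow> i \<noteq> j" "third x i \<noteq> third y j"
proof -
  have a: "adj y j" "adj y i" "adj x i" using i j unfolding common_def by auto
  show n: "third x i \<noteq> third y j" using third_x(2)[OF i] third_y(1)[OF j] adj_sym by metis
  have b: "third x i \<in> P" "third x i \<noteq> y" "\<not> adj (third x i) y"
    using third_x[OF i] by auto
  show "adj (third x i) (third y j) \<longleftrightarrow> i \<noteq> j"
  proof (cases "i = j")
    case True
    have "adj (third x i) i" "third x i \<noteq> i" using third_adj(2)[OF a(3)] third_x(4)[OF i] adj_sym by auto
    then show ?thesis using triangle_cases[OF a(1) b(1,2)] n True by metis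
  next
    case False
    then show ?thesis
      using triangle_cases[OF a(1) b(1,2) third_x_common(2)[OF i j False] n]
        third_x_common(1)[OF i j False] b(3) by metis
  qed
qed

abbreviation apex :: "'a \<Rightarrow> 'a \<Rightarrow> 'a" where
  "apex i j \<equiv> third (third x i) (third y j)"

text \<open>For \<open>w\<close> skew to \<open>x\<close> this records on which side of the triangle
  \<open>x\<close>, \<open>q\<close>, \<open>third x q\<close> the line \<open>w\<close> meets it:
  at \<open>third x q\<close> for \<open>q\<close> in \<open>side w\<close>, at \<open>q\<close>
  itself otherwise (\<open>skew_cases\<close>). It serves as the coordinate vector of
  \<open>w\<close>.\<close>

definition side :: "'a \<Rightarrow> 'a set" where
  "side w = {q \<in> common x y. adj w (third x q)}"

lemma skew_cases:
  assumes "w \<in> P" "\<not> adj w x" "w \<noteq> x" "q \<in> common x y" "w \<noteq> q" "w \<noteq> third x q"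
  shows "adj w q \<longleftrightarrow> q \<notin> side w"
proof -
  have "adj x q" using assms(4) unfolding common_def by auto
  from triangle_cases[OF this assms(1,3,5,6)] show ?thesis
    using assms(2,4) unfolding side_def by blast
qed

text \<open>The line misses \<open>y\<close> and meets \<open>third y j\<close>, so it misses
  \<open>j\<close>; missing also \<open>x\<close>, it must meet \<open>third x j\<close>. This is
  why its \<open>side\<close> is symmetric in \<open>i\<close> and \<open>j\<close> although the
  construction is not.\<close>

lemma apex:
  assumes i: "i \<in> common x y" and j: "j \<in> common x y" and ij: "i \<noteq> j"
  shows "apex i j \<in> P" "\<not> adj (apex i j) x" "\<not> adj (apex i j) y" "apex i j \<noteq> x" "apex i j \<noteq> y"
    "apex i j \<notin> common x y" "side (apex i j) = {i, j}"
proof -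
  let ?w = "apex i j"
  have A: "adj (third x i) (third y j)" using third_x_third_y i j ij by auto
  have w: "adj (third x i) ?w" "adj (third y j) ?w" using third_adj[OF A] by auto
  have w': "adj ?w (third x i)" "adj ?w (third y j)" using w adj_sym by auto
  have ax: "adj x i" "adj x j" "adj y i" "adj y j" using i j unfolding common_def by auto
  show P: "?w \<in> P" using w adj_in adj_sym by blast
  have nij: "\<not> adj (third x i) j" "\<not> adj (third y j) i"
    using third_x_common[OF i j ij] third_y_common[OF j i] ij by auto
  show wx: "?w \<noteq> x" using w third_y(2)[OF j] by metis
  show wy: "?w \<noteq> y" using w third_x(2)[OF i] by metis
  have wi: "?w \<noteq> i" "?w \<noteq> j" using w nij by metis+
  have wxi: "?w \<noteq> third x i" "?w \<noteq> third y j" using w adj_irrefl by metis+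
  show wnx: "\<not> adj ?w x" using triangle_cases[OF ax(1) P wx wi(1) wxi(1)] w' by metis
  show wny: "\<not> adj ?w y" using triangle_cases[OF ax(4) P wy wi(2) wxi(2)] w' by metis
  show nc: "?w \<notin> common x y" using wnx adj_sym unfolding common_def by blast
  have wj: "\<not> adj ?w j" using triangle_cases[OF ax(4) P wy wi(2) wxi(2)] w' by metis
  have xj: "?w \<noteq> third x j" using wnx third_x(1)[OF j] adj_sym by metis
  have wxj: "adj ?w (third x j)" using triangle_cases[OF ax(2) P wx wi(2) xj] wnx wj by metis
  \<comment> \<open>\<open>third x q\<close> and \<open>third x i\<close> would both complete the
    triangle on \<open>third y j\<close> and \<open>apex i j\<close>.\<close>
  have "\<not> adj ?w (third x q)" if q: "q \<in> common x y" "q \<noteq> i" "q \<noteq> j" for q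
  proof
    assume a: "adj ?w (third x q)"
    have "third x q \<noteq> third x i"
      using neighbours_nonadjacent(3)[OF xP yP xy nadj] q i by (auto dest: inj_onD)
    moreover have "adj (third x q) (third y j)" using third_x_third_y q j by auto
    ultimately show False
      using third_unique[OF w(2), of "third x q" "third x i"] a w' A adj_sym by blast
  qed
  then show "side ?w = {i, j}" unfolding side_def using i j w' wxj by auto
qed

text \<open>The line \<open>w = apex i j\<close> meets \<open>third x q\<close> for \<open>q \<in> {i, j}\<close> and \<open>q\<close> itself for every other common
  neighbour \<open>q\<close>. Passing to \<open>third w k\<close> turns the two-element set \<open>{i, j}\<close> into the complement of
  \<open>{i, j, k}\<close>; if this is not empty, \<open>third w k\<close> is an apex again, so the complement has two elements too.\<close>

lemma common_minus_three:
  assumes i: "i \<in> common x y" and j: "j \<in> common x y" and k: "k \<in> common x y"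
    and d: "i \<noteq> j" "i \<noteq> k" "j \<noteq> k" and m: "m \<in> common x y - {i, j, k}"
  shows "card (common x y - {i, j, k}) = 2"
proof -
  let ?w = "apex i j"
  note w = apex[OF i j d(1)]
  have wz: "adj ?w q \<longleftrightarrow> q \<notin> {i, j}" if "q \<in> common x y" for q
  proof -
    have "?w \<noteq> q" using w(6) that by auto
    moreover have "?w \<noteq> third x q" using w(2) adj_sym[OF third_x(1)[OF that]] by auto
    ultimately show ?thesis using skew_cases[OF w(1,2,4) that] w(7) by simp
  qed
  define v where "v = third ?w k"
  have wk: "adj ?w k" using wz k d by auto
  have ck: "adj x k" "adj y k" using k unfolding common_def by auto
  have v: "adj ?w v" "adj k v" using third_adj[OF wk] unfolding v_def by auto
  have v': "adj v ?w" "adj v k" using v adj_sym by auto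
  have vP: "v \<in> P" using v'(1) adj_in by blast
  have vx: "v \<noteq> x" "v \<noteq> y" using v w(2,3) by auto
  have xw: "\<not> adj x ?w" "\<not> adj y ?w" using w(2,3) adj_sym by blast+
  have kk: "x \<noteq> k" "y \<noteq> k" using ck adj_irrefl by metis+
  have nvx: "\<not> adj x v" 
    using triangle_cases[OF wk xP w(4)[symmetric] kk(1)] vx ck xw v_def by metis
  have nvy: "\<not> adj y v" 
    using triangle_cases[OF wk yP w(5)[symmetric] kk(2)] vx ck xw v_def by metis
  have nv: "\<not> adj v x" "\<not> adj v y" using nvx nvy adj_sym by blast+
  have vne: "v \<noteq> q" "v \<noteq> third x q" if "q \<in> common x y" for q
    using nvx third_x(1)[OF that] that unfolding common_def by auto
  have vz: "adj v q \<longleftrightarrow> q \<in> {i, j, k}" if q: "q \<in> common x y" for q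
  proof (cases "q = k")
    case True then show ?thesis using v' by auto
  next
    case False
    have "q \<in> P" "q \<noteq> ?w" using q w(6) adj_in adj_sym unfolding common_def by auto
    from triangle_cases[OF wk this False] vne(1)[OF q] common_nonadjacent[OF q k] wz[OF q] False
    show ?thesis unfolding v_def[symmetric] using adj_sym by (metis insert_iff empty_iff)
  qed
  have side_v: "side v = common x y - {i, j, k}"
  proof -
    have "q \<in> side v \<longleftrightarrow> q \<notin> {i, j, k}" if q: "q \<in> common x y" for q
      using skew_cases[OF vP nv(1) vx(1) q vne[OF q]] vz[OF q] by blast
    then show ?thesis unfolding side_def by blast
  qed
  have mc: "m \<in> common x y" and vm: "adj v (third x m)" using m side_v unfolding side_def by auto
  \<comment> \<open>\<open>y\<close> misses both \<open>third x m\<close> and \<open>v\<close>, so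
    it meets the third side \<open>u\<close> of their triangle. Hence \<open>u\<close> is some
    \<open>third y n\<close>, which exhibits \<open>v\<close> as \<open>apex m n\<close>.\<close>
  define u where "u = third (third x m) v"
  have u: "adj (third x m) u" "adj v u" using third_adj[OF adj_sym[OF vm]] unfolding u_def by auto
  have uy: "y \<noteq> u" using u(1) third_x(2)[OF mc] by auto
  have "adj y u"
    using triangle_cases[OF adj_sym[OF vm] yP] uy vx third_x(2,3)[OF mc] nvy adj_sym
    unfolding u_def[symmetric] by metis
  then have "u \<in> common x y \<union> third y ` common x y"
    using neighbours_nonadjacent(1)[OF yP xP xy[symmetric] nadj'] common_sym by blast
  moreover have "u \<notin> common x y"
  proof
    assume "u \<in> common x y"
    then have "adj x u" unfolding common_def by auto
    then have "x = v" using third_unique[OF u(1), of x v] third_x(1)[OF mc] vm u adj_sym by blast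
    then show False using vx by simp
  qed
  ultimately obtain n where n: "n \<in> common x y" "u = third y n" by auto
  have mn: "m \<noteq> n" using third_x_third_y(1)[OF mc n(1)] u(1) n(2) by simp
  have "apex m n = v" using third_eq[OF u(1)] vm u(2) adj_sym n(2) by blast
  then have "side v = {m, n}" using apex(7)[OF mc n(1) mn] by simp
  then show ?thesis using side_v mn by simp
qed

text \<open>Once three common neighbours exist, the remaining ones number 0 or 2; this excludes 4
  and everything above 5.\<close>

lemma card_common: "finite (common x y)" "card (common x y) \<in> {0, 1, 2, 3, 5}"
proof -
  have "finite (common x y) \<and> card (common x y) \<in> {0, 1, 2, 3, 5}"
  proof (cases "\<exists>i j k. i \<in> common x y \<and> j \<in> common x y \<and> k \<in> common x y \<and> i \<noteq> j \<and> i \<noteq> k \<and> j \<noteq> k")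
    case True
    then obtain i j k where c: "i \<in> common x y" "j \<in> common x y" "k \<in> common x y" "i \<noteq> j" "i \<noteq> k" "j \<noteq> k"
      by blast
    show ?thesis
    proof (cases "common x y - {i, j, k} = {}")
      case True
      then have "common x y = {i, j, k}" using c by blast
      then show ?thesis using c by simp
    next
      case False
      then obtain m where "m \<in> common x y - {i, j, k}" by blast
      define D where "D = common x y - {i, j, k}"
      have e: "card D = 2" using common_minus_three[OF c \<open>m \<in> _\<close>] unfolding D_def .
      then have f: "finite D" by (intro card_ge_0_finite) simp
      have u: "common x y = D \<union> {i, j, k}" using c unfolding D_def by blast
      have "D \<inter> {i, j, k} = {}" unfolding D_def by blast
      from card_Un_disjoint[OF f _ this] have "card (common x y) = 5" using c e unfolding u by simp
      then show ?thesis using card_ge_0_finite[of "common x y"] by simp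
    qed
  next
    case False
    show ?thesis
    proof (cases "\<exists>i j. i \<in> common x y \<and> j \<in> common x y \<and> i \<noteq> j")
      case True
      then obtain i j where c: "i \<in> common x y" "j \<in> common x y" "i \<noteq> j" by blast
      then have "common x y = {i, j}" using False by blast
      then show ?thesis using c by simp
    next
      case False
      then have "common x y = {} \<or> (\<exists>i. common x y = {i})" by blast
      then show ?thesis by auto
    qed
  qed
  then show "finite (common x y)" "card (common x y) \<in> {0, 1, 2, 3, 5}" by auto
qed

end

end

section \<open>Counting all lines of a configuration\<close>

context line_configuration
begin

lemma adj_ne: "adj x y \<Longrightarrow> x \<noteq> y"
  using adj_irrefl by blast

text \<open>Both degrees are twice \<open>card (common x y)\<close>, which is symmetric. The degree
  can therefore be transported along any chain of skew pairs.\<close>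

lemma card_nonadjacent_eq:
  assumes "x \<in> P" "y \<in> P" "x \<noteq> y" "\<not> adj x y"
  shows "finite {z. adj x z}" "card {z. adj y z} = card {z. adj x z}"
  using degree_nonadjacent[OF assms] card_common(1)[OF assms]
    degree_nonadjacent[OF assms(2,1) assms(3)[symmetric]] assms(4) adj_sym
    common_sym[of x y] by auto

text \<open>Every line off the triangle meets exactly one side, and the degree of a side also counts
  the two other sides: three lines minus six surplus counts explain the \<open>+ 3\<close>.\<close>

lemma card_triangle:
  assumes xc: "adj x c" and fin: "finite {z. adj x z}" "finite {z. adj c z}" "finite {z. adj (third x c) z}"
  shows "finite P" "card P + 3 = card {z. adj x z} + card {z. adj c z} + card {z. adj (third x c) z}"
proof -
  let ?t = "third x c"
  let ?T = "{x, c, ?t}"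
  have a: "adj x ?t" "adj c ?t" "adj c x" "adj ?t x" "adj ?t c"
    using third_adj[OF xc] xc adj_sym by auto
  have ne: "x \<noteq> c" "x \<noteq> ?t" "c \<noteq> ?t" using a adj_ne by blast+
  let ?X = "{z. adj x z} - {c, ?t}" and ?C = "{z. adj c z} - {x, ?t}" and ?U = "{z. adj ?t z} - {x, c}"
  have P: "P = ?T \<union> (?X \<union> (?C \<union> ?U))"
  proof
    show "?T \<union> (?X \<union> (?C \<union> ?U)) \<subseteq> P" using a adj_in adj_sym by blast
    show "P \<subseteq> ?T \<union> (?X \<union> (?C \<union> ?U))"
      using triangle_cases[OF xc] adj_sym by blast
  qed
  have d1: "?T \<inter> (?X \<union> (?C \<union> ?U)) = {}" using adj_irrefl by auto
  have d2: "?X \<inter> (?C \<union> ?U) = {}" "?C \<inter> ?U = {}"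
    using triangle_cases[OF xc] adj_sym adj_in by blast+
  show "finite P" unfolding P using fin by auto
  have s: "card {z. adj x z} = card ?X + 2" "card {z. adj c z} = card ?C + 2" "card {z. adj ?t z} = card ?U + 2"
    using card_Diff_subset[of "{c, ?t}" "{z. adj x z}"] card_mono[OF fin(1), of "{c, ?t}"]
      card_Diff_subset[of "{x, ?t}" "{z. adj c z}"] card_mono[OF fin(2), of "{x, ?t}"]
      card_Diff_subset[of "{x, c}" "{z. adj ?t z}"] card_mono[OF fin(3), of "{x, c}"]
      a ne xc by auto
  have "card P = 3 + (card ?X + (card ?C + card ?U))"
    unfolding P using d1 d2 fin ne
    by (subst card_Un_disjoint, simp, simp, simp, subst card_Un_disjoint, simp, simp, simp,
        subst card_Un_disjoint) auto
  then show "card P + 3 = card {z. adj x z} + card {z. adj c z} + card {z. adj (third x c) z}"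
    using s by simp
qed

text \<open>In the triangle \<open>x\<close>, \<open>c\<close>, \<open>third x c\<close> the third
  side is skew to \<open>y\<close>. The second common neighbour \<open>d\<close> supplies
  \<open>third x d\<close>, which is skew to both \<open>y\<close> and \<open>c\<close> and so links
  the degree of \<open>c\<close> to the others.\<close>

lemma card_two_common:
  assumes P: "x \<in> P" "y \<in> P" and xy: "x \<noteq> y" "\<not> adj x y" and two: "card (common x y) \<ge> 2"
  shows "finite P" "card P + 3 = 6 * card (common x y)"
proof -
  have fc: "finite (common x y)" using two card_ge_0_finite[of "common x y"] by simp
  obtain c d where c: "c \<in> common x y" and d: "d \<in> common x y" and cd: "c \<noteq> d"
    using two fc by (metis card_le_Suc0_iff_eq not_less_eq_eq numeral_2_eq_2)
  note tc = third_common[OF P xy c] and td = third_common[OF P xy d]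
  have cx: "adj x c" "c \<in> P" using c adj_sym adj_in unfolding common_def by blast+
  have dx: "\<not> adj (third x d) c" "third x d \<noteq> c"
    using third_x_common[OF P xy d c] cd by auto
  have D: "card {z. adj x z} = 2 * card (common x y)" "finite {z. adj x z}"
    using degree_nonadjacent[OF P xy] fc by auto
  have Y: "card {z. adj y z} = card {z. adj x z}"
    using card_nonadjacent_eq[OF P xy] by simp
  have T: "card {z. adj (third x c) z} = card {z. adj y z}" "finite {z. adj (third x c) z}"
    using card_nonadjacent_eq[OF tc(5) P(2) tc(3,2)] by auto
  have U: "card {z. adj (third x d) z} = card {z. adj y z}"
    using card_nonadjacent_eq[OF td(5) P(2) td(3,2)] by auto
  have "card {z. adj c z} = card {z. adj (third x d) z}"
    using card_nonadjacent_eq[OF td(5) cx(2) dx(2,1)] by auto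
  moreover have "finite {z. adj c z}"
    using card_nonadjacent_eq(1)[OF cx(2) td(5)] dx adj_sym by metis
  ultimately show "finite P" "card P + 3 = 6 * card (common x y)"
    using card_triangle[OF cx(1) D(2) _ T(2)] T U Y D by auto
qed

text \<open>With one common neighbour \<open>c\<close>, every line meets \<open>c\<close>, and \<open>transversal\<close> leaves room for at
  most three triangles through \<open>c\<close>.\<close>

lemma card_one_common:
  assumes P: "x \<in> P" "y \<in> P" and xy: "x \<noteq> y" "\<not> adj x y" and one: "card (common x y) = 1"
  shows "finite P" "card P = (if \<exists>z\<in>P. z \<noteq> x \<and> z \<noteq> y \<and> \<not> adj x z \<and> \<not> adj y z then 7 else 5)"
proof -
  obtain c where c: "common x y = {c}" using one card_1_singletonE by blast
  then have cc: "c \<in> common x y" by simp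
  have a: "adj x c" "adj y c" "adj c x" "adj c y" using cc adj_sym unfolding common_def by blast+
  have yx: "\<not> adj y x" using xy(2) adj_sym by blast
  let ?t = "third x c" and ?u = "third y c"
  note tc = third_common[OF P xy cc]
    and uc = third_common[OF P(2,1) xy(1)[symmetric] yx cc[unfolded common_sym[of x]]]
  have Nx: "{z. adj x z} = {c, ?t}" and Ny: "{z. adj y z} = {c, ?u}"
    using neighbours_nonadjacent(1)[OF P xy] neighbours_nonadjacent(1)[OF P(2,1) xy(1)[symmetric] yx]
      common_sym[of x] c by auto
  have tadj: "adj ?t x" "adj ?t c" "adj c ?t" using third_adj[OF a(1)] adj_sym by auto
  have uadj: "adj ?u y" "adj ?u c" "adj c ?u" using third_adj[OF a(2)] adj_sym by auto
  \<comment> \<open>\<open>third x c\<close> is skew to \<open>y\<close>, so it has degree 2 as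
    well.\<close>
  have Nt: "{z. adj ?t z} = {x, c}"
  proof -
    have "card {z. adj ?t z} = card {z. adj y z}" and f: "finite {z. adj ?t z}"
      using card_nonadjacent_eq[OF tc(5) P(2) tc(3,2)] by auto
    then have "card {z. adj ?t z} = 2" using Ny uc(4) by simp
    moreover have "card {x, c} = 2" using a adj_ne by auto
    ultimately show ?thesis using card_subset_eq[OF f, of "{x, c}"] tadj by auto
  qed
  have Nx': "adj x z \<longleftrightarrow> z = c \<or> z = ?t" and Ny': "adj y z \<longleftrightarrow> z = c \<or> z = ?u"
    and Nt': "adj ?t z \<longleftrightarrow> z = x \<or> z = c" for z
    using Nx Ny Nt by auto
  \<comment> \<open>The other two sides of the triangle have no neighbours outside it, so every
    further line must meet \<open>c\<close>.\<close>
  have Pc: "P = insert c {z. adj c z}"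
  proof
    show "insert c {z. adj c z} \<subseteq> P" using a adj_in adj_sym by blast
    show "P \<subseteq> insert c {z. adj c z}"
    proof
      fix w assume w: "w \<in> P"
      show "w \<in> insert c {z. adj c z}"
        using triangle_cases[OF a(1) w] Nx'[of w] Nt'[of w] a(3) tadj(3)
          adj_sym[of w x] adj_sym[of w c] adj_sym[of w ?t] by auto
    qed
  qed
  have star: "v = third c u" if "adj c u" "adj c v" "adj u v" for u v
    using third_eq[OF that] by simp
  have tt: "third c x = ?t" "third c y = ?u" "third c ?t = x" "third c ?u = y"
    using third_eq[OF a(3) tadj(3)] third_eq[OF a(4) uadj(3)] third_eq[OF tadj(3) a(3)]
      third_eq[OF uadj(3) a(4)] tadj(1) uadj(1) adj_sym by blast+
  have cne: "c \<noteq> z" if "adj c z" for z using that adj_ne by blast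
  have tu: "?t \<noteq> ?u" using tt xy by metis
  have xne: "x \<noteq> ?t" "x \<noteq> ?u" "y \<noteq> ?t" "y \<noteq> ?u" using tadj uadj tc uc adj_ne by metis+
  let ?S = "{c, x, ?t, y, ?u}"
  have S: "?S \<subseteq> P" unfolding Pc using a tadj uadj by auto
  have cS: "card ?S = 5" using cne[OF a(3)] cne[OF a(4)] cne[OF tadj(3)] cne[OF uadj(3)] tu xne xy by auto
  \<comment> \<open>Restates "there is more than the two triangles through \<open>c\<close>" as the
    existence of a third line skew to \<open>x\<close> and \<open>y\<close>, which can be tested on
    an explicit surface.\<close>
  have iff: "(\<exists>z\<in>P. z \<noteq> x \<and> z \<noteq> y \<and> \<not> adj x z \<and> \<not> adj y z) \<longleftrightarrow> P \<noteq> ?S"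
  proof
    assume "\<exists>z\<in>P. z \<noteq> x \<and> z \<noteq> y \<and> \<not> adj x z \<and> \<not> adj y z"
    moreover have "adj x c" "adj x ?t" "adj y ?u" using a tadj uadj adj_sym by auto
    ultimately show "P \<noteq> ?S" by blast
  next
    assume "P \<noteq> ?S"
    then obtain z where "z \<in> P" "z \<notin> ?S" using S by blast
    then show "\<exists>z\<in>P. z \<noteq> x \<and> z \<noteq> y \<and> \<not> adj x z \<and> \<not> adj y z"
      unfolding Nx' Ny' by auto
  qed
  have "finite P \<and> card P = (if P \<noteq> ?S then 7 else 5)"
  proof (cases "P = ?S")
    case True
    then have "finite P" by (metis finite.emptyI finite_insert)
    moreover have "card P = 5" using True cS by metis
    ultimately show ?thesis using True by argo
  next
    case False
    then obtain z where z: "z \<in> P" "z \<notin> ?S" using S by blast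
    then have cz: "adj c z" unfolding Pc by auto
    let ?v = "third c z"
    have v: "adj c ?v" "adj z ?v" using third_adj[OF cz] by auto
    have nz: "\<not> adj x z" "\<not> adj y z" unfolding Nx' Ny' using z by auto
    have vS: "?v \<notin> ?S"
    proof
      assume "?v \<in> ?S"
      then have "z \<in> third c ` {x, ?t, y, ?u}" 
        using third_third[OF cz] cne[OF v(1)] by (metis image_eqI insert_iff)
      then show False using tt z(2) by auto
    qed
    have "P \<subseteq> ?S \<union> {z, ?v}"
    proof
      fix w assume w: "w \<in> P"
      show "w \<in> ?S \<union> {z, ?v}"
      proof (rule ccontr)
        assume n: "w \<notin> ?S \<union> {z, ?v}"
        then have cw: "adj c w" using w Pc by auto
        have nw: "\<not> adj x w" "\<not> adj y w" unfolding Nx' Ny' using n by auto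
        have "\<not> adj z w" using star[OF cz cw] n by blast
        moreover have "distinct [x, y, z, w]" "{x, y, z, w} \<subseteq> P" using n z w P xy by auto
        \<comment> \<open>A line meeting \<open>x\<close> and \<open>y\<close> can only be
          \<open>c\<close>, but \<open>c\<close> meets \<open>w\<close> while the transversal does
          not.\<close>
        ultimately obtain q where q: "adj q x" "adj q y" "\<not> adj q w"
          using transversal[of x y z w] xy nz nw by blast
        then have "q \<in> common x y" unfolding common_def using adj_sym by blast
        then show False using c q(3) cw by simp
      qed
    qed
    then have "P = insert z (insert ?v ?S)" using S z v Pc by blast
    moreover have "card (insert z (insert ?v ?S)) = 7"
      using cS z(2) vS adj_ne[OF v(2)] by (subst card_insert_disjoint; simp)+
    ultimately show ?thesis using False by (metis finite.emptyI finite_insert)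
  qed
  then show "finite P" "card P = (if \<exists>z\<in>P. z \<noteq> x \<and> z \<noteq> y \<and> \<not> adj x z \<and> \<not> adj y z then 7 else 5)"
    unfolding iff by auto
qed

text \<open>\<open>x\<close> has degree 0, so every other line is skew to it and has degree 0 too.
  Four lines would then be pairwise skew, and \<open>transversal\<close> would produce an
  adjacency.\<close>

lemma card_no_common:
  assumes P: "x \<in> P" "y \<in> P" and xy: "x \<noteq> y" "\<not> adj x y" and none: "common x y = {}"
  shows "finite P" "card P = (if \<exists>z\<in>P. z \<noteq> x \<and> z \<noteq> y \<and> \<not> adj x z \<and> \<not> adj y z then 3 else 2)"
proof -
  have Nx: "{z. adj x z} = {}" using neighbours_nonadjacent(1)[OF P xy] none by auto
  have no: "\<not> adj u v" for u v
  proof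
    assume uv: "adj u v"
    have u: "u \<in> P" using uv adj_in by blast
    have "x \<noteq> u" using uv Nx by blast
    then have "\<not> adj u x" "u \<noteq> x" using Nx adj_sym by blast+
    from card_nonadjacent_eq[OF u P(1) this(2,1)] Nx uv show False by auto
  qed
  have "finite P \<and> card P = (if \<exists>z\<in>P. z \<noteq> x \<and> z \<noteq> y then 3 else 2)"
  proof (cases "\<exists>z\<in>P. z \<noteq> x \<and> z \<noteq> y")
    case True
    then obtain z where z: "z \<in> P" "z \<noteq> x" "z \<noteq> y" by blast
    have "P \<subseteq> {x, y, z}"
    proof
      fix w assume w: "w \<in> P"
      show "w \<in> {x, y, z}"
      proof (rule ccontr)
        assume "w \<notin> {x, y, z}"
        then have "distinct [x, y, z, w]" "{x, y, z, w} \<subseteq> P" using z w P xy by auto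
        then show False using transversal no by blast
      qed
    qed
    then have "P = {x, y, z}" using P z by blast
    then show ?thesis using True z xy by simp
  next
    case False
    then have "P = {x, y}" using P by blast
    then show ?thesis using xy by simp
  qed
  then show "finite P" "card P = (if \<exists>z\<in>P. z \<noteq> x \<and> z \<noteq> y \<and> \<not> adj x z \<and> \<not> adj y z then 3 else 2)"
    using no by auto
qed

lemma card_all_adjacent:
  assumes all: "\<And>x y. x \<in> P \<Longrightarrow> y \<in> P \<Longrightarrow> x \<noteq> y \<Longrightarrow> adj x y"
  shows "finite P" "card P \<in> {0, 1, 3}"
proof -
  have "finite P \<and> card P \<in> {0, 1, 3}"
  proof (cases "\<exists>x y. x \<in> P \<and> y \<in> P \<and> x \<noteq> y")
    case True
    then obtain x y where xy: "x \<in> P" "y \<in> P" "x \<noteq> y" by blast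
    have a: "adj x y" using all xy by blast
    have t: "adj x (third x y)" "adj y (third x y)" using third_adj[OF a] by auto
    have "w \<in> {x, y, third x y}" if "w \<in> P" for w
      using triangle_cases[OF a that] all[OF that] xy by blast
    then have "P = {x, y, third x y}" using xy t adj_in adj_sym by blast
    then show ?thesis using adj_ne[OF t(1)] adj_ne[OF t(2)] xy(3)
      by (metis card_3_iff finite.emptyI finite_insert insertCI)
  next
    case False
    then have "P = {} \<or> (\<exists>x. P = {x})" by blast
    then show ?thesis by auto
  qed
  then show "finite P" "card P \<in> {0, 1, 3}" by auto
qed

theorem card_line_configuration:
  "finite P" "card P \<in> {0, 1, 2, 3, 5, 7, 9, 15, 27}"
proof -
  have "finite P \<and> card P \<in> {0, 1, 2, 3, 5, 7, 9, 15, 27}"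
  proof (cases "\<exists>x y. x \<in> P \<and> y \<in> P \<and> x \<noteq> y \<and> \<not> adj x y")
    case True
    then obtain x y where xy: "x \<in> P" "y \<in> P" "x \<noteq> y" "\<not> adj x y" by blast
    note c = card_common[OF xy]
    consider "card (common x y) = 0" | "card (common x y) = 1" | "card (common x y) \<in> {2, 3, 5}"
      using c(2) by auto
    then show ?thesis
    proof cases
      case 1
      then have "common x y = {}" using c(1) by simp
      from card_no_common[OF xy this] show ?thesis by (simp split: if_splits)
    next
      case 2
      from card_one_common[OF xy this] show ?thesis by (simp split: if_splits)
    next
      case 3
      then have "card (common x y) \<ge> 2" by auto
      from card_two_common[OF xy this] 3 show ?thesis by auto
    qed
  next
    case False
    then show ?thesis using card_all_adjacent by blast
  qed
  then show "finite P" "card P \<in> {0, 1, 2, 3, 5, 7, 9, 15, 27}" by auto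
qed

end

section \<open>Lines in projective space\<close>

definition proj_line :: "(rat^4) set \<Rightarrow> bool" where
  "proj_line L \<longleftrightarrow> vec.subspace L \<and> vec.dim L = 2"

lemma span2: "x \<in> vec.span {p, u :: rat^4} \<longleftrightarrow> (\<exists>a b. x = a *s p + b *s u)"
proof -
  have "x \<in> vec.span {p, u} \<longleftrightarrow> (\<exists>a b. x - a *s p = b *s u)"
    by (auto simp: vec.span_breakdown_eq)
  then show ?thesis by (simp add: diff_eq_eq add.commute)
qed

lemma span3: "x \<in> vec.span {p, u, v :: rat^4} \<longleftrightarrow> (\<exists>a b c. x = a *s p + b *s u + c *s v)"
proof -
  have "x \<in> vec.span {p, u, v} \<longleftrightarrow> (\<exists>a b c. x - a *s p = b *s u + c *s v)"
    by (subst vec.span_breakdown_eq) (simp add: span2)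
  then show ?thesis by (simp add: diff_eq_eq algebra_simps)
qed

lemma span4: "x \<in> vec.span {p, u, v, w :: rat^4} \<longleftrightarrow>
    (\<exists>a b c d. x = a *s p + b *s u + c *s v + d *s w)"
proof -
  have "x \<in> vec.span {p, u, v, w} \<longleftrightarrow> (\<exists>a b c d. x - a *s p = b *s u + c *s v + d *s w)"
    by (subst vec.span_breakdown_eq) (simp add: span3)
  then show ?thesis by (simp add: diff_eq_eq algebra_simps)
qed

lemma proj_line_span:
  assumes "p \<noteq> 0" "u \<notin> vec.span {p}" shows "proj_line (vec.span {p, u :: rat^4})"
proof -
  have "vec.dim {u, p} = 2" using assms by (subst vec.dim_insert) simp
  then show ?thesis unfolding proj_line_def by (simp add: insert_commute)
qed

lemma proj_line_eq_span:
  assumes L: "proj_line L" and pu: "p \<in> L" "u \<in> L" "p \<noteq> 0" "u \<notin> vec.span {p}"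
  shows "L = vec.span {p, u}"
proof -
  have "vec.span {p, u} \<subseteq> L" using L pu unfolding proj_line_def by (intro vec.span_minimal) auto
  then show ?thesis
    using vec.subspace_dim_equal[of "vec.span {p, u}" L] proj_line_span[OF pu(3,4)] L
    unfolding proj_line_def by auto
qed

lemma proj_line_basis:
  assumes L: "proj_line L" and p: "p \<in> L" "p \<noteq> 0"
  obtains u where "u \<in> L" "u \<notin> vec.span {p}" "L = vec.span {p, u}"
proof -
  have "\<not> L \<subseteq> vec.span {p}"
  proof
    assume "L \<subseteq> vec.span {p}"
    from vec.dim_subset[OF this] show False using L p unfolding proj_line_def by simp
  qed
  then obtain u where "u \<in> L" "u \<notin> vec.span {p}" by blast
  with proj_line_eq_span[OF L p(1) _ p(2)] that show ?thesis by blast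
qed

lemma proj_line_nonzero:
  assumes "proj_line L" obtains p where "p \<in> L" "p \<noteq> 0"
proof -
  have "\<not> L \<subseteq> {0}"
    using assms vec.dim_subset[of L "{0}"] unfolding proj_line_def by auto
  then show ?thesis using that by blast
qed

lemma proj_line_subset_eq:
  assumes "proj_line L" "proj_line M" "L \<subseteq> M" shows "L = M"
  using vec.subspace_dim_equal[of L M] assms unfolding proj_line_def by auto

lemma proj_line_lincomb:
  assumes "proj_line L" "x \<in> L" "y \<in> L" shows "a *s x + b *s y \<in> L"
  using assms unfolding proj_line_def by (auto intro: vec.subspace_add vec.subspace_scale)

lemma independent2:
  assumes "p \<noteq> 0" "u \<notin> vec.span {p :: rat^4}" "a *s p + b *s u = 0"
  shows "a = 0 \<and> b = 0"
proof -
  have "b = 0"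
  proof (rule ccontr)
    assume b: "b \<noteq> 0"
    have "b *s u = (-a) *s p" using assms(3) by (simp add: eq_neg_iff_add_eq_0 add.commute)
    then have "(1/b) *s (b *s u) = (1/b) *s ((-a) *s p)" by simp
    then have "u = (-a/b) *s p" using b by (simp add: vec.scale_scale)
    then show False using assms(2) vec.span_scale[OF vec.span_base[of p "{p}"], of "-a/b"] by simp
  qed
  then show ?thesis using assms by simp
qed

lemma not_in_span1:
  assumes "\<And>a b. a *s p + b *s u = 0 \<Longrightarrow> a = 0 \<and> b = 0"
  shows "(p :: rat^4) \<noteq> 0" "u \<notin> vec.span {p}"
proof -
  show "p \<noteq> 0" using assms[of 1 0] by auto
  show "u \<notin> vec.span {p}"
  proof
    assume "u \<in> vec.span {p}"
    then obtain k where "u = k *s p" by (auto simp: vec.span_singleton)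
    then show False using assms[of k "-1"] by simp
  qed
qed

lemma rat_line_iff_proj_line: "rat_line L \<longleftrightarrow> proj_line L"
proof
  assume "rat_line L"
  then obtain u v where i: "\<And>a b. (\<forall>i. a * u$i + b * v$i = 0) \<Longrightarrow> a = 0 \<and> b = 0"
    and L: "L = {(\<chi> i. a * u$i + b * v$i) | a b. True}" unfolding rat_line_def by blast
  have "L = vec.span {u, v}" unfolding L set_eq_iff span2 by (auto simp: vec_eq_iff)
  moreover have ab: "a = 0 \<and> b = 0" if "a *s u + b *s v = 0" for a b
    using i[of a b] that by (auto simp: vec_eq_iff)
  have "u \<noteq> 0" "v \<notin> vec.span {u}" using not_in_span1[of u v] ab by blast+
  ultimately show "proj_line L" using proj_line_span by simp
next
  assume L: "proj_line L"
  obtain u where u: "u \<in> L" "u \<noteq> 0" using proj_line_nonzero[OF L] .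
  obtain v where v: "v \<in> L" "v \<notin> vec.span {u}" "L = vec.span {u, v}"
    using proj_line_basis[OF L u] .
  have "a = 0 \<and> b = 0" if "\<forall>i. a * u$i + b * v$i = 0" for a b
  proof -
    have "a *s u + b *s v = 0" using that by (simp add: vec_eq_iff)
    then show ?thesis using independent2[OF u(2) v(2)] by blast
  qed
  moreover have "L = {(\<chi> i. a * u$i + b * v$i) | a b. True}"
    unfolding v(3) set_eq_iff span2 by (auto simp: vec_eq_iff)
  ultimately show "rat_line L" unfolding rat_line_def by blast
qed

lemma dim3:
  assumes "p \<noteq> 0" "u \<notin> vec.span {p :: rat^4}" "v \<notin> vec.span {p, u}"
  shows "vec.dim {p, u, v} = 3"
proof -
  have "vec.dim {v, p, u} = 3"
    using proj_line_span[OF assms(1,2)] assms(3) unfolding proj_line_def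
    by (subst vec.dim_insert) simp
  then show ?thesis by (simp add: insert_commute)
qed

lemma dim_rat4: "vec.dim (UNIV :: (rat^4) set) = 4"
  by (simp only: vec_dim_card) simp

lemma span4_UNIV:
  assumes "p \<noteq> 0" "u \<notin> vec.span {p :: rat^4}" "v \<notin> vec.span {p, u}" "w \<notin> vec.span {p, u, v}"
  shows "vec.span {p, u, v, w} = UNIV"
proof -
  have "vec.dim {w, p, u, v} = 4"
    using dim3[OF assms(1-3)] assms(4) by (subst vec.dim_insert) simp
  then have "vec.dim {p, u, v, w} = 4" by (simp add: insert_commute)
  then show ?thesis using vec.dim_eq_full[of "{p, u, v, w}"] dim_rat4
    by (simp add: vec.dim_UNIV vec.dimension_def)
qed

lemma fourth_vector:
  assumes "p \<noteq> 0" "u \<notin> vec.span {p :: rat^4}" "v \<notin> vec.span {p, u}"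
  obtains w where "vec.span {p, u, v, w} = UNIV"
proof -
  have "vec.span {p, u, v} \<noteq> UNIV" 
  proof
    assume "vec.span {p, u, v} = UNIV"
    then have "vec.dim {p, u, v} = 4" using dim_rat4 vec.dim_span[of "{p, u, v}"] by argo
    then show False using dim3[OF assms] by simp
  qed
  then show ?thesis using span4_UNIV[OF assms] that by blast
qed

lemma skew_sum:
  assumes L: "proj_line L" "proj_line M" and LM: "\<And>x. x \<in> L \<Longrightarrow> x \<in> M \<Longrightarrow> x = 0"
  obtains l m where "l \<in> L" "m \<in> M" "x = l + m"
proof -
  let ?S = "{l + m | l m. l \<in> L \<and> m \<in> M}"
  have s: "vec.subspace L" "vec.subspace M" using L unfolding proj_line_def by auto
  have "L \<inter> M = {0}" using LM s vec.subspace_0 by blast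
  then have "vec.dim ?S = 4"
    using vec.dim_sums_Int[OF s] L unfolding proj_line_def by simp
  moreover have "vec.subspace ?S" using vec.subspace_sums[OF s] .
  ultimately have "?S = UNIV"
    using vec.subspace_dim_equal[of ?S UNIV] dim_rat4 by simp
  then show ?thesis using that by blast
qed

text \<open>Dimension count in a space of dimension 4: the intersection has dimension at least 3 + 2
  - 4.\<close>

lemma plane_meets_line:
  assumes "p \<noteq> 0" "u \<notin> vec.span {p :: rat^4}" "v \<notin> vec.span {p, u}" and W: "proj_line W"
  obtains q where "q \<noteq> 0" "q \<in> W" "q \<in> vec.span {p, u, v}"
proof -
  let ?K = "vec.span {p, u, v}"
  let ?S = "{l + m | l m. l \<in> ?K \<and> m \<in> W}"
  have s: "vec.subspace ?K" "vec.subspace W" using W unfolding proj_line_def by auto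
  have "vec.dim ?S + vec.dim (?K \<inter> W) = 5"
    using vec.dim_sums_Int[OF s] W dim3[OF assms(1-3)] unfolding proj_line_def by simp
  moreover have "vec.dim ?S \<le> 4" using vec.dim_subset[of ?S UNIV] dim_rat4 by simp
  ultimately have "vec.dim (?K \<inter> W) \<noteq> 0" by linarith
  then have "\<not> ?K \<inter> W \<subseteq> {0}" using vec.dim_subset[of "?K \<inter> W" "{0}"] by auto
  then show ?thesis using that by blast
qed

text \<open>Among four points \<open>p + k *s u\<close> two fall into the same one of the three
  lines, and two such points span \<open>W\<close>.\<close>

lemma proj_line_cover:
  assumes W: "proj_line W" and L: "proj_line A" "proj_line B" "proj_line C"
    and sub: "W \<subseteq> A \<union> B \<union> C"
  shows "W = A \<or> W = B \<or> W = C"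
proof -
  obtain p where p: "p \<in> W" "p \<noteq> 0" using proj_line_nonzero[OF W] .
  obtain u where u: "u \<in> W" "u \<notin> vec.span {p}" "W = vec.span {p, u}" using proj_line_basis[OF W p] .
  define f where "f k = p + of_nat k *s u" for k :: nat
  have f: "f k \<in> W" for k
    unfolding f_def using proj_line_lincomb[OF W p(1) u(1), of 1] by simp
  have key: "W = X" if X: "proj_line X" and kl: "k \<noteq> l" "f k \<in> X" "f l \<in> X" for X k l
  proof -
    let ?c = "of_nat k - of_nat l :: rat"
    have c: "?c \<noteq> 0" using kl by simp
    have "(1/?c) *s f k + (-1/?c) *s f l = (1/?c) *s (?c *s u)"
      unfolding f_def by (auto simp: vec_eq_iff algebra_simps)
    then have "(1/?c) *s f k + (-1/?c) *s f l = u"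
      unfolding vec.scale_scale using c by simp
    then have uX: "u \<in> X" using proj_line_lincomb[OF X kl(2,3)] by metis
    have "1 *s f k + (- of_nat k) *s u = p" unfolding f_def by (auto simp: vec_eq_iff)
    then have pX: "p \<in> X" using proj_line_lincomb[OF X kl(2) uX] by metis
    show ?thesis using proj_line_eq_span[OF X pX uX p(2) u(2)] u(3) by simp
  qed
  have "\<exists>X. X \<in> {A, B, C} \<and> f k \<in> X" for k using f[of k] sub by blast
  then obtain X where X: "\<And>k. X k \<in> {A, B, C}" "\<And>k. f k \<in> X k" by metis
  have "card (X ` {..<4::nat}) \<le> card {A, B, C}" using X(1) by (intro card_mono) auto
  also have "\<dots> \<le> 3" by (simp add: card_insert_if)
  finally have "\<not> inj_on X {..<4}" by (intro pigeonhole) simp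
  then obtain k l where "k \<noteq> l" "X k = X l" unfolding inj_on_def by blast
  then show ?thesis using key[of "X k" k l] X[of k] X[of l] L by auto
qed

section \<open>Lines on a nonsingular cubic surface\<close>

text \<open>\<open>T\<close> plays the role of the polarised cubic form, so \<open>T x x w\<close>
  is a multiple of the derivative at \<open>x\<close> along \<open>w\<close>. The last axiom expands
  \<open>T Z Z w\<close> at the complex point Z = s p + r u of a rational line, which keeps
  \<open>T\<close> itself on rational vectors.\<close>

locale nonsingular_cubic_form =
  fixes T :: "rat^4 \<Rightarrow> rat^4 \<Rightarrow> rat^4 \<Rightarrow> rat"
  assumes T_add: "T (x + y) z w = T x z w + T y z w"
    and T_scale: "T (k *s x) z w = k * T x z w"
    and T_sym1: "T x y z = T y x z"
    and T_sym2: "T x y z = T x z y"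
    and nonsingular: "p \<noteq> 0 \<Longrightarrow> u \<notin> vec.span {p} \<Longrightarrow>
      (\<And>w. s\<^sup>2 * of_rat (T p p w) + 2 * s * r * of_rat (T p u w) + r\<^sup>2 * of_rat (T u u w) = (0 :: complex)) \<Longrightarrow>
      s = 0 \<and> r = 0"
begin

lemma T_add2: "T z (x + y) w = T z x w + T z y w"
  by (metis T_add T_sym1)

lemma T_add3: "T z w (x + y) = T z w x + T z w y"
  by (metis T_add2 T_sym2)

lemma T_scale2: "T z (k *s x) w = k * T z x w"
  by (metis T_scale T_sym1)

lemma T_scale3: "T z w (k *s x) = k * T z w x"
  by (metis T_scale2 T_sym2)

lemmas T_lin = T_add T_add2 T_add3 T_scale T_scale2 T_scale3

lemma T_perm: "T y x z = T x y z" "T x z y = T x y z" "T y z x = T x y z" "T z x y = T x y z" "T z y x = T x y z"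
  by (simp_all add: T_sym1 T_sym2)

lemmas T_comm = T_sym1 T_sym2

definition on_surface :: "(rat^4) set \<Rightarrow> bool" where
  "on_surface L \<longleftrightarrow> proj_line L \<and> (\<forall>x\<in>L. T x x x = 0)"

definition meets :: "(rat^4) set \<Rightarrow> (rat^4) set \<Rightarrow> bool" where
  "meets L M \<longleftrightarrow> on_surface L \<and> on_surface M \<and> L \<noteq> M \<and> (\<exists>p\<in>L. p \<in> M \<and> p \<noteq> 0)"

text \<open>Polarisation: inclusion-exclusion over the cubes of partial sums isolates
  \<open>6 * T x y z\<close>.\<close>

lemma on_surface_polar:
  assumes L: "on_surface L" and x: "x \<in> L" "y \<in> L" "z \<in> L"
  shows "T x y z = 0"
proof -
  have l: "proj_line L" using L unfolding on_surface_def by auto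
  have i: "u + v \<in> L" if "u \<in> L" "v \<in> L" for u v using proj_line_lincomb[OF l that, of 1 1] by simp
  have c: "T u u u = 0" if "u \<in> L" for u using L that unfolding on_surface_def by auto
  note e = c[OF x(1)] c[OF x(2)] c[OF x(3)] c[OF i[OF x(1,2)]] c[OF i[OF x(1,3)]] c[OF i[OF x(2,3)]]
    c[OF i[OF i[OF x(1,2)] x(3)]]
  have "T (x+y+z) (x+y+z) (x+y+z) - T (x+y) (x+y) (x+y) - T (x+z) (x+z) (x+z) - T (y+z) (y+z) (y+z)
      + T x x x + T y y y + T z z z = 6 * T x y z"
    by (simp add: T_lin T_comm)
  then show ?thesis using e by simp
qed

lemma on_surface_span:
  assumes "p \<noteq> 0" "u \<notin> vec.span {p}" "T p p p = 0" "T p p u = 0" "T p u u = 0" "T u u u = 0"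
  shows "on_surface (vec.span {p, u})"
proof -
  have "T (a *s p + b *s u) (a *s p + b *s u) (a *s p + b *s u) = 0" for a b
    using assms(3-6) by (simp add: T_lin T_comm)
  then have "T x x x = 0" if "x \<in> vec.span {p, u}" for x using that unfolding span2 by blast
  then show ?thesis using proj_line_span[OF assms(1,2)] unfolding on_surface_def by blast
qed

text \<open>A binary quadratic form over the complex numbers has a nontrivial zero, so a plane cannot be
  tangent to the surface along a whole line.\<close>

lemma not_tangent_along_line:
  assumes pu: "p \<noteq> 0" "u \<notin> vec.span {p}" and v: "v \<notin> vec.span {p, u}"
    and L: "on_surface (vec.span {p, u})"
    and z: "T p p v = 0" "T p u v = 0" "T u u v = 0"
  shows False
proof -
  obtain w where w: "vec.span {p, u, v, w} = UNIV" using fourth_vector[OF pu v] .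
  have m: "p \<in> vec.span {p, u}" "u \<in> vec.span {p, u}" by (auto intro: vec.span_base)
  note zz = on_surface_polar[OF L]
  \<comment> \<open>At a point of the line only the derivative along \<open>w\<close> can be
    nonzero. Its value at s p + r u is the binary quadratic with coefficients \<open>A\<close>,
    \<open>2 * B\<close>, \<open>C\<close>, and a root is a singular point.\<close>
  define A B C where "A = (of_rat (T p p w) :: complex)" and "B = (of_rat (T p u w) :: complex)"
    and "C = (of_rat (T u u w) :: complex)"
  obtain s r :: complex where sr: "s\<^sup>2 * A + 2 * s * r * B + r\<^sup>2 * C = 0" "\<not> (s = 0 \<and> r = 0)"
  proof (cases "A = 0")
    case True
    then show ?thesis using that[of 1 0] by simp
  next
    case False
    define D where "D = csqrt (B\<^sup>2 - A * C)"
    have D: "D\<^sup>2 = B\<^sup>2 - A * C" unfolding D_def by simp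
    have "(D - B)\<^sup>2 * A + 2 * (D - B) * A * B + A\<^sup>2 * C = A * (D\<^sup>2 - B\<^sup>2 + A * C)"
      by (simp add: power2_eq_square algebra_simps)
    also have "\<dots> = 0" using D by simp
    finally show ?thesis using that[of "D - B" A] False by simp
  qed
  have "s\<^sup>2 * of_rat (T p p x) + 2 * s * r * of_rat (T p u x) + r\<^sup>2 * of_rat (T u u x) = 0" for x
  proof -
    obtain a b c d where x: "x = a *s p + b *s u + c *s v + d *s w"
      using w span4[of x p u v w] by auto
    have "T p p x = d * T p p w" "T p u x = d * T p u w" "T u u x = d * T u u w"
      unfolding x using z zz[OF m(1) m(1) m(1)] zz[OF m(1) m(1) m(2)] zz[OF m(1) m(2) m(1)]
        zz[OF m(1) m(2) m(2)] zz[OF m(2) m(2) m(1)] zz[OF m(2) m(2) m(2)] by (simp_all add: T_lin T_comm)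
    then have "s\<^sup>2 * of_rat (T p p x) + 2 * s * r * of_rat (T p u x) + r\<^sup>2 * of_rat (T u u x)
      = of_rat d * (s\<^sup>2 * A + 2 * s * r * B + r\<^sup>2 * C)"
      unfolding A_def B_def C_def by (simp add: of_rat_mult algebra_simps)
    then show ?thesis using sr by simp
  qed
  from nonsingular[OF pu this] show False using sr(2) by blast
qed

lemma not_singular_point:
  assumes "p \<noteq> 0" "\<And>x. T p p x = 0"
  shows False
proof -
  obtain u where "u \<notin> vec.span {p}"
  proof -
    have "vec.span {p} \<noteq> UNIV"
    proof
      assume e: "vec.span {p} = UNIV"
      have "vec.dim (vec.span {p}) = 4" unfolding e dim_rat4 ..
      then show False using assms(1) by simp
    qed
    then show ?thesis using that by blast
  qed
  from nonsingular[OF assms(1) this, of 1 0] show False using assms(2) by simp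
qed

lemma meets_obtain:
  assumes "meets L M"
  obtains p u v where "p \<noteq> 0" "u \<notin> vec.span {p}" "v \<notin> vec.span {p, u}"
    "L = vec.span {p, u}" "M = vec.span {p, v}" "v \<notin> vec.span {p}" "u \<notin> vec.span {p, v}"
proof -
  have l: "proj_line L" "proj_line M" "L \<noteq> M" using assms unfolding meets_def on_surface_def by auto
  obtain p where p: "p \<in> L" "p \<in> M" "p \<noteq> 0" using assms unfolding meets_def by auto
  obtain u where u: "u \<in> L" "u \<notin> vec.span {p}" "L = vec.span {p, u}"
    using proj_line_basis[OF l(1) p(1,3)] .
  obtain v where v: "v \<in> M" "v \<notin> vec.span {p}" "M = vec.span {p, v}"
    using proj_line_basis[OF l(2) p(2,3)] .
  have "v \<notin> L" using proj_line_eq_span[OF l(1) p(1) _ p(3) v(2)] l(3) v(3) by auto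
  moreover have "u \<notin> M" using proj_line_eq_span[OF l(2) p(2) _ p(3) u(2)] l(3) u(3) by auto
  ultimately show ?thesis using that p u v by metis
qed

text \<open>The cubic form restricted to the plane spanned by two meeting lines is a product of three
  linear forms.\<close>

lemma plane_section:
  assumes LM: "meets L M"
  obtains N p u v where "meets L N" "meets M N" 
    "p \<noteq> 0" "u \<notin> vec.span {p}" "v \<notin> vec.span {p, u}" "L = vec.span {p, u}" "M = vec.span {p, v}"
    "\<forall>x\<in>vec.span {p, u, v}. T x x x = 0 \<longrightarrow> x \<in> L \<union> M \<union> N"
proof -
  obtain p u v where b: "p \<noteq> 0" "u \<notin> vec.span {p}" "v \<notin> vec.span {p, u}"
    "L = vec.span {p, u}" "M = vec.span {p, v}" "v \<notin> vec.span {p}" "u \<notin> vec.span {p, v}"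
    using meets_obtain[OF LM] .
  have os: "on_surface L" "on_surface M" using LM unfolding meets_def by auto
  have m: "p \<in> L" "u \<in> L" "p \<in> M" "v \<in> M" unfolding b(4,5) by (auto intro: vec.span_base)
  note lz = on_surface_polar[OF os(1)] and mz = on_surface_polar[OF os(2)]
  define A B C where "A = T p u v" and "B = T u u v" and "C = T u v v"
  have z: "T p p p = 0" "T p p u = 0" "T p u u = 0" "T u u u = 0" "T p p v = 0" "T p v v = 0" "T v v v = 0"
    using lz m mz by auto
  \<comment> \<open>On the plane the cubic is 3bc(2aA + bB + cC), and L, M are c = 0, b = 0. If
    \<open>A\<close> and \<open>B\<close> both vanished, the residual line would be L again, that
    is, the plane would be tangent along L.\<close>
  have AB: "A \<noteq> 0 \<or> B \<noteq> 0"
    using not_tangent_along_line[OF b(1,2,3) os(1)[unfolded b(4)]] z unfolding A_def B_def by auto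
  have AC: "A \<noteq> 0 \<or> C \<noteq> 0"
    using not_tangent_along_line[OF b(1,6,7) os(2)[unfolded b(5)]] z T_perm[of p u v] T_perm[of u v v]
    unfolding A_def C_def by auto
  have F: "T x x x = 3 * b * c * (2 * a * A + b * B + c * C)" if "x = a *s p + b *s u + c *s v" for x a b c
    unfolding that A_def B_def C_def using z by (simp add: T_lin T_comm algebra_simps)
  have uniq: "a = 0 \<and> b = 0 \<and> c = 0" if "a *s p + b *s u + c *s v = 0" for a b c
  proof -
    have "c = 0"
    proof (rule ccontr)
      assume c: "c \<noteq> 0"
      have "c *s v = (-a) *s p + (-b) *s u" using that by (simp add: eq_neg_iff_add_eq_0 algebra_simps)
      then have "(1/c) *s (c *s v) = (1/c) *s ((-a) *s p + (-b) *s u)" by simp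
      then have "v = (-a/c) *s p + (-b/c) *s u" using c
        unfolding vec.scale_right_distrib vec.scale_scale by simp
      then show False using b(3) span2 by blast
    qed
    then show ?thesis using that independent2[OF b(1,2)] by simp
  qed
  obtain e f where ef: "e \<noteq> 0" "f \<notin> vec.span {e}" "e \<in> L" "f \<in> vec.span {p, u, v}"
    and sp: "\<And>a b c. 2 * a * A + b * B + c * C = 0 \<longleftrightarrow> a *s p + b *s u + c *s v \<in> vec.span {e, f}"
    and mm: "\<exists>g\<in>M. g \<noteq> 0 \<and> g \<in> vec.span {e, f}"
  proof (cases "A = 0")
    case True
    then have BC: "B \<noteq> 0" "C \<noteq> 0" using AB AC by auto
    let ?f = "C *s u + (-B) *s v"
    have "?f \<notin> vec.span {p}"
    proof
      assume "?f \<in> vec.span {p}"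
      then obtain k where "?f = k *s p" by (auto simp: vec.span_singleton)
      then have "(-k) *s p + C *s u + (-B) *s v = 0" by (simp add: vec_eq_iff algebra_simps)
      from uniq[OF this] show False using BC by simp
    qed
    moreover have "2 * a * A + b * B + c * C = 0 \<longleftrightarrow> a *s p + b *s u + c *s v \<in> vec.span {p, ?f}" for a b c
    proof
      assume "2 * a * A + b * B + c * C = 0"
      then have "b = (b / C) * C" "c = (b / C) * (-B)" using True BC by (auto simp: field_simps)
      then have "a *s p + b *s u + c *s v = a *s p + (b / C) *s ?f"
        unfolding vec.scale_right_distrib vec.scale_scale by (metis add.assoc)
      then show "a *s p + b *s u + c *s v \<in> vec.span {p, ?f}" using span2 by blast
    next
      assume "a *s p + b *s u + c *s v \<in> vec.span {p, ?f}"
      then obtain k l where "a *s p + b *s u + c *s v = k *s p + l *s ?f" using span2 by blast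
      then have "(a - k) *s p + (b - l * C) *s u + (c + l * B) *s v = 0"
        by (simp add: vec_eq_iff algebra_simps)
      from uniq[OF this] show "2 * a * A + b * B + c * C = 0" using True by algebra
    qed
    moreover have "?f \<in> vec.span {p, u, v}" using span3[of ?f p u v] by (metis add_0 vec.scale_zero_left)
    moreover have "p \<in> vec.span {p, ?f}" by (simp add: vec.span_base)
    ultimately show ?thesis using that[of p ?f] b(1) m by blast
  next
    case False
    let ?e = "B *s p + (-2*A) *s u" and ?f = "C *s p + (-2*A) *s v"
    have e: "?e \<noteq> 0" using uniq[of B "-2*A" 0] False by auto
    moreover have "?f \<noteq> 0" using uniq[of C 0 "-2*A"] False by auto
    moreover have "?f \<notin> vec.span {?e}"
    proof
      assume "?f \<in> vec.span {?e}"
      then obtain k where "?f = k *s ?e" by (auto simp: vec.span_singleton)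
      then have "(C - k * B) *s p + (2 * k * A) *s u + (-2*A) *s v = 0"
        by (simp add: vec_eq_iff algebra_simps)
      from uniq[OF this] show False using False by simp
    qed
    moreover have "?e \<in> L" "?f \<in> M" using os m proj_line_lincomb unfolding on_surface_def by blast+
    moreover have "2 * a * A + b * B + c * C = 0 \<longleftrightarrow> a *s p + b *s u + c *s v \<in> vec.span {?e, ?f}" for a b c
    proof
      assume "2 * a * A + b * B + c * C = 0"
      then have a: "a = (-b/(2*A)) * B + (-c/(2*A)) * C" "b = (-b/(2*A)) * (-2*A)" "c = (-c/(2*A)) * (-2*A)"
        using False by (auto simp: field_simps)
      have "(-b/(2*A)) *s ?e + (-c/(2*A)) *s ?f = ((-b/(2*A)) * B + (-c/(2*A)) * C) *s p
          + ((-b/(2*A)) * (-2*A)) *s u + ((-c/(2*A)) * (-2*A)) *s v"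
        by (simp add: vec_eq_iff algebra_simps)
      then have "a *s p + b *s u + c *s v = (-b/(2*A)) *s ?e + (-c/(2*A)) *s ?f"
        using a by argo
      then show "a *s p + b *s u + c *s v \<in> vec.span {?e, ?f}" using span2 by blast
    next
      assume "a *s p + b *s u + c *s v \<in> vec.span {?e, ?f}"
      then obtain k l where "a *s p + b *s u + c *s v = k *s ?e + l *s ?f" using span2 by blast
      then have "(a - k * B - l * C) *s p + (b + 2 * k * A) *s u + (c + 2 * l * A) *s v = 0"
        by (simp add: vec_eq_iff algebra_simps)
      from uniq[OF this] show "2 * a * A + b * B + c * C = 0" by algebra
    qed
    moreover have "?f \<in> vec.span {p, u, v}" using span3[of ?f p u v] by (metis add.right_neutral vec.scale_zero_left)
    moreover have "?f \<in> vec.span {?e, ?f}" by (simp add: vec.span_base)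
    ultimately show ?thesis using that[of ?e ?f] by blast
  qed
  let ?N = "vec.span {e, f}"
  have pN: "proj_line ?N" using proj_line_span ef by blast
  have eK: "e \<in> vec.span {p, u, v}" using ef(3) vec.span_mono[of "{p, u}" "{p, u, v}"] b(4) by blast
  have "?N \<subseteq> vec.span {p, u, v}" using eK ef(4) by (intro vec.span_minimal) auto
  then have "T x x x = 0" if "x \<in> ?N" for x
    using that F sp span3[of x p u v] by fastforce
  then have N: "on_surface ?N" using pN unfolding on_surface_def by blast
  have iff: "p \<in> ?N \<longleftrightarrow> A = 0" "u \<in> ?N \<longleftrightarrow> B = 0" "v \<in> ?N \<longleftrightarrow> C = 0"
    using sp[of 1 0 0] sp[of 0 1 0] sp[of 0 0 1] by simp_all
  have ne: "L \<noteq> ?N" "M \<noteq> ?N" using iff m AB AC by metis+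
  have eN: "e \<in> ?N" by (simp add: vec.span_base)
  show ?thesis
  proof (rule that[OF _ _ b(1-5)])
    show "meets L ?N" unfolding meets_def using os N ne eN ef by blast
  next
    show "meets M ?N" unfolding meets_def using os N ne mm by blast
  next
    have "x \<in> L \<union> M \<union> ?N" if xK: "x \<in> vec.span {p, u, v}" and T0: "T x x x = 0" for x
    proof -
      obtain a b' c where x: "x = a *s p + b' *s u + c *s v" using xK unfolding span3 by blast
      then consider "b' = 0" | "c = 0" | "2 * a * A + b' * B + c * C = 0" using F[OF x] T0 by auto
      then show ?thesis
      proof cases
        case 1 then show ?thesis using x b(5) span2 by auto
      next
        case 2 then show ?thesis using x b(4) span2 by auto
      next
        case 3 then show ?thesis using x sp by blast
      qed
    qed
    then show "\<forall>x\<in>vec.span {p, u, v}. T x x x = 0 \<longrightarrow> x \<in> L \<union> M \<union> ?N" by blast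
  qed
qed

lemma meets_sym: "meets L M \<Longrightarrow> meets M L"
  unfolding meets_def by blast

lemma plane_triangle:
  assumes LM: "meets L M"
  shows "\<exists>N. meets L N \<and> meets M N \<and> (\<forall>W. meets W L \<and> meets W M \<longrightarrow> W = N) \<and>
    (\<forall>W. on_surface W \<longrightarrow> W = L \<or> W = M \<or> W = N \<or> meets W L \<or> meets W M \<or> meets W N)"
proof -
  obtain N p u v where N: "meets L N" "meets M N"
    and b: "p \<noteq> 0" "u \<notin> vec.span {p}" "v \<notin> vec.span {p, u}" "L = vec.span {p, u}" "M = vec.span {p, v}"
    and cover: "\<forall>x\<in>vec.span {p, u, v}. T x x x = 0 \<longrightarrow> x \<in> L \<union> M \<union> N"
    using plane_section[OF LM] .
  let ?K = "vec.span {p, u, v}"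
  have os: "on_surface L" "on_surface M" "on_surface N" using N unfolding meets_def by auto
  have LMK: "L \<subseteq> ?K" "M \<subseteq> ?K" unfolding b(4,5) by (auto intro!: vec.span_mono)
  have m: "p \<in> L" "p \<in> M" unfolding b(4,5) by (auto intro: vec.span_base)
  show ?thesis
  proof (intro exI conjI allI impI)
    show "meets L N" "meets M N" by (rule N)+
  next
    fix W assume "meets W L \<and> meets W M"
    then have WL: "meets W L" and WM: "meets W M" by auto
    have W: "on_surface W" "W \<noteq> L" "W \<noteq> M" and pW: "proj_line W"
      using WL WM unfolding meets_def on_surface_def by auto
    obtain q where q: "q \<in> W" "q \<in> L" "q \<noteq> 0" using WL unfolding meets_def by auto
    obtain r where r: "r \<in> W" "r \<in> M" "r \<noteq> 0" using WM unfolding meets_def by auto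
    \<comment> \<open>Distinct meeting points on L and M span W inside the plane. If both are the
      vertex \<open>p\<close>, a line W leaving the plane would give vanishing derivatives at
      \<open>p\<close> in four independent directions.\<close>
    have "W \<subseteq> ?K"
    proof (cases "r \<in> vec.span {q}")
      case False
      from proj_line_eq_span[OF pW q(1) r(1) q(3) False] have "W = vec.span {q, r}" .
      moreover have "q \<in> ?K" "r \<in> ?K" using q r LMK by auto
      ultimately show ?thesis using vec.span_minimal[of "{q, r}" ?K] by simp
    next
      case True
      then obtain k where k: "r = k *s q" by (auto simp: vec.span_singleton)
      have "r \<in> L" using k q(2) proj_line_lincomb[of L q q k 0] os(1) unfolding on_surface_def by simp
      have "r \<in> vec.span {p}"
      proof (rule ccontr)
        assume n: "r \<notin> vec.span {p}"
        have "L = vec.span {p, r}" "M = vec.span {p, r}"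
          using proj_line_eq_span[of L p r] proj_line_eq_span[of M p r] n b(1) m \<open>r \<in> L\<close> r(2) os
          unfolding on_surface_def by auto
        then show False using LM unfolding meets_def by simp
      qed
      then obtain l where l: "r = l *s p" by (auto simp: vec.span_singleton)
      then have "p = (1/l) *s r" using r(3) by auto
      then have pW': "p \<in> W" using r(1) proj_line_lincomb[OF pW r(1,1), of "1/l" 0] by simp
      obtain w where w: "w \<in> W" "w \<notin> vec.span {p}" "W = vec.span {p, w}"
        using proj_line_basis[OF pW pW' b(1)] .
      have "w \<in> ?K"
      proof (rule ccontr)
        assume "w \<notin> ?K"
        from span4_UNIV[OF b(1-3) this] have U: "vec.span {p, u, v, w} = UNIV" .
        have "u \<in> L" "v \<in> M" unfolding b(4,5) by (auto intro: vec.span_base)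
        then have z: "T p p p = 0" "T p p u = 0" "T p p v = 0" "T p p w = 0"
          using on_surface_polar[OF os(1)] on_surface_polar[OF os(2)] on_surface_polar[OF W(1)] m w(1) pW' by auto
        have "T p p x = 0" for x
        proof -
          obtain a b' c d where "x = a *s p + b' *s u + c *s v + d *s w"
            using U span4[of x p u v w] by auto
          then show ?thesis using z by (simp add: T_lin)
        qed
        then show False using not_singular_point b(1) by blast
      qed
      moreover have "p \<in> ?K" using LMK(1) m(1) by auto
      ultimately show ?thesis using w(3) vec.span_minimal[of "{p, w}" ?K] by simp
    qed
    then have "W \<subseteq> L \<union> M \<union> N" using cover W(1) unfolding on_surface_def by blast
    then show "W = N" using proj_line_cover[OF pW] os W unfolding on_surface_def by blast
  next
    fix W assume W: "on_surface W"
    then have pW: "proj_line W" unfolding on_surface_def by auto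
    obtain q where q: "q \<noteq> 0" "q \<in> W" "q \<in> ?K" using plane_meets_line[OF b(1-3) pW] .
    then have "q \<in> L \<or> q \<in> M \<or> q \<in> N" using cover W unfolding on_surface_def by blast
    then show "W = L \<or> W = M \<or> W = N \<or> meets W L \<or> meets W M \<or> meets W N"
      using W os q unfolding meets_def by blast
  qed
qed

end

section \<open>Transversals of skew lines\<close>

context nonsingular_cubic_form
begin

lemma T_diff:
  "T (x - y) z w = T x z w - T y z w" "T z (x - y) w = T z x w - T z y w"
  "T z w (x - y) = T z w x - T z w y"
  using T_add[of "x - y" y z w] T_add2[of z "x - y" y w] T_add3[of z w "x - y" y] by simp_all

lemma T_cube_add: "T (x + y) (x + y) (x + y) = T x x x + 3 * T x x y + 3 * T x y y + T y y y"
  by (simp add: T_lin T_comm)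

text \<open>For skew lines \<open>\<langle>X, X'\<rangle>\<close>, \<open>\<langle>Y, Y'\<rangle>\<close>, \<open>\<langle>X + Y, X' + Y'\<rangle>\<close> on the surface, the form restricted to the
  transversal \<open>\<langle>X, Y\<rangle>\<close> is \<open>3 T(X, X, Y) x y (x - y)\<close>.  If the binary cubic \<open>T(X, X, Y)\<close> had a double
  root, some point of the corresponding transversal would be singular.\<close>

lemma transversal_no_double_root:
  assumes U: "vec.span {X, X', Y, Y'} = UNIV" and X0: "X \<noteq> 0" and XY: "Y \<notin> vec.span {X}"
    and a: "T X X X = 0" "T X X X' = 0" and b: "T Y Y Y = 0" "T Y Y Y' = 0"
    and c: "T (X + Y) (X + Y) (X + Y) = 0" "T (X + Y) (X + Y) (X' + Y') = 0"
    and r: "T X X Y = 0" "2 * T X X' Y + T X X Y' = 0"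
  shows False
proof -
  define A B where "A = T X X' Y" and "B = T X Y Y'"
  have s: "T X Y Y = 0" using c(1) a b r by (simp add: T_lin T_comm)
  have AB: "T X X Y' = -2 * A" "T X' Y Y = -2 * B"
    using r(2) c(2) a b unfolding A_def B_def by (simp_all add: T_lin T_comm algebra_simps)
  \<comment> \<open>For Z = xX + yY the derivatives along X and Y vanish for all x, y, and those
    along X' and Y' are both multiples of xA - yB. One linear condition thus produces a singular
    point.\<close>
  obtain x y where xy: "x * A = y * B" "x \<noteq> 0 \<or> y \<noteq> 0"
  proof (cases "A = 0 \<and> B = 0")
    case True then show ?thesis using that[of 1 0] by simp
  next
    case False then show ?thesis using that[of B A] by auto
  qed
  let ?Z = "x *s X + y *s Y"
  have Z: "?Z \<noteq> 0" using independent2[OF X0 XY] xy(2) by blast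
  have e: "T ?Z ?Z X = 0" "T ?Z ?Z Y = 0"
    using a b r(1) s by (simp_all add: T_lin T_comm)
  have "T ?Z ?Z X' = 2 * x * y * A + y * y * (-2 * B)"
    unfolding AB(2)[symmetric] A_def using a by (simp add: T_lin T_comm algebra_simps)
  also have "\<dots> = 2 * y * (x * A - y * B)" by (simp add: algebra_simps)
  finally have e3: "T ?Z ?Z X' = 0" using xy by simp
  have "T ?Z ?Z Y' = 2 * x * y * B + x * x * (-2 * A)"
    unfolding AB(1)[symmetric] B_def using b by (simp add: T_lin T_comm algebra_simps)
  also have "\<dots> = - 2 * x * (x * A - y * B)" by (simp add: algebra_simps)
  finally have e4: "T ?Z ?Z Y' = 0" using xy by simp
  have "T ?Z ?Z w = 0" for w
  proof -
    obtain k l m n where w: "w = k *s X + l *s X' + m *s Y + n *s Y'"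
      using U span4[of w X X' Y Y'] by auto
    show ?thesis unfolding w T_add3 T_scale3 using e e3 e4 by simp
  qed
  then show False using not_singular_point[OF Z] by blast
qed

lemma skew_zero:
  assumes "on_surface L" "on_surface M" "L \<noteq> M" "\<not> meets L M" "x \<in> L" "x \<in> M"
  shows "x = 0"
  using assms unfolding meets_def by blast

text \<open>In the next two lemmas \<open>a0 s^3 + a1 s^2 r + a2 s r^2 + a3 r^3\<close> is the binary cubic \<open>T(X, X, Y)\<close> above.
  The fourth line meets the quadric containing the first three in two points (possibly conjugate), which
  lie on transversals contained in the surface: those over the roots of \<open>s^2 + t s r - d r^2\<close>. Hence this form
  divides the cubic, and the remaining root is rational.\<close>

lemma double_root_identity:
  fixes a0 a1 a2 a3 d t :: rat
  assumes "a2 = -d * a0 + t * (a1 - t * a0)" "a3 = -d * (a1 - t * a0)"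
    and "s = t * a0 - a1" "r = a0"
  shows "a0 * s^3 + a1 * s\<^sup>2 * r + a2 * s * r\<^sup>2 + a3 * r^3 = 0"
    and "s\<^sup>2 + t * s * r - d * r\<^sup>2 = 0 \<Longrightarrow>
      3 * a0 * s\<^sup>2 * (-r) + a1 * (2 * s * r * (-r) + s\<^sup>2 * s) + a2 * (r\<^sup>2 * (-r) + 2 * s * r * s) + 3 * a3 * r\<^sup>2 * s = 0"
  using assms by algebra+

lemma quotient_identity:
  fixes a1 :: rat
  assumes "d \<noteq> 0" "1 - t - d \<noteq> 0"
    and c: "a1 + b1 = 0" "a2 + 2 * a3 + 2 * b2 + b4 = 0" "2 * a4 + a5 + b3 + 2 * b5 = 0" "a6 + b6 = 0"
    and k: "a2 + b3 = 0" "d * a1 + t * a2 + 2 * a4 + 2 * d * b2 + 2 * t * b3 + b6 = 0"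
      "2 * d * a3 + 2 * t * a4 + d * d * b1 + 2 * d * t * b2 + t * t * b3 + a6 + 2 * d * b5 + 2 * t * b6 = 0"
      "d * a5 + t * a6 + d * d * b4 + 2 * d * t * b5 + t * t * b6 = 0"
  shows "2 * a4 + a5 = -d * a1 + t * (a2 + 2 * a3 - t * a1)" "a6 = -d * (a2 + 2 * a3 - t * a1)"
proof -
  have b: "b1 = - a1" "b6 = - a6" "b3 = - a2" "b4 = - a2 - 2 * a3 - 2 * b2" "2 * b5 = a2 - 2 * a4 - a5"
    using c k(1) by auto
  have e1: "d * (2 * a4 + a5) = d * (a2 + 2 * a3) - d * (d + t) * a1 + (1 - t) * a6"
    using k(2,3) b by algebra
  have e2: "d * (2 * a4 + a5) + (t - d - t * t) * a6 - d * d * (a2 + 2 * a3) + d * d * a1 - d * t * (2 * a4 + a5) = 0"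
    using k(2,4) b by algebra
  \<comment> \<open>Eliminating \<open>2 * a4 + a5\<close> between \<open>e1\<close> and
    \<open>e2\<close> leaves one coefficient of the division remainder, multiplied by
    \<open>1 - t - d\<close>.\<close>
  have "(1 - t - d) * (d * (a2 + 2 * a3) - d * t * a1 + a6) = 0"
    using e1 e2 by algebra
  then have "d * (a2 + 2 * a3) - d * t * a1 + a6 = 0" using assms(2) by simp
  then show a6: "a6 = -d * (a2 + 2 * a3 - t * a1)" by algebra
  have "d * (2 * a4 + a5) = d * (-d * a1 + t * (a2 + 2 * a3 - t * a1))"
    using e1 a6 by algebra
  then show "2 * a4 + a5 = -d * a1 + t * (a2 + 2 * a3 - t * a1)" using assms(1) by simp
qed

text \<open>(-r, s) completes (s, r) to a basis because the determinant s^2 + r^2 is nonzero over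
  the rationals; no case split on which coordinate vanishes is needed.\<close>

lemma span_rotate:
  fixes e1 e2 :: "rat^4"
  assumes "s \<noteq> 0 \<or> r \<noteq> 0"
  shows "e1 \<in> vec.span {s *s e1 + r *s e2, (-r) *s e1 + s *s e2}"
    "e2 \<in> vec.span {s *s e1 + r *s e2, (-r) *s e1 + s *s e2}"
proof -
  let ?n = "s * s + r * r"
  have n: "?n \<noteq> 0" using assms by (simp add: sum_squares_eq_zero_iff)
  have "(s / ?n) *s (s *s e1 + r *s e2) + (- r / ?n) *s ((-r) *s e1 + s *s e2) = (1 / ?n) *s (?n *s e1)"
    "(r / ?n) *s (s *s e1 + r *s e2) + (s / ?n) *s ((-r) *s e1 + s *s e2) = (1 / ?n) *s (?n *s e2)"
    by (simp_all add: vec_eq_iff add_divide_distrib algebra_simps)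
  moreover have "1 / ?n * ?n = 1" using n by (rule nonzero_eq_divide_eq[THEN iffD1]) (rule refl)
  then have "(1 / ?n) *s (?n *s e) = e" for e :: "rat^4"
    by (simp only: vec.scale_scale vec.scale_one)
  ultimately show "e1 \<in> vec.span {s *s e1 + r *s e2, (-r) *s e1 + s *s e2}"
    "e2 \<in> vec.span {s *s e1 + r *s e2, (-r) *s e1 + s *s e2}"
    unfolding span2 by metis+
qed

lemma skew_independent:
  assumes skew: "a \<inter> b \<subseteq> {0}" and lines: "proj_line a" "proj_line b"
    and e: "e1 \<in> a" "e2 \<in> a" "e1 \<noteq> 0" "e2 \<notin> vec.span {e1}"
    and f: "f1 \<in> b" "f2 \<in> b" "f1 \<noteq> 0" "f2 \<notin> vec.span {f1}"
  shows "x *s e1 + y *s e2 + z *s f1 + w *s f2 = 0 \<Longrightarrow> x = 0 \<and> y = 0 \<and> z = 0 \<and> w = 0"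
    and "vec.span {e1, e2, f1, f2} = UNIV"
proof -
  have ind: "x = 0 \<and> y = 0 \<and> z = 0 \<and> w = 0" if 0: "x *s e1 + y *s e2 + z *s f1 + w *s f2 = 0" for x y z w
  proof -
    have E: "x *s e1 + y *s e2 = (-z) *s f1 + (-w) *s f2"
      using 0 by (simp add: vec_eq_iff algebra_simps eq_neg_iff_add_eq_0)
    have "x *s e1 + y *s e2 \<in> a" using proj_line_lincomb[OF lines(1) e(1,2)] .
    moreover have "x *s e1 + y *s e2 \<in> b" unfolding E using proj_line_lincomb[OF lines(2) f(1,2)] .
    ultimately have "x *s e1 + y *s e2 = 0" using skew by blast
    then show ?thesis using independent2[OF e(3,4)] independent2[OF f(3,4), of "-z" "-w"] E by auto
  qed
  show "x *s e1 + y *s e2 + z *s f1 + w *s f2 = 0 \<Longrightarrow> x = 0 \<and> y = 0 \<and> z = 0 \<and> w = 0"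
    by (rule ind)
  show "vec.span {e1, e2, f1, f2} = UNIV"
  proof (rule span4_UNIV[OF e(3,4)])
    show "f1 \<notin> vec.span {e1, e2}"
    proof
      assume "f1 \<in> vec.span {e1, e2}"
      then obtain x y where "f1 = x *s e1 + y *s e2" unfolding span2 by blast
      then have "x *s e1 + y *s e2 + (-1) *s f1 + 0 *s f2 = 0" by simp
      from ind[OF this] show False by simp
    qed
    show "f2 \<notin> vec.span {e1, e2, f1}"
    proof
      assume "f2 \<in> vec.span {e1, e2, f1}"
      then obtain x y z where "f2 = x *s e1 + y *s e2 + z *s f1" unfolding span3 by blast
      then have "x *s e1 + y *s e2 + z *s f1 + (-1) *s f2 = 0" by simp
      from ind[OF this] show False by simp
    qed
  qed
qed

text \<open>\<open>c\<close> and \<open>d\<close> are graphs of maps from \<open>a\<close> to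
  \<open>b\<close>. In these bases \<open>c\<close> is the identity and \<open>d\<close> has a
  companion matrix. The transversal of \<open>a\<close>, \<open>b\<close>, \<open>c\<close> through
  X = s e1 + r e2 meets \<open>d\<close> exactly when X is an eigenvector, that is, s^2 + t s r - k
  r^2 = 0.\<close>

lemma transversal_companion:
  assumes os: "on_surface a" "on_surface b" "on_surface c" "on_surface d"
    and disj: "a \<inter> b \<subseteq> {0}" "a \<inter> c \<subseteq> {0}" "b \<inter> c \<subseteq> {0}"
      "a \<inter> d \<subseteq> {0}" "b \<inter> d \<subseteq> {0}" "c \<inter> d \<subseteq> {0}"
    and ef: "e1 \<in> a" "e2 \<in> a" "f1 \<in> b" "f2 \<in> b" "e1 \<noteq> 0" "f2 \<notin> vec.span {f1}"
    and c: "e1 + f1 \<in> c" "e2 + f2 \<in> c" and d: "e1 + f2 \<in> d" "e2 + (k *s f1 + t *s f2) \<in> d"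
  shows "\<exists>y. on_surface y \<and> (\<exists>x\<in>y. x \<in> a \<and> x \<noteq> 0) \<and> (\<exists>x\<in>y. x \<in> b \<and> x \<noteq> 0) \<and>
    (\<exists>x\<in>y. x \<in> c \<and> x \<noteq> 0) \<and> (\<forall>x\<in>y. x \<in> d \<longrightarrow> x = 0)"
proof -
  have skew: "\<And>x. x \<in> a \<Longrightarrow> x \<in> b \<Longrightarrow> x = 0" "\<And>x. x \<in> a \<Longrightarrow> x \<in> c \<Longrightarrow> x = 0" "\<And>x. x \<in> b \<Longrightarrow> x \<in> c \<Longrightarrow> x = 0"
      "\<And>x. x \<in> a \<Longrightarrow> x \<in> d \<Longrightarrow> x = 0" "\<And>x. x \<in> b \<Longrightarrow> x \<in> d \<Longrightarrow> x = 0" "\<And>x. x \<in> c \<Longrightarrow> x \<in> d \<Longrightarrow> x = 0"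
    using disj by blast+
  have lines: "proj_line a" "proj_line b" "proj_line c" "proj_line d"
    using os unfolding on_surface_def by auto
  note lc = proj_line_lincomb[OF lines(1)] proj_line_lincomb[OF lines(2)]
    proj_line_lincomb[OF lines(3)] proj_line_lincomb[OF lines(4)]
  have f1: "f1 \<noteq> 0" using skew(2)[OF ef(1)] c(1) ef(5) by auto
  have e2: "e2 \<notin> vec.span {e1}"
  proof
    assume "e2 \<in> vec.span {e1}"
    then obtain l where l: "e2 = l *s e1" by (auto simp: vec.span_singleton)
    have "(-l) *s (e1 + f1) + 1 *s (e2 + f2) = (-l) *s f1 + 1 *s f2"
      unfolding l by (simp add: vec_eq_iff algebra_simps)
    then have "(-l) *s f1 + 1 *s f2 \<in> c" using lc(3)[OF c] by metis
    then have "(-l) *s f1 + 1 *s f2 = 0" using skew(3) lc(2)[OF ef(3,4)] by blast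
    from independent2[OF f1 ef(6) this] show False by simp
  qed
  note ind = skew_independent(1)[OF disj(1) lines(1,2) ef(1,2,5) e2 ef(3,4) f1 ef(6)]
    and U = skew_independent(2)[OF disj(1) lines(1,2) ef(1,2,5) e2 ef(3,4) f1 ef(6)]
  \<comment> \<open>Eigenvalue 0 would put a point of \<open>a\<close> on \<open>d\<close>.\<close>
  have k0: "k \<noteq> 0"
  proof
    assume "k = 0"
    then have "(-t) *s (e1 + f2) + 1 *s (e2 + (k *s f1 + t *s f2)) = (-t) *s e1 + 1 *s e2"
      by (simp add: vec_eq_iff algebra_simps)
    then have "(-t) *s e1 + 1 *s e2 \<in> d" using lc(4)[OF d] by metis
    then have "(-t) *s e1 + 1 *s e2 = 0" using skew(4) lc(1)[OF ef(1,2)] by blast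
    from independent2[OF ef(5) e2 this] show False by simp
  qed
  \<comment> \<open>Eigenvalue 1 would put a point of \<open>c\<close> on \<open>d\<close>.\<close>
  have kt: "1 - t - k \<noteq> 0"
  proof
    assume "1 - t - k = 0"
    then have t: "t = 1 - k" by simp
    have "k *s (e1 + f2) + 1 *s (e2 + (k *s f1 + t *s f2)) = k *s (e1 + f1) + 1 *s (e2 + f2)"
      unfolding t by (simp add: vec_eq_iff algebra_simps)
    then have "k *s (e1 + f1) + 1 *s (e2 + f2) \<in> d" using lc(4)[OF d] by metis
    then have "k *s (e1 + f1) + 1 *s (e2 + f2) = 0" using skew(6) lc(3)[OF c] by blast
    then have "k *s e1 + 1 *s e2 + k *s f1 + 1 *s f2 = 0" by (simp add: vec_eq_iff algebra_simps)
    from ind[OF this] show False by simp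
  qed
  note az = on_surface_polar[OF os(1)] and bz = on_surface_polar[OF os(2)]
    and cz = on_surface_polar[OF os(3)] and dz = on_surface_polar[OF os(4)]
  note A = az[OF ef(1) ef(1) ef(1)] az[OF ef(1) ef(1) ef(2)] az[OF ef(1) ef(2) ef(2)] az[OF ef(2) ef(2) ef(2)]
    and B = bz[OF ef(3) ef(3) ef(3)] bz[OF ef(3) ef(3) ef(4)] bz[OF ef(3) ef(4) ef(4)] bz[OF ef(4) ef(4) ef(4)]
    and C = cz[OF c(1) c(1) c(1)] cz[OF c(1) c(1) c(2)] cz[OF c(1) c(2) c(2)] cz[OF c(2) c(2) c(2)]
    and D = dz[OF d(1) d(1) d(1)] dz[OF d(1) d(1) d(2)] dz[OF d(1) d(2) d(2)] dz[OF d(2) d(2) d(2)]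
  have comm: "T e2 e1 x = T e1 e2 x" "T f2 f1 x = T f1 f2 x" "T f1 e1 x = T e1 f1 x" "T f1 e2 x = T e2 f1 x"
     "T f2 e1 x = T e1 f2 x" "T f2 e2 x = T e2 f2 x" 
     "T x e2 e1 = T x e1 e2" "T x f2 f1 = T x f1 f2" "T x f1 e1 = T x e1 f1" "T x f1 e2 = T x e2 f1"
     "T x f2 e1 = T x e1 f2" "T x f2 e2 = T x e2 f2" for x
    using T_perm by blast+
  define a1 a2 a3 a4 a5 a6 where a: "a1 = T e1 e1 f1" "a2 = T e1 e1 f2" "a3 = T e1 e2 f1" "a4 = T e1 e2 f2"
    "a5 = T e2 e2 f1" "a6 = T e2 e2 f2"
  define b1 b2 b3 b4 b5 b6 where b: "b1 = T e1 f1 f1" "b2 = T e1 f1 f2" "b3 = T e1 f2 f2" "b4 = T e2 f1 f1"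
    "b5 = T e2 f1 f2" "b6 = T e2 f2 f2"
  have C': "a1 + b1 = 0" "a2 + 2 * a3 + 2 * b2 + b4 = 0" "2 * a4 + a5 + b3 + 2 * b5 = 0" "a6 + b6 = 0"
    using C A B unfolding a b by (simp_all add: T_lin comm)
  have D': "a2 + b3 = 0" "k * a1 + t * a2 + 2 * a4 + 2 * k * b2 + 2 * t * b3 + b6 = 0"
    "2 * k * a3 + 2 * t * a4 + k * k * b1 + 2 * k * t * b2 + t * t * b3 + a6 + 2 * k * b5 + 2 * t * b6 = 0"
    "k * a5 + t * a6 + k * k * b4 + 2 * k * t * b5 + t * t * b6 = 0"
    using D A B unfolding a b by (simp_all add: T_lin comm algebra_simps)
  define \<alpha>1 \<alpha>2 where \<alpha>: "\<alpha>1 = a2 + 2 * a3" "\<alpha>2 = 2 * a4 + a5"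
  have q: "\<alpha>2 = -k * a1 + t * (\<alpha>1 - t * a1)" "a6 = -k * (\<alpha>1 - t * a1)"
    unfolding \<alpha> using quotient_identity[OF k0 kt C' D'] by simp_all
  have cubic: "T (s *s e1 + r *s e2) (s *s e1 + r *s e2) (s *s f1 + r *s f2)
      = a1 * s^3 + \<alpha>1 * s\<^sup>2 * r + \<alpha>2 * s * r\<^sup>2 + a6 * r^3" for s r
    unfolding \<alpha> a by (simp add: T_lin comm power3_eq_cube power2_eq_square algebra_simps)
  have deriv: "2 * T (s *s e1 + r *s e2) ((-r) *s e1 + s *s e2) (s *s f1 + r *s f2)
      + T (s *s e1 + r *s e2) (s *s e1 + r *s e2) ((-r) *s f1 + s *s f2)
      = 3 * a1 * s\<^sup>2 * (-r) + \<alpha>1 * (2 * s * r * (-r) + s\<^sup>2 * s) + \<alpha>2 * (r\<^sup>2 * (-r) + 2 * s * r * s) + 3 * a6 * r\<^sup>2 * s" for s r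
    unfolding \<alpha> a by (simp add: T_lin T_diff comm power3_eq_cube power2_eq_square algebra_simps)
  have no_double: False
    if sr: "s \<noteq> 0 \<or> r \<noteq> 0"
      and "a1 * s^3 + \<alpha>1 * s\<^sup>2 * r + \<alpha>2 * s * r\<^sup>2 + a6 * r^3 = 0"
      and "3 * a1 * s\<^sup>2 * (-r) + \<alpha>1 * (2 * s * r * (-r) + s\<^sup>2 * s) + \<alpha>2 * (r\<^sup>2 * (-r) + 2 * s * r * s) + 3 * a6 * r\<^sup>2 * s = 0"
    for s r
  proof -
    let ?X = "s *s e1 + r *s e2" and ?X' = "(-r) *s e1 + s *s e2"
      and ?Y = "s *s f1 + r *s f2" and ?Y' = "(-r) *s f1 + s *s f2"
    have aX: "?X \<in> a" "?X' \<in> a" "?Y \<in> b" "?Y' \<in> b"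
      by (rule lc(1)[OF ef(1,2)] lc(2)[OF ef(3,4)])+
    have g: "?X + ?Y = s *s (e1 + f1) + r *s (e2 + f2)" "?X' + ?Y' = (-r) *s (e1 + f1) + s *s (e2 + f2)"
      by (simp_all add: vec_eq_iff algebra_simps)
    then have cX: "?X + ?Y \<in> c" "?X' + ?Y' \<in> c" using lc(3)[OF c] by metis+
    have X0: "?X \<noteq> 0" using independent2[OF ef(5) e2] sr by blast
    have Y0: "?Y \<noteq> 0" using independent2[OF f1 ef(6)] sr by blast
    have YX: "?Y \<notin> vec.span {?X}"
    proof
      assume "?Y \<in> vec.span {?X}"
      then obtain l where "?Y = l *s ?X" by (auto simp: vec.span_singleton)
      then have "?Y = l *s ?X + 0 *s ?X" by simp
      then have "?Y \<in> a" using lc(1)[OF aX(1,1)] by metis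
      then show False using skew(1) aX(3) Y0 by blast
    qed
    have "{e1, e2, f1, f2} \<subseteq> vec.span {?X, ?X', ?Y, ?Y'}"
      using span_rotate[OF sr] vec.span_mono[of "{?X, ?X'}" "{?X, ?X', ?Y, ?Y'}"]
        vec.span_mono[of "{?Y, ?Y'}" "{?X, ?X', ?Y, ?Y'}"] by blast
    then have "vec.span {?X, ?X', ?Y, ?Y'} = UNIV"
      using vec.span_minimal[of "{e1, e2, f1, f2}" "vec.span {?X, ?X', ?Y, ?Y'}"] U by auto
    note sing = transversal_no_double_root[OF this X0 YX az[OF aX(1,1,1)] az[OF aX(1,1,2)] bz[OF aX(3,3,3)] bz[OF aX(3,3,4)]
        cz[OF cX(1,1,1)] cz[OF cX(1,1,2)]]
    show False
      by (rule sing[OF trans[OF cubic that(2)] trans[OF deriv that(3)]])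
  qed
  \<comment> \<open>Root of the cofactor a1 s + (\<alpha>1 - t a1) r left after dividing the cubic
    by the eigenvector quadratic.\<close>
  define s r where sr: "s = t * a1 - \<alpha>1" "r = a1"
  \<comment> \<open>A zero cofactor would make the whole cubic zero, and then (1, 0) is a double
    root.\<close>
  have sr0: "s \<noteq> 0 \<or> r \<noteq> 0"
  proof (rule ccontr)
    assume "\<not> (s \<noteq> 0 \<or> r \<noteq> 0)"
    then have "a1 = 0" "\<alpha>1 = 0" "\<alpha>2 = 0" "a6 = 0" using q unfolding sr by auto
    then show False using no_double[of 1 0] by simp
  qed
  note root = double_root_identity[OF q sr]
  let ?X = "s *s e1 + r *s e2" and ?Y = "s *s f1 + r *s f2"
  have aX: "?X \<in> a" "?Y \<in> b" by (rule lc(1)[OF ef(1,2)] lc(2)[OF ef(3,4)])+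
  have g: "?X + ?Y = s *s (e1 + f1) + r *s (e2 + f2)" by (simp add: vec_eq_iff algebra_simps)
  then have cX: "?X + ?Y \<in> c" using lc(3)[OF c] by metis
  have X0: "?X \<noteq> 0" using independent2[OF ef(5) e2] sr0 by blast
  have Y0: "?Y \<noteq> 0" using independent2[OF f1 ef(6)] sr0 by blast
  have YX: "?Y \<notin> vec.span {?X}"
  proof
    assume "?Y \<in> vec.span {?X}"
    then obtain l where "?Y = l *s ?X" by (auto simp: vec.span_singleton)
    then have "?Y = l *s ?X + 0 *s ?X" by simp
    then have "?Y \<in> a" using lc(1)[OF aX(1,1)] by metis
    then show False using skew(1) aX(2) Y0 by blast
  qed
  have XX: "?X + ?Y \<noteq> 0"
    using independent2[OF X0 YX, of 1 1] by auto
  have TX: "T ?X ?X ?X = 0" "T ?Y ?Y ?Y = 0" using az[OF aX(1,1,1)] bz[OF aX(2,2,2)] by auto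
  have XXY: "T ?X ?X ?Y = 0" using cubic root(1) by simp
  have XYY: "T ?X ?Y ?Y = 0" using T_cube_add[of ?X ?Y] cz[OF cX cX cX] TX XXY by linarith
  let ?y = "vec.span {?X, ?Y}"
  have y: "on_surface ?y" using on_surface_span[OF X0 YX TX(1) XXY XYY TX(2)] .
  have mem: "?X \<in> ?y" "?Y \<in> ?y" by (simp_all add: vec.span_base)
  then have "?X + ?Y \<in> ?y" using vec.span_add by blast
  \<comment> \<open>If the new transversal met \<open>d\<close>, the quadratic would vanish at (s,
    r) as well, giving the cubic a double root.\<close>
  moreover have "x = 0" if xy: "x \<in> ?y" and xd: "x \<in> d" for x
  proof (rule ccontr)
    assume x0: "x \<noteq> 0"
    have "e1 + f2 \<noteq> 0" "e2 + (k *s f1 + t *s f2) \<notin> vec.span {e1 + f2}"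
    proof -
      have i: "u = 0 \<and> v = 0" if "u *s (e1 + f2) + v *s (e2 + (k *s f1 + t *s f2)) = 0" for u v
      proof -
        have "u *s e1 + v *s e2 + (v * k) *s f1 + (u + v * t) *s f2 = 0"
          using that by (simp add: vec_eq_iff algebra_simps)
        from ind[OF this] show ?thesis by simp
      qed
      show "e1 + f2 \<noteq> 0" "e2 + (k *s f1 + t *s f2) \<notin> vec.span {e1 + f2}"
        using not_in_span1[of "e1 + f2" "e2 + (k *s f1 + t *s f2)"] i by blast+
    qed
    from proj_line_eq_span[OF lines(4) d this] xd
    obtain u v where x: "x = u *s (e1 + f2) + v *s (e2 + (k *s f1 + t *s f2))"
      unfolding span2 by (metis span2)
    obtain m n where x': "x = m *s ?X + n *s ?Y" using xy unfolding span2 by blast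
    have "(m * s - u) *s e1 + (m * r - v) *s e2 + (n * s - k * v) *s f1 + (n * r - u - t * v) *s f2 = 0"
      using x x' by (simp add: vec_eq_iff algebra_simps)
    from ind[OF this] have uv: "u = m * s" "v = m * r" "n * s = k * v" "n * r = u + t * v" by auto
    have "m \<noteq> 0" using uv x x0 by auto
    moreover have "m * (s\<^sup>2 + t * s * r - k * r\<^sup>2) = 0" using uv by algebra
    ultimately have "s\<^sup>2 + t * s * r - k * r\<^sup>2 = 0" by simp
    from no_double[OF sr0 root(1) root(2)[OF this]] show False .
  qed
  ultimately show ?thesis using y mem aX cX X0 Y0 XX by blast
qed

text \<open>A companion basis exists as soon as some vector of \<open>a\<close> is not an
  eigenvector of the map comparing \<open>c\<close> with \<open>d\<close>. If all are eigenvectors,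
  every transversal of \<open>a\<close>, \<open>b\<close>, \<open>c\<close> meets \<open>d\<close>;
  the binary cubic is then identically zero, contradicting nonsingularity.\<close>

lemma skew_transversal:
  assumes os: "on_surface a" "on_surface b" "on_surface c" "on_surface d"
    and disj: "a \<inter> b \<subseteq> {0}" "a \<inter> c \<subseteq> {0}" "b \<inter> c \<subseteq> {0}"
      "a \<inter> d \<subseteq> {0}" "b \<inter> d \<subseteq> {0}" "c \<inter> d \<subseteq> {0}"
  shows "\<exists>y. on_surface y \<and> (\<exists>x\<in>y. x \<in> a \<and> x \<noteq> 0) \<and> (\<exists>x\<in>y. x \<in> b \<and> x \<noteq> 0) \<and>
    (\<exists>x\<in>y. x \<in> c \<and> x \<noteq> 0) \<and> (\<forall>x\<in>y. x \<in> d \<longrightarrow> x = 0)"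
proof -
  have skew: "\<And>x. x \<in> a \<Longrightarrow> x \<in> b \<Longrightarrow> x = 0" "\<And>x. x \<in> a \<Longrightarrow> x \<in> c \<Longrightarrow> x = 0" "\<And>x. x \<in> b \<Longrightarrow> x \<in> c \<Longrightarrow> x = 0"
      "\<And>x. x \<in> a \<Longrightarrow> x \<in> d \<Longrightarrow> x = 0" "\<And>x. x \<in> b \<Longrightarrow> x \<in> d \<Longrightarrow> x = 0" "\<And>x. x \<in> c \<Longrightarrow> x \<in> d \<Longrightarrow> x = 0"
    using disj by blast+
  have lines: "proj_line a" "proj_line b" "proj_line c" "proj_line d"
    using os unfolding on_surface_def by auto
  have decomp: "\<exists>f\<in>m. e + f \<in> l" if lm: "proj_line l" "proj_line m" "\<And>x. x \<in> m \<Longrightarrow> x \<in> l \<Longrightarrow> x = 0" for l m e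
  proof -
    obtain g h where g: "g \<in> m" "h \<in> l" "e = g + h" using skew_sum[OF lm(2,1,3)] by metis
    have "(-1) *s g + 0 *s g \<in> m" using proj_line_lincomb[OF lm(2) g(1,1)] .
    moreover have "e + ((-1) *s g + 0 *s g) = h" unfolding g(3) by simp
    ultimately show ?thesis using g(2) by metis
  qed
  have to_c: "\<exists>f\<in>b. e + f \<in> c" for e using decomp[OF lines(3,2)] skew(3) by blast
  have to_d: "\<exists>f\<in>b. e + f \<in> d" for e using decomp[OF lines(4,2)] skew(5) by blast
  have from_c: "\<exists>e\<in>a. e + f \<in> c" for f
    using decomp[OF lines(3,1), of f] skew(2) by (metis add.commute)
  show ?thesis
  proof (cases "\<exists>e f h. e \<in> a \<and> e \<noteq> 0 \<and> f \<in> b \<and> h \<in> b \<and> e + f \<in> c \<and> e + h \<in> d \<and> h \<notin> vec.span {f}")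
    case True
    then obtain e f h where e: "e \<in> a" "e \<noteq> 0" "f \<in> b" "h \<in> b" "e + f \<in> c" "e + h \<in> d" "h \<notin> vec.span {f}"
      by blast
    obtain e2 where e2: "e2 \<in> a" "e2 + h \<in> c" using from_c by blast
    obtain h2 where h2: "h2 \<in> b" "e2 + h2 \<in> d" using to_d by blast
    have "f \<noteq> 0" using skew(2)[OF e(1)] e(2,5) by auto
    from proj_line_eq_span[OF lines(2) e(3,4) this e(7)] h2(1)
    obtain k t where "h2 = k *s f + t *s h" using span2 by blast
    then have "e2 + (k *s f + t *s h) \<in> d" using h2(2) by simp
    then show ?thesis
      by (rule transversal_companion[OF os disj e(1) e2(1) e(3,4,2,7,5) e2(2) e(6)])
  next
    case False
    \<comment> \<open>On the line through \<open>e\<close> and \<open>f\<close> the form vanishes at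
      four distinct points, those on \<open>a\<close>, \<open>b\<close>, \<open>c\<close> and
      \<open>d\<close>, so its mixed coefficients vanish.\<close>
    have zero: "T e e f = 0" if ef: "e \<in> a" "f \<in> b" "e + f \<in> c" for e f
    proof (cases "e = 0")
      case True then show ?thesis using T_scale[of 0 e e f] by simp
    next
      case e0: False
      obtain h where h: "h \<in> b" "e + h \<in> d" using to_d by blast
      then have "h \<in> vec.span {f}" using False ef e0 by blast
      then obtain l where l: "h = l *s f" by (auto simp: vec.span_singleton)
      have l0: "l \<noteq> 0" using skew(4)[OF ef(1)] h(2) e0 unfolding l by auto
      have l1: "l \<noteq> 1"
      proof
        assume "l = 1"
        then have ef0: "e + f = 0" using skew(6) ef(3) h(2) l by simp
        have "1 *s e + 0 *s e = (-1) *s f + 0 *s f" using ef0 by (simp add: eq_neg_iff_add_eq_0)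
        then have "e \<in> b" using proj_line_lincomb[OF lines(2) ef(2,2), of "-1" 0] by simp
        then show False using skew(1) ef(1) e0 by blast
      qed
      have E: "T e e e = 0" "T f f f = 0" "T (e + f) (e + f) (e + f) = 0" "T (e + l *s f) (e + l *s f) (e + l *s f) = 0"
        using os ef h unfolding on_surface_def l by auto
      have "T e e f + T e f f = 0" using E by (simp add: T_lin T_comm)
      moreover have "l * T e e f + l * l * T e f f = 0" using E by (simp add: T_lin T_comm)
      ultimately have "l * (1 - l) * T e e f = 0" by algebra
      then show ?thesis using l0 l1 by simp
    qed
    obtain e1 where e1: "e1 \<in> a" "e1 \<noteq> 0" using proj_line_nonzero[OF lines(1)] .
    obtain e2 where e2: "e2 \<in> a" "e2 \<notin> vec.span {e1}" using proj_line_basis[OF lines(1) e1] .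
    obtain f1 where f1: "f1 \<in> b" "e1 + f1 \<in> c" using to_c by blast
    obtain f2 where f2: "f2 \<in> b" "e2 + f2 \<in> c" using to_c by blast
    have f10: "f1 \<noteq> 0" using skew(2)[OF e1(1)] e1 f1(2) by auto
    have f2n: "f2 \<notin> vec.span {f1}"
    proof
      assume "f2 \<in> vec.span {f1}"
      then obtain l where l: "f2 = l *s f1" by (auto simp: vec.span_singleton)
      have "(-l) *s (e1 + f1) + 1 *s (e2 + f2) = (-l) *s e1 + 1 *s e2"
        unfolding l by (simp add: vec_eq_iff algebra_simps)
      then have "(-l) *s e1 + 1 *s e2 \<in> c" using proj_line_lincomb[OF lines(3) f1(2) f2(2)] by metis
      then have "(-l) *s e1 + 1 *s e2 = 0" using skew(2) proj_line_lincomb[OF lines(1) e1(1) e2(1)] by blast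
      from independent2[OF e1(2) e2(2) this] show False by simp
    qed
    note ind = skew_independent[OF disj(1) lines(1,2) e1(1) e2(1) e1(2) e2(2) f1(1) f2(1) f10 f2n]
    \<comment> \<open>The vanishing cubic is evaluated at (1, 0), (0, 1), (1, 1) and (1, -1), which
      determines its coefficients.\<close>
    have sums: "e1 + e2 \<in> a" "f1 + f2 \<in> b" "(e1 + e2) + (f1 + f2) \<in> c"
      "e1 + (-1) *s e2 \<in> a" "f1 + (-1) *s f2 \<in> b" "(e1 + (-1) *s e2) + (f1 + (-1) *s f2) \<in> c"
    proof -
      show "e1 + e2 \<in> a" "f1 + f2 \<in> b" "e1 + (-1) *s e2 \<in> a" "f1 + (-1) *s f2 \<in> b"
        using proj_line_lincomb[OF lines(1) e1(1) e2(1), of 1] proj_line_lincomb[OF lines(2) f1(1) f2(1), of 1]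
        by (metis vec.scale_one)+
      have "(e1 + e2) + (f1 + f2) = 1 *s (e1 + f1) + 1 *s (e2 + f2)"
        "(e1 + (-1) *s e2) + (f1 + (-1) *s f2) = 1 *s (e1 + f1) + (-1) *s (e2 + f2)"
        by (simp_all add: vec_eq_iff algebra_simps)
      then show "(e1 + e2) + (f1 + f2) \<in> c" "(e1 + (-1) *s e2) + (f1 + (-1) *s f2) \<in> c"
        using proj_line_lincomb[OF lines(3) f1(2) f2(2)] by metis+
    qed
    note Z = zero[OF e1(1) f1] zero[OF e2(1) f2] zero[OF sums(1-3)] zero[OF sums(4-6)]
    have r: "2 * T e1 e2 f1 + T e1 e1 f2 = 0"
      using Z T_perm[of e1 e2 f1] T_perm[of e1 e2 f2] by (simp add: T_lin T_diff algebra_simps)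
    have f1e: "f1 \<notin> vec.span {e1}"
    proof
      assume "f1 \<in> vec.span {e1}"
      then obtain l where "f1 = l *s e1" by (auto simp: vec.span_singleton)
      then have "l *s e1 + 0 *s e2 + (-1) *s f1 + 0 *s f2 = 0" by simp
      from ind(1)[OF this] show False by simp
    qed
    from transversal_no_double_root[OF ind(2) e1(2) f1e on_surface_polar[OF os(1) e1(1,1,1)]
        on_surface_polar[OF os(1) e1(1,1) e2(1)] on_surface_polar[OF os(2) f1(1,1,1)]
        on_surface_polar[OF os(2) f1(1,1) f2(1)] on_surface_polar[OF os(3) f1(2,2,2)]
        on_surface_polar[OF os(3) f1(2,2) f2(2)] Z(1) r]
    show ?thesis by blast
  qed
qed

end

sublocale nonsingular_cubic_form \<subseteq> line_configuration "{L. on_surface L}" meets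
proof
  show "x \<in> {L. on_surface L}" if "meets x y" for x y
    using that unfolding meets_def by blast
  show "meets y x" if "meets x y" for x y
    using that by (rule meets_sym)
  show "\<not> meets x x" for x
    unfolding meets_def by blast
  show "\<exists>z. meets x z \<and> meets y z" if "meets x y" for x y
    using plane_triangle[OF that] by blast
  show "z = w" if m: "meets x y" "meets x z" "meets y z" "meets x w" "meets y w" for x y z w
  proof -
    obtain N where "\<forall>W. meets W x \<and> meets W y \<longrightarrow> W = N"
      using plane_triangle[OF m(1)] by blast
    then show ?thesis using m meets_sym by blast
  qed
  show "w = x \<or> w = y \<or> w = z \<or> meets w x \<or> meets w y \<or> meets w z"
    if m: "meets x y" "meets x z" "meets y z" and w: "w \<in> {L. on_surface L}" for x y z w
  proof -
    obtain N where N: "\<forall>W. meets W x \<and> meets W y \<longrightarrow> W = N"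
      "\<forall>W. on_surface W \<longrightarrow> W = x \<or> W = y \<or> W = N \<or> meets W x \<or> meets W y \<or> meets W N"
      using plane_triangle[OF m(1)] by blast
    then have "N = z" using m meets_sym by blast
    then show ?thesis using N(2) w by blast
  qed
  show "\<exists>y. meets y a \<and> meets y b \<and> meets y c \<and> \<not> meets y d"
    if "distinct [a, b, c, d]" "{a, b, c, d} \<subseteq> {L. on_surface L}"
      "\<not> meets a b" "\<not> meets a c" "\<not> meets a d" "\<not> meets b c" "\<not> meets b d" "\<not> meets c d" for a b c d
  proof -
    have os: "on_surface a" "on_surface b" "on_surface c" "on_surface d" using that(2) by auto
    have ne: "a \<noteq> b" "a \<noteq> c" "a \<noteq> d" "b \<noteq> c" "b \<noteq> d" "c \<noteq> d" using that(1) by auto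
    have skew: "\<And>x. x \<in> a \<Longrightarrow> x \<in> b \<Longrightarrow> x = 0" "\<And>x. x \<in> a \<Longrightarrow> x \<in> c \<Longrightarrow> x = 0" "\<And>x. x \<in> b \<Longrightarrow> x \<in> c \<Longrightarrow> x = 0"
      "\<And>x. x \<in> a \<Longrightarrow> x \<in> d \<Longrightarrow> x = 0" "\<And>x. x \<in> b \<Longrightarrow> x \<in> d \<Longrightarrow> x = 0" "\<And>x. x \<in> c \<Longrightarrow> x \<in> d \<Longrightarrow> x = 0"
      using skew_zero os ne that(3-8) by metis+
    then have disj: "a \<inter> b \<subseteq> {0}" "a \<inter> c \<subseteq> {0}" "b \<inter> c \<subseteq> {0}"
      "a \<inter> d \<subseteq> {0}" "b \<inter> d \<subseteq> {0}" "c \<inter> d \<subseteq> {0}" by blast+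
    obtain y where y: "on_surface y" "\<exists>x\<in>y. x \<in> a \<and> x \<noteq> 0" "\<exists>x\<in>y. x \<in> b \<and> x \<noteq> 0"
      "\<exists>x\<in>y. x \<in> c \<and> x \<noteq> 0" "\<forall>x\<in>y. x \<in> d \<longrightarrow> x = 0"
      using skew_transversal[OF os disj] by blast
    have "y \<noteq> a" "y \<noteq> b" "y \<noteq> c" using y skew by metis+
    then show ?thesis using y os unfolding meets_def by metis
  qed
qed

section \<open>The polar form of a cubic\<close>

definition exponents :: "4 \<Rightarrow> 4 \<Rightarrow> 4 \<Rightarrow> nat \<times> nat \<times> nat \<times> nat" where
  "exponents i j k = (let n = (\<lambda>a. of_bool (i = a) + of_bool (j = a) + of_bool (k = a)) in (n 0, n 1, n 2, n 3))"

text \<open>Differentiating the monomial with exponents \<open>m\<close> exactly to the order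
  \<open>m\<close> leaves the product of factorials.\<close>

definition third_derivative :: "cubic_coeffs \<Rightarrow> nat \<times> nat \<times> nat \<times> nat \<Rightarrow> rat" where
  "third_derivative c m = (case m of (i, j, k, l) \<Rightarrow> c m * (fact i * fact j * fact k * fact l))"

text \<open>The trilinear form of third derivatives, so that \<open>polar c x x x = 6 F(x)\<close>.\<close>

definition polar :: "cubic_coeffs \<Rightarrow> 'a::field_char_0 ^ 4 \<Rightarrow> 'a ^ 4 \<Rightarrow> 'a ^ 4 \<Rightarrow> 'a" where
  "polar c x y z = (\<Sum>i\<in>UNIV. \<Sum>j\<in>UNIV. \<Sum>k\<in>UNIV.
      of_rat (third_derivative c (exponents i j k)) * (x$i * y$j * z$k))"

lemma UNIV_4: "(UNIV :: 4 set) = {0, 1, 2, 3}"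
proof -
  have "(4 :: 4) = 0" by simp
  then have "x \<in> {0, 1, 2, 3}" for x :: 4 using exhaust_4[of x] by auto
  then show ?thesis by blast
qed

lemma sum_UNIV_4: "(\<Sum>i\<in>(UNIV :: 4 set). f i) = f 0 + f 1 + f 2 + f 3"
  unfolding UNIV_4 by (simp add: add.assoc)

lemma all_4: "(\<forall>i :: 4. P i) \<longleftrightarrow> P 0 \<and> P 1 \<and> P 2 \<and> P 3"
proof -
  have "(\<forall>i\<in>(UNIV :: 4 set). P i) \<longleftrightarrow> P 0 \<and> P 1 \<and> P 2 \<and> P 3" unfolding UNIV_4 by simp
  then show ?thesis by simp
qed

lemma vec4_eq_iff: "x = y \<longleftrightarrow> x$0 = y$0 \<and> x$1 = y$1 \<and> x$2 = y$2 \<and> x$3 = y$3" for x y :: "'a^4"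
  unfolding vec_eq_iff all_4 ..

lemma mons3_eq: "mons3 = {(3,0,0,0), (0,3,0,0), (0,0,3,0), (0,0,0,3),
   (2,1,0,0), (2,0,1,0), (2,0,0,1), (1,2,0,0), (0,2,1,0), (0,2,0,1),
   (1,0,2,0), (0,1,2,0), (0,0,2,1), (1,0,0,2), (0,1,0,2), (0,0,1,2),
   (1,1,1,0), (1,1,0,1), (1,0,1,1), (0,1,1,1)}" (is "_ = ?M")
proof -
  have mem: "(i, j, k, l) \<in> ?M" if s: "i + j + k + l = 3" for i j k l
  proof -
    have "i = 0 \<or> i = 1 \<or> i = 2 \<or> i = 3" "j = 0 \<or> j = 1 \<or> j = 2 \<or> j = 3"
      "k = 0 \<or> k = 1 \<or> k = 2 \<or> k = 3" "l = 3 - i - j - k"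
      using s by linarith+
    then show ?thesis using s by (elim disjE) simp_all
  qed
  have "mons3 \<subseteq> ?M"
  proof
    fix m assume "m \<in> mons3"
    then obtain i j k l where m: "m = (i, j, k, l)" "i + j + k + l = 3" unfolding mons3_def by blast
    show "m \<in> ?M" unfolding m(1) by (rule mem[OF m(2)])
  qed
  moreover have "?M \<subseteq> mons3" unfolding mons3_def by simp
  ultimately show ?thesis by (rule subset_antisym)
qed

lemma polar_sym1: "polar c x y z = polar c y x z"
proof -
  have "exponents i j k = exponents j i k" for i j k unfolding exponents_def by (simp add: add_ac)
  then show ?thesis unfolding polar_def by (subst sum.swap) (simp add: mult_ac)
qed

lemma polar_sym2: "polar c x y z = polar c x z y"
proof -
  have e: "exponents i j k = exponents i k j" for i j k unfolding exponents_def by (simp add: add_ac)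
  show ?thesis unfolding polar_def
  proof (rule sum.cong[OF refl])
    fix i :: 4
    show "(\<Sum>j\<in>UNIV. \<Sum>k\<in>UNIV. of_rat (third_derivative c (exponents i j k)) * (x$i * y$j * z$k)) =
        (\<Sum>j\<in>UNIV. \<Sum>k\<in>UNIV. of_rat (third_derivative c (exponents i j k)) * (x$i * z$j * y$k))"
      by (subst sum.swap, subst e) (simp add: mult_ac)
  qed
qed

lemma polar_add: "polar c (x + y) z w = polar c x z w + polar c y z w"
  unfolding polar_def by (simp add: distrib_right distrib_left sum.distrib)

lemma polar_scale: "polar c (k *s x) z w = k * polar c x z w"
  unfolding polar_def by (simp add: sum_distrib_left mult_ac)

lemma polar_diag: "polar c x x x = 6 * cubic_eval c x"
  unfolding polar_def cubic_eval_def mons3_eq sum_UNIV_4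
  by (simp add: exponents_def third_derivative_def of_rat_mult power2_eq_square power3_eq_cube
      numeral_2_eq_2[symmetric] fact_numeral algebra_simps)

lemma polar_axis: 
  "polar c x x (axis 0 1) = 2 * cubic_d0 c x"
  "polar c x x (axis 1 1) = 2 * cubic_d1 c x"
  "polar c x x (axis 2 1) = 2 * cubic_d2 c x"
  "polar c x x (axis 3 1) = 2 * cubic_d3 c x"
  unfolding polar_def cubic_d0_def cubic_d1_def cubic_d2_def cubic_d3_def mons3_eq sum_UNIV_4
  by (simp_all add: axis_def exponents_def third_derivative_def of_rat_mult power2_eq_square power3_eq_cube
      numeral_2_eq_2[symmetric] fact_numeral algebra_simps)

lemma polar_of_rat:
  "polar c (\<chi> i. of_rat (x$i)) (\<chi> i. of_rat (y$i)) (\<chi> i. of_rat (z$i)) = of_rat (polar c x y z)"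
  unfolding polar_def by (simp add: of_rat_sum of_rat_mult)

lemma nonzero_minor:
  fixes u v :: "rat^4"
  assumes "u \<noteq> 0" "v \<notin> vec.span {u}"
  obtains i j where "u$i * v$j - u$j * v$i \<noteq> 0"
proof -
  obtain i where i: "u$i \<noteq> 0" using assms(1) by (auto simp: vec_eq_iff)
  have "v \<noteq> (v$i / u$i) *s u" using assms(2) by (metis vec.span_base vec.span_scale singletonI)
  then obtain j where "v$j \<noteq> v$i / u$i * u$j" by (auto simp: vec_eq_iff)
  then have "u$i * v$j - u$j * v$i \<noteq> 0" using i by (simp add: field_simps)
  then show ?thesis using that by blast
qed

text \<open>Smoothness is applied to the complex point Z = s p + r u, whose partial derivatives are
  half of \<open>polar c Z Z\<close> along the axes. Then Z = 0 forces s = r = 0 through a nonzero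
  minor of \<open>p\<close>, \<open>u\<close>.\<close>

lemma smooth_nonsingular:
  assumes "smooth_cubic c"
  shows "nonsingular_cubic_form (polar c)"
proof
  show "polar c (x + y) z w = polar c x z w + polar c y z w" for x y z w :: "rat^4" by (rule polar_add)
  show "polar c (k *s x) z w = k * polar c x z w" for k and x z w :: "rat^4" by (rule polar_scale)
  show "polar c x y z = polar c y x z" for x y z :: "rat^4" by (rule polar_sym1)
  show "polar c x y z = polar c x z y" for x y z :: "rat^4" by (rule polar_sym2)
next
  fix p u :: "rat^4" and s r :: complex
  assume p: "p \<noteq> 0" and u: "u \<notin> vec.span {p}"
    and h: "\<And>w. s\<^sup>2 * of_rat (polar c p p w) + 2 * s * r * of_rat (polar c p u w) + r\<^sup>2 * of_rat (polar c u u w) = 0"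
  let ?C = "\<lambda>x :: rat^4. (\<chi> i. of_rat (x$i)) :: complex^4"
  let ?Z = "s *s ?C p + r *s ?C u"
  have lin: "polar c ?Z ?Z w = s\<^sup>2 * polar c (?C p) (?C p) w + 2 * s * r * polar c (?C p) (?C u) w
      + r\<^sup>2 * polar c (?C u) (?C u) w" for w
  proof -
    have a: "polar c x (y + z) w = polar c x y w + polar c x z w"
      "polar c x (k *s y) w = k * polar c x y w" for x y z w :: "complex^4" and k
      by (metis polar_sym1 polar_add) (metis polar_sym1 polar_scale)
    show ?thesis
      unfolding a polar_add polar_scale polar_sym1[of c "?C u" "?C p"] by (simp add: power2_eq_square algebra_simps)
  qed
  have ax: "axis a 1 = ?C (axis a 1)" for a by (simp add: vec_eq_iff axis_def)
  have "polar c ?Z ?Z (axis a 1) = 0" for a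
    unfolding lin ax polar_of_rat by (rule h)
  then have "?Z = 0"
    using assms polar_axis[of c ?Z] unfolding smooth_cubic_def by simp
  then have Z: "s * of_rat (p$i) + r * of_rat (u$i) = 0" for i
    by (simp add: vec_eq_iff)
  obtain i j where m: "p$i * u$j - p$j * u$i \<noteq> 0" using nonzero_minor[OF p u] .
  have "r * of_rat (p$i * u$j - p$j * u$i) = 0" "s * of_rat (p$i * u$j - p$j * u$i) = 0"
    using Z[of i] Z[of j] unfolding of_rat_diff of_rat_mult by algebra+
  then show "s = 0 \<and> r = 0" using m by simp
qed

lemma rat_lines_on_eq:
  assumes "smooth_cubic c"
  shows "rat_lines_on c = {L. nonsingular_cubic_form.on_surface (polar c) L}"
  unfolding rat_lines_on_def nonsingular_cubic_form.on_surface_def[OF smooth_nonsingular[OF assms]]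
    rat_line_iff_proj_line polar_diag by simp

theorem card_rat_lines_on:
  assumes "smooth_cubic c"
  shows "finite (rat_lines_on c)" "card (rat_lines_on c) \<in> {0, 1, 2, 3, 5, 7, 9, 15, 27}"
proof -
  interpret nonsingular_cubic_form "polar c" by (rule smooth_nonsingular[OF assms])
  show "finite (rat_lines_on c)" "card (rat_lines_on c) \<in> {0, 1, 2, 3, 5, 7, 9, 15, 27}"
    unfolding rat_lines_on_eq[OF assms] by (rule card_line_configuration)+
qed

section \<open>Diagonal surfaces\<close>

text \<open>A rational line pairs the coordinates so that the two coefficients of each pair have a
  rational cube as ratio. As 2 is not a cube, coefficients 1, 1, 1, 2 admit no pairing, 1, 1, 2, 2
  admit one and 1, 1, 1, 1 all three.\<close>

definition diagonal_cubic :: "rat \<Rightarrow> rat \<Rightarrow> cubic_coeffs" where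
  "diagonal_cubic a b = (\<lambda>_. 0)((3,0,0,0) := 1, (0,3,0,0) := 1, (0,0,3,0) := a, (0,0,0,3) := b)"

lemma cubic_eval_diagonal:
  "cubic_eval (diagonal_cubic a b) x = x$0^3 + x$1^3 + of_rat a * x$2^3 + of_rat b * x$3^3"
  unfolding cubic_eval_def mons3_eq by (simp add: diagonal_cubic_def algebra_simps)

lemma smooth_diagonal:
  assumes "a \<noteq> 0" "b \<noteq> 0" shows "smooth_cubic (diagonal_cubic a b)"
  unfolding smooth_cubic_def cubic_d0_def cubic_d1_def cubic_d2_def cubic_d3_def mons3_eq
  using assms by (simp add: diagonal_cubic_def vec4_eq_iff)

text \<open>The mixed coefficients of the sum of four cubes vanish. If \<alpha> and \<beta> were
  both nonzero, the two linear forms would be proportional, and the vanishing mixed term would force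
  \<open>di = 0\<close>.\<close>

lemma cubes_pairing:
  fixes \<alpha> \<beta> \<gamma> \<delta> :: rat
  assumes d: "di \<noteq> 0" "dj \<noteq> 0" "dk \<noteq> 0" "dl \<noteq> 0"
    and e: "di + dk * \<alpha>^3 + dl * \<gamma>^3 = 0" "dj + dk * \<beta>^3 + dl * \<delta>^3 = 0"
      "di + dj + dk * (\<alpha> + \<beta>)^3 + dl * (\<gamma> + \<delta>)^3 = 0" "di - dj + dk * (\<alpha> - \<beta>)^3 + dl * (\<gamma> - \<delta>)^3 = 0"
  shows "\<alpha> = 0 \<and> \<delta> = 0 \<or> \<beta> = 0 \<and> \<gamma> = 0"
proof -
  have f: "dk * (\<alpha>\<^sup>2 * \<beta>) + dl * (\<gamma>\<^sup>2 * \<delta>) = 0" "dk * (\<alpha> * \<beta>\<^sup>2) + dl * (\<gamma> * \<delta>\<^sup>2) = 0"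
    using e by algebra+
  have ab: "\<alpha> * \<beta> = 0"
  proof (rule ccontr)
    assume ab: "\<alpha> * \<beta> \<noteq> 0"
    have "dl * (\<gamma>\<^sup>2 * \<delta>) \<noteq> 0" using f(1) ab d by auto
    then have gd: "\<gamma> \<noteq> 0" "\<delta> \<noteq> 0" by auto
    have "dk * dl * \<alpha> * \<beta> * \<gamma> * \<delta> * (\<alpha> * \<delta> - \<beta> * \<gamma>) = 0" using f by algebra
    then have "\<alpha> * \<delta> = \<beta> * \<gamma>" using ab gd d by simp
    moreover have "\<delta> * (dk * \<alpha>^3 + dl * \<gamma>^3) = \<gamma> * (dk * (\<alpha>\<^sup>2 * \<beta>) + dl * (\<gamma>\<^sup>2 * \<delta>)) + dk * \<alpha>\<^sup>2 * (\<alpha> * \<delta> - \<beta> * \<gamma>)"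
      by algebra
    ultimately have "\<delta> * (dk * \<alpha>^3 + dl * \<gamma>^3) = 0" using f by simp
    then show False using gd e(1) d(1) by simp
  qed
  show ?thesis
  proof (cases "\<alpha> = 0")
    case True
    then have "\<gamma> \<noteq> 0" using e(1) d by auto
    then have "\<delta> = 0" using f(1) True d by simp
    then show ?thesis using True by simp
  next
    case False
    then have b: "\<beta> = 0" using ab by simp
    then have "\<gamma> = 0 \<or> \<delta> = 0" using f(1) d by simp
    moreover have "\<delta> \<noteq> 0" using e(2) b d(2) by auto
    ultimately show ?thesis using b by blast
  qed
qed

text \<open>The linear forms \<open>\<ell>\<close> induced on \<open>L\<close> by the coordinates satisfy \<open>\<Sum> d \<ell>^3 = 0\<close>; this forces them to be
  proportional in pairs.\<close>

lemma diagonal_line_pairing: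
  fixes d :: "4 \<Rightarrow> rat"
  assumes d: "\<And>i. d i \<noteq> 0" and L: "proj_line L" and z: "\<And>x. x \<in> L \<Longrightarrow> (\<Sum>i\<in>UNIV. d i * x$i^3) = 0"
  obtains i j k l \<beta> \<gamma> where "distinct [i, j, k, l]" "d i + d l * \<gamma>^3 = 0" "d j + d k * \<beta>^3 = 0"
    "\<And>x. x \<in> L \<Longrightarrow> x$k = \<beta> * x$j \<and> x$l = \<gamma> * x$i"
proof -
  obtain u where u: "u \<in> L" "u \<noteq> 0" using proj_line_nonzero[OF L] .
  obtain v where v: "v \<in> L" "v \<notin> vec.span {u}" "L = vec.span {u, v}" using proj_line_basis[OF L u] .
  obtain i j where m: "u$i * v$j - u$j * v$i \<noteq> 0" using nonzero_minor[OF u(2) v(2)] .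
  then have ij: "i \<noteq> j" by auto
  have "card (UNIV - {i, j} :: 4 set) = 2" using ij by (simp add: card_Diff_subset)
  then obtain k l where kl: "UNIV - {i, j} = {k, l}" "k \<noteq> l" by (meson card_2_iff)
  then have dist: "distinct [i, j, k, l]" and U: "(UNIV :: 4 set) = {i, j, k, l}" using ij by auto
  define D where "D = u$i * v$j - u$j * v$i"
  \<comment> \<open>Cramer's rule: the basis of \<open>L\<close> dual to its coordinates
    \<open>i\<close> and \<open>j\<close>.\<close>
  define e f where "e = (v$j / D) *s u + (- u$j / D) *s v" and "f = (- v$i / D) *s u + (u$i / D) *s v"
  have D0: "D \<noteq> 0" using m unfolding D_def .
  have ef: "e \<in> L" "f \<in> L" unfolding e_def f_def by (rule proj_line_lincomb[OF L u(1) v(1)])+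
  have c: "e$i = 1" "e$j = 0" "f$i = 0" "f$j = 1"
    using D0 unfolding e_def f_def by (simp_all add: field_simps) (simp_all add: D_def)
  have xe: "x = x$i *s e + x$j *s f" if "x \<in> L" for x
  proof -
    have e0: "e \<noteq> 0" using c by auto
    have "f \<notin> vec.span {e}" using c by (auto simp: vec.span_singleton)
    from proj_line_eq_span[OF L ef e0 this] that obtain a b where "x = a *s e + b *s f"
      unfolding span2 by (metis span2)
    then show ?thesis using c by simp
  qed
  have S: "d i * x$i^3 + d j * x$j^3 + d k * x$k^3 + d l * x$l^3 = 0" if "x \<in> L" for x
    using z[OF that] dist unfolding U by (simp add: add.assoc)
  have g: "e + f \<in> L" "e - f \<in> L"
    using proj_line_lincomb[OF L ef, of 1 1] proj_line_lincomb[OF L ef, of 1 "-1"] by simp_all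
  have E: "d i + d k * (e$k)^3 + d l * (e$l)^3 = 0" "d j + d k * (f$k)^3 + d l * (f$l)^3 = 0"
    "d i + d j + d k * (e$k + f$k)^3 + d l * (e$l + f$l)^3 = 0" "d i - d j + d k * (e$k - f$k)^3 + d l * (e$l - f$l)^3 = 0"
    using S[OF ef(1)] S[OF ef(2)] S[OF g(1)] S[OF g(2)] c by simp_all
  have xkl: "x$k = e$k * x$i + f$k * x$j" "x$l = e$l * x$i + f$l * x$j" if "x \<in> L" for x
    using xe[OF that] by (metis vector_add_component vector_smult_component mult.commute)+
  from cubes_pairing[OF d d d d E] show ?thesis
  proof
    assume "e$k = 0 \<and> f$l = 0"
    then show ?thesis using that[of i j k l "e$l" "f$k"] dist E xkl by simp
  next
    assume "f$k = 0 \<and> e$l = 0"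
    then show ?thesis using that[of i j l k "e$k" "f$l"] dist E xkl by (auto simp: add.commute)
  qed
qed

lemma rat_power_ne_2:
  fixes y :: rat
  assumes "n \<ge> 2" shows "y ^ n \<noteq> 2"
proof
  assume y: "y ^ n = 2"
  obtain p q :: int where pq: "y = of_int p / of_int q" "q > 0" "coprime p q"
    by (metis quotient_of_unique quotient_of_div quotient_of_denom_pos quotient_of_coprime prod.collapse)
  have "(of_int (p ^ n) :: rat) = of_int (2 * q ^ n)"
    using y pq(2) unfolding pq(1) by (simp add: power_divide field_simps)
  then have e: "p ^ n = 2 * q ^ n" by (simp only: of_int_eq_iff)
  then have "even (p ^ n)" by simp
  then have "even p" using even_power by blast
  then obtain m where "p = 2 * m" by blast
  then have "2 * q ^ n = 2 ^ n * m ^ n" using e by (simp add: power_mult_distrib)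
  moreover have "(2 :: int) ^ n = 2 * (2 * 2 ^ (n - 2))"
    using assms by (metis power_Suc Suc_diff_le diff_Suc_Suc numeral_2_eq_2 le_add_diff_inverse2 add_2_eq_Suc')
  ultimately have "q ^ n = 2 * (2 ^ (n - 2) * m ^ n)" by simp
  then have "even (q ^ n)" by simp
  then have "even q" using even_power by blast
  then show False using \<open>even p\<close> pq(3) by (metis coprime_common_divisor odd_one dvd_refl)
qed

lemma rat_cube_eq_neg1:
  fixes y :: rat
  assumes "1 + y ^ 3 = 0" shows "y = -1"
proof -
  \<comment> \<open>Four times y^3 + 1, with the quadratic factor completed to a square.\<close>
  have "(y + 1) * ((2 * y - 1)\<^sup>2 + 3) = 0" using assms by algebra
  moreover have "(2 * y - 1)\<^sup>2 + 3 \<noteq> 0" using zero_le_power2[of "2 * y - 1"] by linarith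
  ultimately show ?thesis by simp
qed

lemma cube_ratio:
  fixes y :: rat
  assumes "a \<in> {1, 2}" "b \<in> {1, 2}" "a + b * y ^ 3 = 0"
  shows "a = b \<and> y = -1"
proof -
  have "1 + 2 * y ^ 3 \<noteq> 0"
  proof
    assume "1 + 2 * y ^ 3 = 0"
    then have "(- 1 / y) ^ 3 = 2" by (cases "y = 0") (auto simp: field_simps power_divide)
    then show False using rat_power_ne_2[of 3 "- 1 / y"] by simp
  qed
  moreover have "2 + y ^ 3 \<noteq> 0"
  proof
    assume "2 + y ^ 3 = 0"
    then have "(- y) ^ 3 = 2" by simp
    then show False using rat_power_ne_2[of 3 "- y"] by simp
  qed
  moreover have "y = -1" if "a = b"
    using rat_cube_eq_neg1[of y] assms that by auto
  ultimately show ?thesis using assms by auto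
qed

lemma UNIV_4_distinct:
  assumes "distinct [i, j, k, l :: 4]" shows "UNIV = {i, j, k, l}"
  using card_subset_eq[of UNIV "{i, j, k, l}"] assms by simp

definition pair_line :: "4 \<Rightarrow> 4 \<Rightarrow> 4 \<Rightarrow> 4 \<Rightarrow> (rat^4) set" where
  "pair_line i j k l = {x. x$j = - x$i \<and> x$l = - x$k}"

lemma proj_line_pair_line:
  assumes "distinct [i, j, k, l]" shows "proj_line (pair_line i j k l)"
proof -
  let ?u = "axis i 1 - axis j 1 :: rat^4" and ?v = "axis k 1 - axis l 1 :: rat^4"
  note U = UNIV_4_distinct[OF assms]
  have all: "(\<forall>m. P m) \<longleftrightarrow> P i \<and> P j \<and> P k \<and> P l" for P
    using U by (metis UNIV_I insertE singletonD)
  have "x \<in> pair_line i j k l \<longleftrightarrow> (\<exists>a b. x = a *s ?u + b *s ?v)" for x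
    unfolding vec_eq_iff all pair_line_def using assms by (auto simp: axis_def)
  then have "pair_line i j k l = vec.span {?u, ?v}" unfolding set_eq_iff span2 by blast
  moreover have "?u \<noteq> 0" unfolding vec_eq_iff all using assms by (auto simp: axis_def)
  moreover have "?v \<notin> vec.span {?u}"
    using assms unfolding vec.span_singleton by (auto simp: vec_eq_iff all axis_def)
  ultimately show ?thesis using proj_line_span by simp
qed

lemma pair_line_commute: "pair_line i j k l = pair_line i j l k" "pair_line i j k l = pair_line k l i j"
  unfolding pair_line_def by auto

lemma diagonal_lines:
  assumes ab: "a \<in> {1, 2}" "b \<in> {1, 2}" and L: "L \<in> rat_lines_on (diagonal_cubic a b)"
  shows "L = pair_line 0 1 2 3 \<and> a = b \<or> L = pair_line 0 2 1 3 \<and> a = 1 \<and> b = 1 \<or>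
    L = pair_line 0 3 1 2 \<and> a = 1 \<and> b = 1"
proof -
  define d :: "4 \<Rightarrow> rat" where "d i = (if i = 2 then a else if i = 3 then b else 1)" for i
  have d12: "d i \<in> {1, 2}" for i using ab unfolding d_def by auto
  have d0: "d i \<noteq> 0" for i using d12[of i] by auto
  have z: "cubic_eval (diagonal_cubic a b) x = 0" if "x \<in> L" for x
    using L that unfolding rat_lines_on_def rat_line_iff_proj_line by auto
  have pL: "proj_line L" using L unfolding rat_lines_on_def rat_line_iff_proj_line by auto
  have S: "(\<Sum>i\<in>UNIV. d i * x$i^3) = 0" if "x \<in> L" for x
    using z[OF that] unfolding sum_UNIV_4 cubic_eval_diagonal by (simp add: d_def)
  obtain i j k l \<beta> \<gamma> where dist: "distinct [i, j, k, l]" and e: "d i + d l * \<gamma>^3 = 0" "d j + d k * \<beta>^3 = 0"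
    and x: "\<And>x. x \<in> L \<Longrightarrow> x$k = \<beta> * x$j \<and> x$l = \<gamma> * x$i"
    using diagonal_line_pairing[OF d0 pL S] by metis
  have r: "d i = d l" "\<gamma> = -1" "d j = d k" "\<beta> = -1"
    using cube_ratio[OF d12 d12 e(1)] cube_ratio[OF d12 d12 e(2)] by auto
  have "L \<subseteq> pair_line i l j k" using x r unfolding pair_line_def by auto
  then have L1: "L = pair_line i l j k"
    using proj_line_subset_eq[OF pL proj_line_pair_line[of i l j k]] dist by auto
  have U: "(UNIV :: 4 set) = {i, l, j, k}"
    by (rule UNIV_4_distinct) (use dist in auto)
  \<comment> \<open>Relabelling so that coordinate 0 comes first leaves three possible
    pairings.\<close>
  have "\<exists>m n p. distinct [0, m, n, p] \<and> L = pair_line 0 m n p \<and> d m = d 0 \<and> d n = d p"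
  proof -
    have "0 \<in> {i, l, j, k}" using U by blast
    then consider "i = 0" | "l = 0" | "j = 0" | "k = 0" by blast
    then show ?thesis
    proof cases
      case 1
      then show ?thesis using L1 dist r by (intro exI[of _ l] exI[of _ j] exI[of _ k]) auto
    next
      case 2
      then show ?thesis using L1 dist r pair_line_commute
        by (intro exI[of _ i] exI[of _ j] exI[of _ k]) (auto simp: pair_line_def)
    next
      case 3
      then show ?thesis using L1 dist r
        by (intro exI[of _ k] exI[of _ i] exI[of _ l]) (auto simp: pair_line_def)
    next
      case 4
      then show ?thesis using L1 dist r
        by (intro exI[of _ j] exI[of _ i] exI[of _ l]) (auto simp: pair_line_def)
    qed
  qed
  then obtain m n p where mnp: "distinct [0, m, n, p]" "L = pair_line 0 m n p" "d m = d 0" "d n = d p"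
    by blast
  have "m \<in> {1, 2, 3}" "n \<in> {1, 2, 3}" "p \<in> {1, 2, 3}"
    using mnp(1) UNIV_4 by auto
  then show ?thesis
    using mnp pair_line_commute(1)[of 0 m n p] unfolding d_def
    by (elim insertE emptyE) simp_all
qed

lemma pair_line_on_diagonal:
  "pair_line 0 1 2 3 \<in> rat_lines_on (diagonal_cubic a a)"
  "pair_line 0 2 1 3 \<in> rat_lines_on (diagonal_cubic 1 1)"
  "pair_line 0 3 1 2 \<in> rat_lines_on (diagonal_cubic 1 1)"
  unfolding rat_lines_on_def rat_line_iff_proj_line
  by (auto intro!: proj_line_pair_line simp: cubic_eval_diagonal) (simp_all add: pair_line_def)

lemma pair_lines_distinct:
  "pair_line 0 1 2 3 \<noteq> pair_line 0 2 1 3" "pair_line 0 1 2 3 \<noteq> pair_line 0 3 1 2"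
  "pair_line 0 2 1 3 \<noteq> pair_line 0 3 1 2"
proof -
  let ?x = "axis 0 1 - axis 1 1 :: rat^4" and ?y = "axis 0 1 - axis 2 1 :: rat^4"
  have "?x \<in> pair_line 0 1 2 3" "?x \<notin> pair_line 0 2 1 3" "?x \<notin> pair_line 0 3 1 2"
    "?y \<in> pair_line 0 2 1 3" "?y \<notin> pair_line 0 3 1 2"
    by (simp_all add: pair_line_def axis_def)
  then show "pair_line 0 1 2 3 \<noteq> pair_line 0 2 1 3" "pair_line 0 1 2 3 \<noteq> pair_line 0 3 1 2"
    "pair_line 0 2 1 3 \<noteq> pair_line 0 3 1 2"
    by blast+
qed

lemma rat_lines_on_diagonal:
  "rat_lines_on (diagonal_cubic 1 2) = {}"
  "rat_lines_on (diagonal_cubic 2 2) = {pair_line 0 1 2 3}"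
  "rat_lines_on (diagonal_cubic 1 1) = {pair_line 0 1 2 3, pair_line 0 2 1 3, pair_line 0 3 1 2}"
proof -
  show "rat_lines_on (diagonal_cubic 1 2) = {}"
    using diagonal_lines[of 1 2] by fastforce
  show "rat_lines_on (diagonal_cubic 2 2) = {pair_line 0 1 2 3}"
    using diagonal_lines[of 2 2] pair_line_on_diagonal(1)[of 2] by fastforce
  show "rat_lines_on (diagonal_cubic 1 1) = {pair_line 0 1 2 3, pair_line 0 2 1 3, pair_line 0 3 1 2}"
    using diagonal_lines[of 1 1] pair_line_on_diagonal pair_line_on_diagonal(1)[of 1] by auto
qed

section \<open>Surfaces containing two given skew lines\<close>

text \<open>The equation
  \<open>x0^2 x3 - x1^2 x2 + x0 (b0 x2^2 + b2 x3^2) + x1 (b3 x2^2 + b4 x2 x3 + b5 x3^2) = 0\<close>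
  of a surface containing the skew lines \<open>x2 = x3 = 0\<close> and \<open>x0 = x1 = 0\<close>.\<close>

definition two_line_cubic :: "rat \<Rightarrow> rat \<Rightarrow> rat \<Rightarrow> rat \<Rightarrow> rat \<Rightarrow> cubic_coeffs" where
  "two_line_cubic b0 b2 b3 b4 b5 = (\<lambda>_. 0)((2,0,0,1) := 1, (0,2,1,0) := -1, (1,0,2,0) := b0,
      (1,0,0,2) := b2, (0,1,2,0) := b3, (0,1,1,1) := b4, (0,1,0,2) := b5)"

lemma cubic_eval_two_line:
  "cubic_eval (two_line_cubic b0 b2 b3 b4 b5) x = (x$0)\<^sup>2 * x$3 - (x$1)\<^sup>2 * x$2
    + x$0 * (of_rat b0 * (x$2)\<^sup>2 + of_rat b2 * (x$3)\<^sup>2)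
    + x$1 * (of_rat b3 * (x$2)\<^sup>2 + of_rat b4 * x$2 * x$3 + of_rat b5 * (x$3)\<^sup>2)"
  unfolding cubic_eval_def mons3_eq by (simp add: two_line_cubic_def of_rat_minus algebra_simps)

lemma partial_derivatives_two_line:
  fixes x :: "complex^4"
  shows "cubic_d0 (two_line_cubic b0 b2 b3 b4 b5) x = 2 * x$0 * x$3 + of_rat b0 * (x$2)\<^sup>2 + of_rat b2 * (x$3)\<^sup>2"
    "cubic_d1 (two_line_cubic b0 b2 b3 b4 b5) x = - 2 * x$1 * x$2 + of_rat b3 * (x$2)\<^sup>2
      + of_rat b4 * x$2 * x$3 + of_rat b5 * (x$3)\<^sup>2"
    "cubic_d2 (two_line_cubic b0 b2 b3 b4 b5) x = - (x$1)\<^sup>2 + 2 * of_rat b0 * x$0 * x$2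
      + 2 * of_rat b3 * x$1 * x$2 + of_rat b4 * x$1 * x$3"
    "cubic_d3 (two_line_cubic b0 b2 b3 b4 b5) x = (x$0)\<^sup>2 + 2 * of_rat b2 * x$0 * x$3
      + of_rat b4 * x$1 * x$2 + 2 * of_rat b5 * x$1 * x$3"
  unfolding cubic_d0_def cubic_d1_def cubic_d2_def cubic_d3_def mons3_eq
  by (simp_all add: two_line_cubic_def of_rat_minus algebra_simps)

text \<open>The planes through \<open>x2 = x3 = 0\<close> cut out conics whose discriminant is the binary quintic
  \<open>x q^2 - y r^2\<close> with \<open>q = b0 x^2 + b2 y^2\<close> and \<open>r = b3 x^2 + b4 x y + b5 y^2\<close>. At a singular point
  the partial derivatives of the quintic vanish.\<close>

lemma smooth_two_line:
  assumes "\<And>x y :: complex.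
    (of_rat b0 * x\<^sup>2 + of_rat b2 * y\<^sup>2)\<^sup>2 + 4 * of_rat b0 * x\<^sup>2 * (of_rat b0 * x\<^sup>2 + of_rat b2 * y\<^sup>2)
      - 2 * y * (of_rat b3 * x\<^sup>2 + of_rat b4 * x * y + of_rat b5 * y\<^sup>2) * (2 * of_rat b3 * x + of_rat b4 * y) = 0 \<Longrightarrow>
    4 * of_rat b2 * x * y * (of_rat b0 * x\<^sup>2 + of_rat b2 * y\<^sup>2)
      - (of_rat b3 * x\<^sup>2 + of_rat b4 * x * y + of_rat b5 * y\<^sup>2)\<^sup>2
      - 2 * y * (of_rat b3 * x\<^sup>2 + of_rat b4 * x * y + of_rat b5 * y\<^sup>2) * (of_rat b4 * x + 2 * of_rat b5 * y) = 0 \<Longrightarrow>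
    x = 0 \<and> y = 0"
  shows "smooth_cubic (two_line_cubic b0 b2 b3 b4 b5)"
  unfolding smooth_cubic_def partial_derivatives_two_line
proof (intro allI impI, elim conjE)
  fix z :: "complex^4"
  define B0 B2 B3 B4 B5 :: complex where B: "B0 = of_rat b0" "B2 = of_rat b2" "B3 = of_rat b3" "B4 = of_rat b4" "B5 = of_rat b5"
  define x0 x1 x y where z: "x0 = z$0" "x1 = z$1" "x = z$2" "y = z$3"
  assume "2 * z$0 * z$3 + of_rat b0 * (z$2)\<^sup>2 + of_rat b2 * (z$3)\<^sup>2 = 0"
    "- 2 * z$1 * z$2 + of_rat b3 * (z$2)\<^sup>2 + of_rat b4 * z$2 * z$3 + of_rat b5 * (z$3)\<^sup>2 = 0"
    "- (z$1)\<^sup>2 + 2 * of_rat b0 * z$0 * z$2 + 2 * of_rat b3 * z$1 * z$2 + of_rat b4 * z$1 * z$3 = 0"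
    "(z$0)\<^sup>2 + 2 * of_rat b2 * z$0 * z$3 + of_rat b4 * z$1 * z$2 + 2 * of_rat b5 * z$1 * z$3 = 0"
  then have e: "2 * x0 * y + B0 * x\<^sup>2 + B2 * y\<^sup>2 = 0" "- 2 * x1 * x + B3 * x\<^sup>2 + B4 * x * y + B5 * y\<^sup>2 = 0"
    "- x1\<^sup>2 + 2 * B0 * x0 * x + 2 * B3 * x1 * x + B4 * x1 * y = 0"
    "x0\<^sup>2 + 2 * B2 * x0 * y + B4 * x1 * x + 2 * B5 * x1 * y = 0"
    unfolding B z by simp_all
  have q: "B0 * x\<^sup>2 + B2 * y\<^sup>2 = - 2 * x0 * y" and r: "B3 * x\<^sup>2 + B4 * x * y + B5 * y\<^sup>2 = 2 * x1 * x"
    using e(1,2) by algebra+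
  \<comment> \<open>\<open>x\<close> times the third plus \<open>y\<close> times the fourth
    equation, with \<open>q\<close> and \<open>r\<close> inserted, is 3(x1^2 x - x0^2 y) =
    0.\<close>
  have F: "x0\<^sup>2 * y = x1\<^sup>2 * x" using e by algebra
  have "(- 2 * x0 * y)\<^sup>2 + 4 * B0 * x\<^sup>2 * (- 2 * x0 * y) - 2 * y * (2 * x1 * x) * (2 * B3 * x + B4 * y) = 0"
    using e(3) F by algebra
  moreover have "4 * B2 * x * y * (- 2 * x0 * y) - (2 * x1 * x)\<^sup>2 - 2 * y * (2 * x1 * x) * (B4 * x + 2 * B5 * y) = 0"
    using e(4) F by algebra
  ultimately have xy: "x = 0 \<and> y = 0"
    using assms[of x y] unfolding B[symmetric] q r by blast
  then have "x0 = 0" "x1 = 0" using e(3,4) by simp_all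
  then show "z = 0" using xy unfolding z vec4_eq_iff by simp
qed

text \<open>The discriminant is x^5 - 4 y^5, while the transversals correspond to rational roots of
  s^5 - 2 t^5, of which there are none.\<close>

lemma smooth_two_line_quintic: "smooth_cubic (two_line_cubic 1 0 0 0 (-2))"
proof (rule smooth_two_line, goal_cases)
  case (1 x y)
  then have "5 * x^4 = 0" "20 * y^4 = 0"
    by (simp_all add: of_rat_minus power2_eq_square power4_eq_xxxx)
  then show ?case by simp
qed

text \<open>The transversals correspond to t^4 + u t + v and the root at infinity. Its discriminant
  is 256 v^3 - 27 u^4, and \<open>u \<noteq> 0\<close> also keeps the squares of its roots distinct;
  these squares are the finite roots of the conic discriminant.\<close>

lemma smooth_two_line_quartic:
  assumes u: "u \<noteq> 0" and uv: "27 * u^4 \<noteq> 256 * v^3"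
  shows "smooth_cubic (two_line_cubic 0 u 1 0 v)"
proof (rule smooth_two_line)
  fix x y :: complex
  define U V :: complex where UV: "U = of_rat u" "V = of_rat v"
  define w where "w = x\<^sup>2 + V * y\<^sup>2"
  assume "(of_rat 0 * x\<^sup>2 + of_rat u * y\<^sup>2)\<^sup>2 + 4 * of_rat 0 * x\<^sup>2 * (of_rat 0 * x\<^sup>2 + of_rat u * y\<^sup>2)
      - 2 * y * (of_rat 1 * x\<^sup>2 + of_rat 0 * x * y + of_rat v * y\<^sup>2) * (2 * of_rat 1 * x + of_rat 0 * y) = 0"
  then have "(U * y\<^sup>2)\<^sup>2 - 2 * y * w * (2 * x) = 0" unfolding UV w_def by simp
  then have e1: "y * (U\<^sup>2 * y^3 - 4 * x * w) = 0" by algebra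
  assume "4 * of_rat u * x * y * (of_rat 0 * x\<^sup>2 + of_rat u * y\<^sup>2)
      - (of_rat 1 * x\<^sup>2 + of_rat 0 * x * y + of_rat v * y\<^sup>2)\<^sup>2
      - 2 * y * (of_rat 1 * x\<^sup>2 + of_rat 0 * x * y + of_rat v * y\<^sup>2) * (of_rat 0 * x + 2 * of_rat v * y) = 0"
  then have e2: "4 * U * x * y * (U * y\<^sup>2) - w\<^sup>2 - 2 * y * w * (2 * V * y) = 0" unfolding UV w_def by simp
  have "y = 0"
  proof (rule ccontr)
    assume y: "y \<noteq> 0"
    then have e3: "U\<^sup>2 * y^3 = 4 * x * w" using e1 by simp
    have "5 * w * (3 * x\<^sup>2 - V * y\<^sup>2) = 0" using e2 e3 w_def by algebra
    moreover have "w \<noteq> 0" using e3 y u unfolding UV by auto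
    ultimately have x: "3 * x\<^sup>2 = V * y\<^sup>2" by simp
    have "y\<^sup>2 * (3 * U\<^sup>2 * y - 16 * x * V) = 0" using e3 x w_def by algebra
    then have "3 * U\<^sup>2 * y = 16 * x * V" using y by simp
    then have "y\<^sup>2 * (27 * U^4 - 256 * V^3) = 0" using x by algebra
    then have "27 * U^4 = 256 * V^3" using y by simp
    then have "(of_rat (27 * u^4) :: complex) = of_rat (256 * v^3)"
      unfolding UV by (simp add: of_rat_mult of_rat_power)
    then show False using uv by (simp only: of_rat_eq_iff)
  qed
  then show "x = 0 \<and> y = 0" using e2 unfolding w_def by simp
qed

text \<open>Designed for the transversal parameters 0, 1, 2, -3 and infinity: their finite values
  sum to 0, as the missing s^3 t^2 term demands, and their squares 0, 1, 4, 9 are distinct.\<close>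

lemma smooth_two_line_split: "smooth_cubic (two_line_cubic 0 6 1 (-7) 0)"
proof (rule smooth_two_line)
  fix x y :: complex
  assume "(of_rat 0 * x\<^sup>2 + of_rat 6 * y\<^sup>2)\<^sup>2 + 4 * of_rat 0 * x\<^sup>2 * (of_rat 0 * x\<^sup>2 + of_rat 6 * y\<^sup>2)
      - 2 * y * (of_rat 1 * x\<^sup>2 + of_rat (-7) * x * y + of_rat 0 * y\<^sup>2) * (2 * of_rat 1 * x + of_rat (-7) * y) = 0"
  then have e1: "36 * y^4 - 2 * y * (x\<^sup>2 - 7 * x * y) * (2 * x - 7 * y) = 0" by (simp add: of_rat_minus power_mult_distrib)
  assume "4 * of_rat 6 * x * y * (of_rat 0 * x\<^sup>2 + of_rat 6 * y\<^sup>2)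
      - (of_rat 1 * x\<^sup>2 + of_rat (-7) * x * y + of_rat 0 * y\<^sup>2)\<^sup>2
      - 2 * y * (of_rat 1 * x\<^sup>2 + of_rat (-7) * x * y + of_rat 0 * y\<^sup>2) * (of_rat (-7) * x + 2 * of_rat 0 * y) = 0"
  then have e2: "144 * x * y^3 - (x\<^sup>2 - 7 * x * y)\<^sup>2 + 14 * x * y * (x\<^sup>2 - 7 * x * y) = 0"
    by (simp add: of_rat_minus power2_eq_square power3_eq_cube algebra_simps)
  \<comment> \<open>Euler's relation: \<open>x\<close> and \<open>y\<close> times the two
    derivatives add up to five times the discriminant, which is the negative of this
    product.\<close>
  have "x * y * (x - y) * (x - 4 * y) * (x - 9 * y) = 0" using e1 e2 by algebra
  then consider "x = 0" | "y = 0" | "x = y" | "x = 4 * y" | "x = 9 * y" by auto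
  then show "x = 0 \<and> y = 0"
  proof cases
    case 1 then show ?thesis using e1 by simp
  next
    case 2 then show ?thesis using e2 by simp
  next
    case 3 
    have "36 * y^4 - 2 * y * (x\<^sup>2 - 7 * x * y) * (2 * x - 7 * y) = - 24 * y^4"
      unfolding 3 by (simp add: power2_eq_square power4_eq_xxxx algebra_simps)
    then have "y = 0" unfolding e1 by simp
    then show ?thesis using 3 by simp
  next
    case 4
    have "36 * y^4 - 2 * y * (x\<^sup>2 - 7 * x * y) * (2 * x - 7 * y) = 60 * y^4"
      unfolding 4 by (simp add: power2_eq_square power4_eq_xxxx algebra_simps)
    then have "y = 0" unfolding e1 by simp
    then show ?thesis using 4 by simp
  next
    case 5
    have "36 * y^4 - 2 * y * (x\<^sup>2 - 7 * x * y) * (2 * x - 7 * y) = - 360 * y^4"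
      unfolding 5 by (simp add: power2_eq_square power4_eq_xxxx algebra_simps)
    then have "y = 0" unfolding e1 by simp
    then show ?thesis using 5 by simp
  qed
qed

section \<open>The coordinate lines, their transversals and lines skew to both\<close>

definition vec4 :: "rat \<Rightarrow> rat \<Rightarrow> rat \<Rightarrow> rat \<Rightarrow> rat^4" where
  "vec4 a b c d = (\<chi> i. if i = 0 then a else if i = 1 then b else if i = 2 then c else d)"

lemma vec4_nth [simp]: "vec4 a b c d $ 0 = a" "vec4 a b c d $ 1 = b" "vec4 a b c d $ 2 = c" "vec4 a b c d $ 3 = d"
  unfolding vec4_def by simp_all

definition line_01 :: "(rat^4) set" where "line_01 = {x. x$2 = 0 \<and> x$3 = 0}"

definition line_23 :: "(rat^4) set" where "line_23 = {x. x$0 = 0 \<and> x$1 = 0}"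

lemma proj_line_coordinate: "proj_line line_01" "proj_line line_23"
proof -
  have e: "line_01 = vec.span {vec4 1 0 0 0, vec4 0 1 0 0}" "line_23 = vec.span {vec4 0 0 1 0, vec4 0 0 0 1}"
    unfolding set_eq_iff span2 line_01_def line_23_def by (auto simp: vec4_eq_iff)
  show "proj_line line_01" "proj_line line_23"
    unfolding e by (rule proj_line_span; auto simp: vec.span_singleton vec4_eq_iff)+
qed

locale two_line_surface =
  fixes b0 b2 b3 b4 b5 :: rat
  assumes smooth: "smooth_cubic (two_line_cubic b0 b2 b3 b4 b5)"

sublocale two_line_surface \<subseteq> nonsingular_cubic_form "polar (two_line_cubic b0 b2 b3 b4 b5)"
  by (rule smooth_nonsingular[OF smooth])

context two_line_surface
begin

definition form :: "rat^4 \<Rightarrow> rat" where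
  "form x = (x$0)\<^sup>2 * x$3 - (x$1)\<^sup>2 * x$2 + x$0 * (b0 * (x$2)\<^sup>2 + b2 * (x$3)\<^sup>2)
    + x$1 * (b3 * (x$2)\<^sup>2 + b4 * x$2 * x$3 + b5 * (x$3)\<^sup>2)"

text \<open>With q and r taken at (s^2, t^2) this is s q + t r, the coefficient left when the
  surface equation is restricted to \<open>cross_line s t\<close>. The conic discriminant at (s^2,
  t^2) is its product with s q - t r.\<close>

definition quintic :: "rat \<Rightarrow> rat \<Rightarrow> rat" where
  "quintic s t = b0 * s^5 + b3 * s^4 * t + b4 * s\<^sup>2 * t^3 + b2 * s * t^4 + b5 * t^5"

lemma on_surface_form: "on_surface L \<longleftrightarrow> proj_line L \<and> (\<forall>x\<in>L. form x = 0)"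
proof -
  have "cubic_eval (two_line_cubic b0 b2 b3 b4 b5) x = form x" for x
    unfolding cubic_eval_two_line form_def by simp
  then show ?thesis unfolding on_surface_def polar_diag by simp
qed

lemma rat_lines: "rat_lines_on (two_line_cubic b0 b2 b3 b4 b5) = {L. on_surface L}"
  by (rule rat_lines_on_eq[OF smooth])

lemma coordinate_lines:
  "on_surface line_01" "on_surface line_23" "line_01 \<noteq> line_23" "\<not> meets line_01 line_23"
proof -
  show "on_surface line_01" "on_surface line_23"
    unfolding on_surface_form using proj_line_coordinate by (auto simp: form_def line_01_def line_23_def)
  have "vec4 1 0 0 0 \<in> line_01" "vec4 1 0 0 0 \<notin> line_23" unfolding line_01_def line_23_def by auto
  then show "line_01 \<noteq> line_23" by blast
  show "\<not> meets line_01 line_23" unfolding meets_def line_01_def line_23_def by (auto simp: vec4_eq_iff)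
qed

text \<open>Chosen so that the terms \<open>x0^2 x3 - x1^2 x2\<close> cancel.\<close>

definition cross_line :: "rat \<Rightarrow> rat \<Rightarrow> (rat^4) set" where
  "cross_line s t = vec.span {vec4 s t 0 0, vec4 0 0 (s\<^sup>2) (t\<^sup>2)}"

lemma cross_line_span:
  assumes "s \<noteq> 0 \<or> t \<noteq> 0"
  shows "vec4 s t 0 0 \<noteq> 0" "vec4 0 0 (s\<^sup>2) (t\<^sup>2) \<notin> vec.span {vec4 s t 0 0}" "vec4 0 0 (s\<^sup>2) (t\<^sup>2) \<noteq> 0"
  using assms by (auto simp: vec.span_singleton vec4_eq_iff)

lemma cross_line_common:
  assumes st: "s \<noteq> 0 \<or> t \<noteq> 0" and root: "quintic s t = 0"
  shows "cross_line s t \<in> common line_01 line_23"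
proof -
  have "form (a *s vec4 s t 0 0 + b *s vec4 0 0 (s\<^sup>2) (t\<^sup>2)) = a * b\<^sup>2 * quintic s t" for a b
    unfolding form_def quintic_def by (simp add: algebra_simps power_mult_distrib eval_nat_numeral)
  then have "form x = 0" if "x \<in> cross_line s t" for x
    using that root unfolding cross_line_def span2 by auto
  then have os: "on_surface (cross_line s t)"
    unfolding on_surface_form cross_line_def using proj_line_span[OF cross_line_span(1,2)[OF st]] by blast
  have m: "vec4 s t 0 0 \<in> cross_line s t" "vec4 0 0 (s\<^sup>2) (t\<^sup>2) \<in> cross_line s t"
    unfolding cross_line_def by (simp_all add: vec.span_base)
  have n: "vec4 s t 0 0 \<in> line_01" "vec4 s t 0 0 \<notin> line_23"
    "vec4 0 0 (s\<^sup>2) (t\<^sup>2) \<in> line_23" "vec4 0 0 (s\<^sup>2) (t\<^sup>2) \<notin> line_01"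
    using st unfolding line_01_def line_23_def by auto
  have "meets line_01 (cross_line s t)" "meets line_23 (cross_line s t)"
    unfolding meets_def using os coordinate_lines(1,2) m n cross_line_span[OF st] by metis+
  then show ?thesis unfolding common_def by blast
qed

lemma common_cross_line:
  assumes "L \<in> common line_01 line_23"
  shows "(\<exists>t. quintic t 1 = 0 \<and> L = cross_line t 1) \<or> b0 = 0 \<and> L = cross_line 1 0"
proof -
  have m: "meets line_01 L" "meets line_23 L" using assms unfolding common_def by auto
  have L: "proj_line L" and F: "\<And>x. x \<in> L \<Longrightarrow> form x = 0"
    using m unfolding meets_def on_surface_form by auto
  obtain p where p: "p \<in> L" "p \<noteq> 0" "p$2 = 0" "p$3 = 0" using m(1) unfolding meets_def line_01_def by auto
  obtain q where q: "q \<in> L" "q \<noteq> 0" "q$0 = 0" "q$1 = 0" using m(2) unfolding meets_def line_23_def by auto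
  have sc: "k *s x \<in> L" if "x \<in> L" for k x using proj_line_lincomb[OF L that that, of k 0] by simp
  have "p + q \<in> L" "p - q \<in> L"
    using proj_line_lincomb[OF L p(1) q(1), of 1 1] proj_line_lincomb[OF L p(1) q(1), of 1 "-1"] by simp_all
  \<comment> \<open>The sum and difference separate the part quadratic in \<open>p\<close> from the
    part quadratic in \<open>q\<close>.\<close>
  from F[OF this(1)] F[OF this(2)]
  have e: "(p$0)\<^sup>2 * q$3 = (p$1)\<^sup>2 * q$2"
    "p$0 * (b0 * (q$2)\<^sup>2 + b2 * (q$3)\<^sup>2) + p$1 * (b3 * (q$2)\<^sup>2 + b4 * q$2 * q$3 + b5 * (q$3)\<^sup>2) = 0"
    unfolding form_def using p q by simp_all
  have eq: "L = cross_line s t"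
    if "s \<noteq> 0 \<or> t \<noteq> 0" "vec4 s t 0 0 \<in> L" "vec4 0 0 (s\<^sup>2) (t\<^sup>2) \<in> L" for s t
    unfolding cross_line_def using proj_line_eq_span[OF L that(2,3) cross_line_span(1,2)[OF that(1)]] .
  show ?thesis
  proof (cases "p$1 = 0")
    case True
    then have p0: "p$0 \<noteq> 0" using p by (auto simp: vec4_eq_iff)
    then have q3: "q$3 = 0" using e(1) True by simp
    then have q2: "q$2 \<noteq> 0" using q by (auto simp: vec4_eq_iff)
    have b: "b0 = 0" using e(2) True q3 p0 q2 by simp
    have "(1 / p$0) *s p = vec4 1 0 0 0" "(1 / q$2) *s q = vec4 0 0 (1\<^sup>2) (0\<^sup>2)"
      using p q p0 q2 q3 True by (auto simp: vec4_eq_iff)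
    then have "L = cross_line 1 0" using eq[of 1 0] sc[OF p(1)] sc[OF q(1)] by (metis zero_neq_one)
    then show ?thesis using b by simp
  next
    case False
    define t where "t = p$0 / p$1"
    have pt: "p$0 = t * p$1" unfolding t_def using False by simp
    have "(p$1)\<^sup>2 * (t\<^sup>2 * q$3 - q$2) = 0" using e(1) unfolding pt by algebra
    then have q2: "q$2 = t\<^sup>2 * q$3" using False by simp
    then have q3: "q$3 \<noteq> 0" using q by (auto simp: vec4_eq_iff)
    have "p$1 * (q$3)\<^sup>2 * quintic t 1 = t * p$1 * (b0 * (t\<^sup>2 * q$3)\<^sup>2 + b2 * (q$3)\<^sup>2)
        + p$1 * (b3 * (t\<^sup>2 * q$3)\<^sup>2 + b4 * (t\<^sup>2 * q$3) * q$3 + b5 * (q$3)\<^sup>2)"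
      unfolding quintic_def by (simp add: algebra_simps eval_nat_numeral)
    then have "p$1 * (q$3)\<^sup>2 * quintic t 1 = 0" using e(2) unfolding pt q2 by simp
    then have r: "quintic t 1 = 0" using False q3 by simp
    have "(1 / p$1) *s p = vec4 t 1 0 0" "(1 / q$3) *s q = vec4 0 0 (t\<^sup>2) (1\<^sup>2)"
      using p q pt q2 q3 False by (auto simp: vec4_eq_iff)
    then have "L = cross_line t 1" using eq[of t 1] sc[OF p(1)] sc[OF q(1)] by (metis zero_neq_one)
    then show ?thesis using r by blast
  qed
qed

lemma cross_line_inject:
  assumes "cross_line s t = cross_line s' t'"
  shows "s * t' = s' * t"
proof -
  have "vec4 s t 0 0 \<in> cross_line s t" unfolding cross_line_def by (simp add: vec.span_base)
  then have "vec4 s t 0 0 \<in> cross_line s' t'" unfolding assms .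
  then obtain a b where "vec4 s t 0 0 = a *s vec4 s' t' 0 0 + b *s vec4 0 0 (s'\<^sup>2) (t'\<^sup>2)"
    unfolding cross_line_def span2 by blast
  then have "s = a * s'" "t = a * t'" by (auto simp: vec4_eq_iff)
  then show ?thesis by simp
qed

text \<open>Setting the second coordinate to 1 loses the point (1 : 0), which is a root exactly when
  \<open>b0 = 0\<close>.\<close>

lemma card_common_lines:
  assumes "finite {t. quintic t 1 = 0}"
  shows "card (common line_01 line_23) = card {t. quintic t 1 = 0} + (if b0 = 0 then 1 else 0)"
proof -
  let ?A = "(\<lambda>t. cross_line t 1) ` {t. quintic t 1 = 0}" and ?B = "if b0 = 0 then {cross_line 1 0} else {}"
  have "common line_01 line_23 = ?A \<union> ?B"
  proof (rule subset_antisym)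
    show "common line_01 line_23 \<subseteq> ?A \<union> ?B" using common_cross_line by auto
    have "quintic 1 0 = b0" unfolding quintic_def by simp
    then show "?A \<union> ?B \<subseteq> common line_01 line_23"
      using cross_line_common[of _ 1] cross_line_common[of 1 0] by auto
  qed
  moreover have "?A \<inter> ?B = {}" using cross_line_inject[of _ 1 1 0] by (auto split: if_splits)
  moreover have "inj_on (\<lambda>t. cross_line t 1) {t. quintic t 1 = 0}"
    using cross_line_inject[of _ 1 _ 1] by (auto intro!: inj_onI)
  ultimately show ?thesis using assms by (simp add: card_Un_disjoint card_image)
qed

text \<open>A line missing \<open>line_23\<close> is a graph x2 = \<alpha> x0 + \<beta> x1, x3 =
  \<gamma> x0 + \<delta> x1. The four equations are the coefficients of the form restricted to it,
  and missing \<open>line_01\<close> excludes \<alpha> = \<gamma> = 0.\<close>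

lemma graph_line:
  assumes z: "on_surface z" "z \<noteq> line_01" "z \<noteq> line_23" "\<not> meets line_01 z" "\<not> meets line_23 z"
  obtains \<alpha> \<beta> \<gamma> \<delta> where "\<not> (\<alpha> = 0 \<and> \<gamma> = 0)"
    "\<gamma> + b0 * \<alpha>\<^sup>2 + b2 * \<gamma>\<^sup>2 = 0"
    "\<delta> + 2 * b0 * \<alpha> * \<beta> + 2 * b2 * \<gamma> * \<delta> + b3 * \<alpha>\<^sup>2 + b4 * \<alpha> * \<gamma> + b5 * \<gamma>\<^sup>2 = 0"
    "- \<alpha> + b0 * \<beta>\<^sup>2 + b2 * \<delta>\<^sup>2 + 2 * b3 * \<alpha> * \<beta> + b4 * (\<alpha> * \<delta> + \<beta> * \<gamma>) + 2 * b5 * \<gamma> * \<delta> = 0"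
    "- \<beta> + b3 * \<beta>\<^sup>2 + b4 * \<beta> * \<delta> + b5 * \<delta>\<^sup>2 = 0"
proof -
  have L: "proj_line z" and F: "\<And>x. x \<in> z \<Longrightarrow> form x = 0" using z(1) unfolding on_surface_form by auto
  have sk: "x = 0" if "x \<in> line_01" "x \<in> z" for x
    using skew_zero[OF coordinate_lines(1) z(1) z(2)[symmetric] z(4) that] .
  have sk': "x = 0" if "x \<in> line_23" "x \<in> z" for x
    using skew_zero[OF coordinate_lines(2) z(1) z(3)[symmetric] z(5) that] .
  obtain l m where m: "l \<in> line_23" "m \<in> z" "vec4 1 0 0 0 = l + m"
    using skew_sum[OF proj_line_coordinate(2) L sk'] by metis
  obtain l' n where n: "l' \<in> line_23" "n \<in> z" "vec4 0 1 0 0 = l' + n"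
    using skew_sum[OF proj_line_coordinate(2) L sk'] by metis
  have c: "m$0 = 1" "m$1 = 0" "n$0 = 0" "n$1 = 1"
    using m(1,3) n(1,3) unfolding line_23_def by (simp_all add: vec4_eq_iff)
  have "m + n \<in> z" "m - n \<in> z"
    using proj_line_lincomb[OF L m(2) n(2), of 1 1] proj_line_lincomb[OF L m(2) n(2), of 1 "-1"] by simp_all
  note e = F[OF m(2)] F[OF n(2)] F[OF this(1)] F[OF this(2)]
  have "\<not> (m$2 = 0 \<and> m$3 = 0)"
  proof
    assume "m$2 = 0 \<and> m$3 = 0"
    then have "m = 0" using sk[OF _ m(2)] unfolding line_01_def by simp
    then show False using c by simp
  qed
  moreover have "m$3 + b0 * (m$2)\<^sup>2 + b2 * (m$3)\<^sup>2 = 0" "- n$2 + b3 * (n$2)\<^sup>2 + b4 * n$2 * n$3 + b5 * (n$3)\<^sup>2 = 0"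
    using e(1,2) c unfolding form_def by simp_all
  moreover have "n$3 + 2 * b0 * m$2 * n$2 + 2 * b2 * m$3 * n$3 + b3 * (m$2)\<^sup>2 + b4 * m$2 * m$3 + b5 * (m$3)\<^sup>2 = 0"
    "- m$2 + b0 * (n$2)\<^sup>2 + b2 * (n$3)\<^sup>2 + 2 * b3 * m$2 * n$2 + b4 * (m$2 * n$3 + n$2 * m$3) + 2 * b5 * m$3 * n$3 = 0"
    using e c unfolding form_def by simp_all algebra+
  ultimately show ?thesis using that by blast
qed

lemma card_rat_lines_two_common:
  assumes "card (common line_01 line_23) \<ge> 2"
  shows "finite (rat_lines_on (two_line_cubic b0 b2 b3 b4 b5))"
    "card (rat_lines_on (two_line_cubic b0 b2 b3 b4 b5)) = 6 * card (common line_01 line_23) - 3"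
  using card_two_common[OF _ _ coordinate_lines(3,4) assms] coordinate_lines(1,2) unfolding rat_lines by simp_all

end

section \<open>Rational roots and the explicit surfaces with 2, 5, 7, 9, 15 and 27 lines\<close>

lemma integral_root:
  fixes y :: rat and a b c d :: int
  assumes y: "y^4 + of_int a * y^3 + of_int b * y\<^sup>2 + of_int c * y + of_int d = 0"
  obtains n where "y = of_int n" "n dvd d"
proof -
  obtain p q :: int where pq: "y = of_int p / of_int q" "q > 0" "coprime p q"
    by (metis quotient_of_unique quotient_of_div quotient_of_denom_pos quotient_of_coprime prod.collapse)
  have yq: "y * of_int q = of_int p" using pq by simp
  have "(of_int p)^4 + of_int a * (of_int p)^3 * of_int q + of_int b * (of_int p)\<^sup>2 * (of_int q)\<^sup>2
      + of_int c * of_int p * (of_int q)^3 + of_int d * (of_int q)^4 = (0 :: rat)"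
    using y unfolding yq[symmetric] by algebra
  then have "(of_int (p^4 + q * (a * p^3 + b * p\<^sup>2 * q + c * p * q\<^sup>2 + d * q^3)) :: rat) = of_int 0"
    by (simp add: algebra_simps eval_nat_numeral)
  then have e: "p^4 + q * (a * p^3 + b * p\<^sup>2 * q + c * p * q\<^sup>2 + d * q^3) = 0"
    by (simp only: of_int_eq_iff)
  then have "q dvd p^4" by (metis dvd_0_right dvd_add_left_iff dvd_triv_left)
  moreover have "coprime (p^4) q" using pq(3) by simp
  ultimately have "is_unit q" using coprime_common_divisor[of "p^4" q q] by simp
  then have q1: "q = 1" using pq(2) by simp
  have "p * (p^3 + a * p\<^sup>2 + b * p + c) + d = 0"
    using e unfolding q1 by (simp add: algebra_simps eval_nat_numeral)
  then have "p dvd d" by (metis dvd_0_right dvd_add_right_iff dvd_triv_left)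
  then show ?thesis using that[of p] pq(1) q1 by simp
qed

lemma dvd_1_2_cases:
  fixes n :: int
  shows "n dvd 1 \<Longrightarrow> n = 1 \<or> n = -1" "n dvd 2 \<Longrightarrow> n = 1 \<or> n = -1 \<or> n = 2 \<or> n = -2"
proof -
  show "n dvd 1 \<Longrightarrow> n = 1 \<or> n = -1" by (auto simp: zdvd1_eq)
  assume n: "n dvd 2"
  then have "\<bar>n\<bar> \<le> 2" using zdvd_imp_le[of "\<bar>n\<bar>" 2] by simp
  moreover have "n \<noteq> 0" using n by auto
  ultimately show "n = 1 \<or> n = -1 \<or> n = 2 \<or> n = -2" by linarith
qed

text \<open>Together with the root at infinity these give f = 1, 1, 2, 3, 5. The two cases with f =
  1 are separated by a third skew line.\<close>

lemma quartic_roots: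
  "{t :: rat. t^4 + t + 1 = 0} = {}"
  "{t :: rat. t^4 + 3 * t - 2 = 0} = {}"
  "{t :: rat. t^4 + t - 2 = 0} = {1}"
  "{t :: rat. t^4 - t = 0} = {0, 1}"
  "{t :: rat. t^4 - 7 * t\<^sup>2 + 6 * t = 0} = {0, 1, 2, -3}"
proof -
  have "False" if t: "t^4 + t + 1 = 0" for t :: rat
  proof -
    obtain n where "t = of_int n" "n dvd 1" using integral_root[of t 0 0 1 1] t by auto
    then show False using t dvd_1_2_cases(1)[of n] by auto
  qed
  then show "{t :: rat. t^4 + t + 1 = 0} = {}" by auto
  have "False" if t: "t^4 + 3 * t - 2 = 0" for t :: rat
  proof -
    obtain n where "t = of_int n" "n dvd -2" using integral_root[of t 0 0 3 "-2"] t by auto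
    then show False using t dvd_1_2_cases(2)[of n] by auto
  qed
  then show "{t :: rat. t^4 + 3 * t - 2 = 0} = {}" by auto
  have "t = 1" if t: "t^4 + t - 2 = 0" for t :: rat
  proof -
    obtain n where "t = of_int n" "n dvd -2" using integral_root[of t 0 0 1 "-2"] t by auto
    then show ?thesis using t dvd_1_2_cases(2)[of n] by auto
  qed
  then show "{t :: rat. t^4 + t - 2 = 0} = {1}" by auto
  have "t = 0 \<or> t = 1" if t: "t^4 - t = 0" for t :: rat
  proof -
    have "t * (t - 1) * ((2 * t + 1)\<^sup>2 + 3) = 0" using t by algebra
    moreover have "(2 * t + 1)\<^sup>2 + 3 \<noteq> 0" using zero_le_power2[of "2 * t + 1"] by linarith
    ultimately show ?thesis by simp
  qed
  then show "{t :: rat. t^4 - t = 0} = {0, 1}" by auto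
  have "t \<in> {0, 1, 2, -3}" if t: "t^4 - 7 * t\<^sup>2 + 6 * t = 0" for t :: rat
  proof -
    have "t * (t - 1) * (t - 2) * (t + 3) = 0" using t by algebra
    then show ?thesis by (auto simp: add_eq_0_iff)
  qed
  then show "{t :: rat. t^4 - 7 * t\<^sup>2 + 6 * t = 0} = {0, 1, 2, -3}" by auto
qed

lemma card_lines_quintic:
  "finite (rat_lines_on (two_line_cubic 1 0 0 0 (-2)))" "card (rat_lines_on (two_line_cubic 1 0 0 0 (-2))) = 2"
proof -
  interpret two_line_surface 1 0 0 0 "-2" by (unfold_locales) (rule smooth_two_line_quintic)
  have no_root: "{t. quintic t 1 = 0} = {}"
    using rat_power_ne_2[of 5] unfolding quintic_def by auto
  have "card (common line_01 line_23) = 0"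
    using card_common_lines unfolding no_root by simp
  moreover have "finite (common line_01 line_23)"
    using card_common(1) coordinate_lines by auto
  ultimately have none: "common line_01 line_23 = {}" by simp
  have no_third: "\<not> (\<exists>z\<in>{L. on_surface L}. z \<noteq> line_01 \<and> z \<noteq> line_23 \<and> \<not> meets line_01 z \<and> \<not> meets line_23 z)"
  proof
    assume "\<exists>z\<in>{L. on_surface L}. z \<noteq> line_01 \<and> z \<noteq> line_23 \<and> \<not> meets line_01 z \<and> \<not> meets line_23 z"
    then obtain z where z: "on_surface z" "z \<noteq> line_01" "z \<noteq> line_23" "\<not> meets line_01 z" "\<not> meets line_23 z" by blast
    obtain \<alpha> \<beta> \<gamma> \<delta> :: rat where nz: "\<not> (\<alpha> = 0 \<and> \<gamma> = 0)" and
      e: "\<gamma> + 1 * \<alpha>\<^sup>2 + 0 * \<gamma>\<^sup>2 = 0"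
    "\<delta> + 2 * 1 * \<alpha> * \<beta> + 2 * 0 * \<gamma> * \<delta> + 0 * \<alpha>\<^sup>2 + 0 * \<alpha> * \<gamma> + - 2 * \<gamma>\<^sup>2 = 0"
    "- \<alpha> + 1 * \<beta>\<^sup>2 + 0 * \<delta>\<^sup>2 + 2 * 0 * \<alpha> * \<beta> + 0 * (\<alpha> * \<delta> + \<beta> * \<gamma>) + 2 * - 2 * \<gamma> * \<delta> = 0"
    "- \<beta> + 0 * \<beta>\<^sup>2 + 0 * \<beta> * \<delta> + - 2 * \<delta>\<^sup>2 = 0"
      using graph_line[OF z] .
    have gb: "\<gamma> = - \<alpha>\<^sup>2" "\<beta> = - 2 * \<delta>\<^sup>2" using e(1,4) by simp_all
    \<comment> \<open>\<alpha> times the second plus \<delta> times the third equation cancels all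
      but the fifth powers.\<close>
    have "2 * (\<alpha>^5 - 2 * \<delta>^5) = 0" using e(2,3) unfolding gb by algebra
    then have ad: "\<alpha>^5 = 2 * \<delta>^5" by simp
    have "\<delta> \<noteq> 0" using ad nz gb by auto
    then have "(\<alpha> / \<delta>)^5 = 2" using ad by (simp add: power_divide)
    then show False using rat_power_ne_2[of 5] by simp
  qed
  show "finite (rat_lines_on (two_line_cubic 1 0 0 0 (-2)))" "card (rat_lines_on (two_line_cubic 1 0 0 0 (-2))) = 2"
    using card_no_common[OF _ _ coordinate_lines(3,4) none] coordinate_lines(1,2) no_third
    unfolding rat_lines by simp_all
qed

lemma quartic_surface:
  assumes "u \<noteq> 0" "27 * u^4 \<noteq> 256 * v^3"
  shows "two_line_surface 0 u 1 0 v" "two_line_surface.quintic 0 u 1 0 v t 1 = t^4 + u * t + v"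
proof -
  show s: "two_line_surface 0 u 1 0 v" by unfold_locales (rule smooth_two_line_quartic[OF assms])
  show "two_line_surface.quintic 0 u 1 0 v t 1 = t^4 + u * t + v"
    unfolding two_line_surface.quintic_def[OF s] by simp
qed

lemma card_lines_quartic_1_1:
  "finite (rat_lines_on (two_line_cubic 0 1 1 0 1))" "card (rat_lines_on (two_line_cubic 0 1 1 0 1)) = 5"
proof -
  interpret two_line_surface 0 1 1 0 1 by (rule quartic_surface) simp_all
  have roots: "{t. quintic t 1 = 0} = {}"
    using quartic_roots(1) unfolding quintic_def by simp
  have one: "card (common line_01 line_23) = 1"
    using card_common_lines unfolding roots by simp
  have no_third: "\<not> (\<exists>z\<in>{L. on_surface L}. z \<noteq> line_01 \<and> z \<noteq> line_23 \<and> \<not> meets line_01 z \<and> \<not> meets line_23 z)"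
  proof
    assume "\<exists>z\<in>{L. on_surface L}. z \<noteq> line_01 \<and> z \<noteq> line_23 \<and> \<not> meets line_01 z \<and> \<not> meets line_23 z"
    then obtain z where z: "on_surface z" "z \<noteq> line_01" "z \<noteq> line_23" "\<not> meets line_01 z" "\<not> meets line_23 z" by blast
    obtain \<alpha> \<beta> \<gamma> \<delta> :: rat where nz: "\<not> (\<alpha> = 0 \<and> \<gamma> = 0)" and
      e: "\<gamma> + 0 * \<alpha>\<^sup>2 + 1 * \<gamma>\<^sup>2 = 0"
    "\<delta> + 2 * 0 * \<alpha> * \<beta> + 2 * 1 * \<gamma> * \<delta> + 1 * \<alpha>\<^sup>2 + 0 * \<alpha> * \<gamma> + 1 * \<gamma>\<^sup>2 = 0"
    "- \<alpha> + 0 * \<beta>\<^sup>2 + 1 * \<delta>\<^sup>2 + 2 * 1 * \<alpha> * \<beta> + 0 * (\<alpha> * \<delta> + \<beta> * \<gamma>) + 2 * 1 * \<gamma> * \<delta> = 0"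
    "- \<beta> + 1 * \<beta>\<^sup>2 + 0 * \<beta> * \<delta> + 1 * \<delta>\<^sup>2 = 0"
      using graph_line[OF z] .
    have "\<gamma> * (1 + \<gamma>) = 0" using e(1) by algebra
    then consider "\<gamma> = 0" | "\<gamma> = -1" by (auto simp: add_eq_0_iff)
    then show False
    proof cases
      case 1
      have a0: "\<alpha> \<noteq> 0" using nz 1 by simp
      have d: "\<delta> = - \<alpha>\<^sup>2" using e(2) 1 by simp
      have "\<alpha> * (\<alpha>^3 + 2 * \<beta> - 1) = 0" using e(3) unfolding 1 d by algebra
      then have b: "2 * \<beta> = 1 - \<alpha>^3" using a0 by simp
      define z where "z = \<alpha>\<^sup>2"
      have cz: "z^3 + 4 * z\<^sup>2 - 1 = 0" using e(4) b unfolding d z_def by algebra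
      \<comment> \<open>The factor z + 1 raises the cubic to a monic quartic, the shape that
        \<open>integral_root\<close> treats.\<close>
      have "z^4 + of_int 5 * z^3 + of_int 4 * z\<^sup>2 + of_int (-1) * z + of_int (-1)
          = (z + 1) * (z^3 + 4 * z\<^sup>2 - 1)"
        by (simp add: algebra_simps eval_nat_numeral)
      also have "\<dots> = 0" unfolding cz by simp
      finally obtain n where n: "z = of_int n" "n dvd -1" by (rule integral_root)
      have "z = 1 \<or> z = -1" using n dvd_1_2_cases(1)[of n] by auto
      moreover have "z \<ge> 0" unfolding z_def by simp
      ultimately show False using cz by auto
    next
      case 2
      have d: "\<delta> = 1 + \<alpha>\<^sup>2" using e(2) unfolding 2 by simp
      then have "1 \<le> \<delta>" by simp
      then have "1 \<le> \<delta>\<^sup>2" by simp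
      \<comment> \<open>The last equation with the square in \<beta> completed; \<delta> >= 1 leaves
        no real solution.\<close>
      moreover have "(2 * \<beta> - 1)\<^sup>2 + 4 * \<delta>\<^sup>2 = 1" using e(4) by algebra
      ultimately show False using zero_le_power2[of "2 * \<beta> - 1"] by linarith
    qed
  qed
  show "finite (rat_lines_on (two_line_cubic 0 1 1 0 1))" "card (rat_lines_on (two_line_cubic 0 1 1 0 1)) = 5"
    using card_one_common[OF _ _ coordinate_lines(3,4) one] coordinate_lines(1,2) no_third
    unfolding rat_lines by simp_all
qed

lemma card_lines_quartic_3_2:
  "finite (rat_lines_on (two_line_cubic 0 3 1 0 (-2)))" "card (rat_lines_on (two_line_cubic 0 3 1 0 (-2))) = 7"
proof -
  interpret two_line_surface 0 3 1 0 "-2" by (rule quartic_surface) simp_all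
  have roots: "{t. quintic t 1 = 0} = {}"
    using quartic_roots(2) unfolding quintic_def by (simp add: algebra_simps)
  have one: "card (common line_01 line_23) = 1"
    using card_common_lines unfolding roots by simp
  \<comment> \<open>The solution \<alpha> = 1, \<beta> = -1, \<gamma> = 0, \<delta> = -1 of the
    system in \<open>graph_line\<close>; prescribing \<alpha> = 1, \<beta> = -1, \<gamma> = 0 forces
    u = 3 and v = -2.\<close>
  let ?z = "vec.span {vec4 1 0 1 0, vec4 0 1 (-1) (-1)}"
  have mem: "x \<in> ?z \<longleftrightarrow> x$2 = x$0 - x$1 \<and> x$3 = - x$1" for x
    unfolding span2 by (auto simp: vec4_eq_iff)
  have "proj_line ?z"
    by (rule proj_line_span; auto simp: vec.span_singleton vec4_eq_iff)
  moreover have "form x = 0" if "x \<in> ?z" for x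
  proof -
    have e: "x$2 = x$0 - x$1" "x$3 = - x$1" using that unfolding mem by auto
    show ?thesis unfolding form_def e by (simp add: power2_eq_square algebra_simps)
  qed
  ultimately have z: "on_surface ?z" unfolding on_surface_form by blast
  have skew: "x = 0" if "x \<in> ?z" "x \<in> line_01 \<or> x \<in> line_23" for x
    using that unfolding mem line_01_def line_23_def by (auto simp: vec4_eq_iff)
  have "vec4 1 0 1 0 \<in> ?z" "vec4 1 0 1 0 \<notin> line_01" "vec4 1 0 1 0 \<notin> line_23"
    unfolding mem line_01_def line_23_def by auto
  then have "?z \<noteq> line_01 \<and> ?z \<noteq> line_23 \<and> \<not> meets line_01 ?z \<and> \<not> meets line_23 ?z"
    using skew unfolding meets_def by blast
  then have "\<exists>z\<in>{L. on_surface L}. z \<noteq> line_01 \<and> z \<noteq> line_23 \<and> \<not> meets line_01 z \<and> \<not> meets line_23 z"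
    using z by blast
  then show "finite (rat_lines_on (two_line_cubic 0 3 1 0 (-2)))" "card (rat_lines_on (two_line_cubic 0 3 1 0 (-2))) = 7"
    using card_one_common[OF _ _ coordinate_lines(3,4) one] coordinate_lines(1,2)
    unfolding rat_lines by simp_all
qed

lemma card_lines_quartic_1_2:
  "finite (rat_lines_on (two_line_cubic 0 1 1 0 (-2)))" "card (rat_lines_on (two_line_cubic 0 1 1 0 (-2))) = 9"
proof -
  interpret two_line_surface 0 1 1 0 "-2" by (rule quartic_surface) simp_all
  have roots: "{t. quintic t 1 = 0} = {1}"
    using quartic_roots(3) unfolding quintic_def by (simp add: algebra_simps)
  have "card (common line_01 line_23) = 2"
    using card_common_lines unfolding roots by simp
  then show "finite (rat_lines_on (two_line_cubic 0 1 1 0 (-2)))" "card (rat_lines_on (two_line_cubic 0 1 1 0 (-2))) = 9"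
    using card_rat_lines_two_common by simp_all
qed

lemma card_lines_quartic_1_0:
  "finite (rat_lines_on (two_line_cubic 0 (-1) 1 0 0))" "card (rat_lines_on (two_line_cubic 0 (-1) 1 0 0)) = 15"
proof -
  interpret two_line_surface 0 "-1" 1 0 0 by (rule quartic_surface) simp_all
  have roots: "{t. quintic t 1 = 0} = {0, 1}"
    using quartic_roots(4) unfolding quintic_def by (simp add: algebra_simps)
  have "card (common line_01 line_23) = 3"
    using card_common_lines unfolding roots by simp
  then show "finite (rat_lines_on (two_line_cubic 0 (-1) 1 0 0))" "card (rat_lines_on (two_line_cubic 0 (-1) 1 0 0)) = 15"
    using card_rat_lines_two_common by simp_all
qed

lemma card_lines_split:
  "finite (rat_lines_on (two_line_cubic 0 6 1 (-7) 0))" "card (rat_lines_on (two_line_cubic 0 6 1 (-7) 0)) = 27"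
proof -
  interpret two_line_surface 0 6 1 "-7" 0 by unfold_locales (rule smooth_two_line_split)
  have roots: "{t. quintic t 1 = 0} = {0, 1, 2, -3}"
    using quartic_roots(5) unfolding quintic_def by (simp add: algebra_simps)
  have "card (common line_01 line_23) = 5"
    using card_common_lines unfolding roots by simp
  then show "finite (rat_lines_on (two_line_cubic 0 6 1 (-7) 0))" "card (rat_lines_on (two_line_cubic 0 6 1 (-7) 0)) = 27"
    using card_rat_lines_two_common by simp_all
qed


theorem theorem1p1:
  shows "(\<forall>c. smooth_cubic c \<longrightarrow>
            finite (rat_lines_on c) \<and>
            card (rat_lines_on c) \<in> {0, 1, 2, 3, 5, 7, 9, 15, 27}) \<and>
         (\<forall>n \<in> {0, 1, 2, 3, 5, 7, 9, 15, 27}.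
            \<exists>c. smooth_cubic c \<and> finite (rat_lines_on c) \<and> card (rat_lines_on c) = n)"
proof (intro conjI allI impI)
  fix c assume c: "smooth_cubic c"
  show "finite (rat_lines_on c)" "card (rat_lines_on c) \<in> {0, 1, 2, 3, 5, 7, 9, 15, 27}"
    using card_rat_lines_on[OF c] by auto
next
  let ?P = "\<lambda>n. \<exists>c. smooth_cubic c \<and> finite (rat_lines_on c) \<and> card (rat_lines_on c) = n"
  have "?P 0" using smooth_diagonal[of 1 2] rat_lines_on_diagonal(1)
    by (intro exI[of _ "diagonal_cubic 1 2"]) simp
  moreover have "?P 1" using smooth_diagonal[of 2 2] rat_lines_on_diagonal(2)
    by (intro exI[of _ "diagonal_cubic 2 2"]) simp
  moreover have "?P 2" using smooth_two_line_quintic card_lines_quintic by blast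
  moreover have "?P 3" using smooth_diagonal[of 1 1] rat_lines_on_diagonal(3) pair_lines_distinct
    by (intro exI[of _ "diagonal_cubic 1 1"]) simp
  moreover have "?P 5" using smooth_two_line_quartic[of 1 1] card_lines_quartic_1_1 by auto
  moreover have "?P 7" using smooth_two_line_quartic[of 3 "-2"] card_lines_quartic_3_2 by auto
  moreover have "?P 9" using smooth_two_line_quartic[of 1 "-2"] card_lines_quartic_1_2 by auto
  moreover have "?P 15" using smooth_two_line_quartic[of "-1" 0] card_lines_quartic_1_0 by auto
  moreover have "?P 27" using smooth_two_line_split card_lines_split by blast
  ultimately show "\<forall>n\<in>{0, 1, 2, 3, 5, 7, 9, 15, 27}. ?P n" by blast
qed

end
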